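(* Let $\mathfrak g$ be a simple finite-dimensional Lie algebra, $f\in\mathfrak g$ a minimal nilpotent element, included in an $\mathfrak{sl}_2$-triple $\{f,2x,e\}$. The classical $\mathcal W$-algebra $\mathcal W$ associated to $f$ is the algebra of differential polynomials with the following generators: the element $$L=f+x'+\frac12\sum_{j\in J_0}a_ja^j+\sum_{k\in J_{1/2}}v^k[f,v_k]+\frac12\sum_{k\in J_{1/2}}v^k\partial v_k ,$$ and the elements of conformal weight $1$ and $\frac32$ given by the following bijective linear maps: $$\varphi:\ \mathfrak g_0^f\to\mathcal W\{1\},\qquad \varphi(a)=a+\frac12\sum_{k\in J_{1/2}}[a,v_k]v^k,$$ and $$\psi:\ \mathfrak g_{-\frac12}\to\mathcal W\{\tfrac32\},\qquad \psi(u)=u+\frac13\sum_{h,k\in J_{1/2}}[[u,v_h],v_k]v^hv^k+\sum_{k\in J_{1/2}}[u,v_k]v^k+\partial[e,u].$$ (That is, if $a$ runs over a basis of $\mathfrak g_0^f$ and $u$ over a basis of $\mathfrak g_{-1/2}$, then $L$, the $\varphi(a)$'s and the $\psi(u)$'s, together with all their derivatives, are algebraically independent and generate $\mathcal W$.)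
   Context: The base field $\mathbb F$ is algebraically closed of characteristic $0$. $\mathfrak g$ carries a non-degenerate symmetric invariant bilinear form $(\cdot|\cdot)$. The triple satisfies $[e,f]=2x$, $[x,e]=e$, $[x,f]=-f$; $\mathfrak g_i$ is the $\mathrm{ad}\,x$-eigenspace of eigenvalue $i\in\frac12\mathbb Z$. $f$ is minimal if it is a root vector of a lowest root, equivalently $\mathfrak g=\mathbb Ff\oplus\mathfrak g_{-1/2}\oplus\mathfrak g_0\oplus\mathfrak g_{1/2}\oplus\mathbb Fe$. $\mathfrak g_0^f$ is the centralizer of $f$ in $\mathfrak g_0$. Bases: $\{a_j\}_{j\in J_0},\{a^j\}_{j\in J_0}$ are bases of $\mathfrak g_0$ dual with respect to $(\cdot|\cdot)$; $\{v_k\}_{k\in J_{1/2}},\{v^k\}_{k\in J_{1/2}}$ are bases of $\mathfrak g_{1/2}$ with $(f|[v_h,v^k])=\delta_{h,k}$. Classical $\mathcal W$-algebra: put $s=e$. Let $\mathcal V(\mathfrak g)=S(\mathbb F[\partial]\mathfrak g)$ be the algebra of differential polynomials over $\mathfrak g$ (derivation $\partial$, also written $'$), with the $\lambda$-bracket determined by $\{a_\lambda b\}_z=[a,b]+(a|b)\lambda+z(s|[a,b])$, $a,b\in\mathfrak g$ ($z\in\mathbb F$ or a formal variable), and the Poisson vertex algebra axioms: sesquilinearity $\{\partial g_\lambda h\}=-\lambda\{g_\lambda h\}$, $\{g_\lambda\partial h\}=(\partial+\lambda)\{g_\lambda h\}$; left Leibniz rule $\{g_\lambda h_1h_2\}=\{g_\lambda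 h_1\}h_2+\{g_\lambda h_2\}h_1$; right Leibniz rule $\{g_1g_{2\,\lambda}h\}=\{g_{1\,\lambda+\partial}h\}_\to g_2+\{g_{2\,\lambda+\partial}h\}_\to g_1$ (the arrow means that $\partial$ acts on the right). Let $\mathcal V(\mathfrak g_{\le\frac12})=S(\mathbb F[\partial]\mathfrak g_{\le\frac12})$ and let $\rho:\mathcal V(\mathfrak g)\to\mathcal V(\mathfrak g_{\le\frac12})$ be the differential algebra homomorphism with $\rho(a)=\pi_{\le\frac12}(a)+(f|a)$ for $a\in\mathfrak g$, where $\pi_{\le\frac12}$ is the projection $\mathfrak g\to\mathfrak g_{\le\frac12}$ with kernel $\mathfrak g_{\ge1}$. Then $\mathcal W=\{g\in\mathcal V(\mathfrak g_{\le\frac12})\mid\rho\{a_\lambda g\}_z=0\ \forall a\in\mathfrak g_{\ge\frac12}\}$, a differential subalgebra (independent of $z$). Conformal weight: on $\mathcal V(\mathfrak g_{\le\frac12})$, the monomial $b_1^{(m_1)}\cdots b_r^{(m_r)}$ with $b_i\in\mathfrak g_{1-\Delta_i}$ has conformal weight $\sum_i(\Delta_i+m_i)$; $\mathcal W\{\Delta\}$ is the subspace of elements of $\mathcal W$ of conformal weight $\Delta$. *)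

theory Defs
  imports
    "HOL-Library.Poly_Mapping"
    "HOL-Computational_Algebra.Polynomial"
begin

section \<open>Lie algebras\<close>

locale lie_algebra = vector_space scale
  for scale :: "'k::field \<Rightarrow> 'g::ab_group_add \<Rightarrow> 'g" +
  fixes lb :: "'g \<Rightarrow> 'g \<Rightarrow> 'g"
  assumes lb_add_left: "lb (a + b) c = lb a c + lb b c"
    and lb_add_right: "lb a (b + c) = lb a b + lb a c"
    and lb_scale_left: "lb (scale r a) b = scale r (lb a b)"
    and lb_scale_right: "lb a (scale r b) = scale r (lb a b)"
    and lb_self: "lb a a = 0"
    and jacobi: "lb a (lb b c) + lb b (lb c a) + lb c (lb a b) = 0"

definition simple_lie :: "('k::field \<Rightarrow> 'g::ab_group_add \<Rightarrow> 'g) \<Rightarrow> ('g \<Rightarrow> 'g \<Rightarrow> 'g) \<Rightarrow> bool" where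
  "simple_lie scale lb \<longleftrightarrow>
     lie_algebra scale lb \<and>
     (\<exists>a b. lb a b \<noteq> 0) \<and>
     (\<forall>I. module.subspace scale I \<and> (\<forall>a. \<forall>b\<in>I. lb a b \<in> I) \<longrightarrow> I = {0} \<or> I = UNIV)"

definition invariant_form ::
  "('k::field \<Rightarrow> 'g::ab_group_add \<Rightarrow> 'g) \<Rightarrow> ('g \<Rightarrow> 'g \<Rightarrow> 'g) \<Rightarrow> ('g \<Rightarrow> 'g \<Rightarrow> 'k) \<Rightarrow> bool" where
  "invariant_form scale lb \<kappa> \<longleftrightarrow>
     (\<forall>a b c. \<kappa> (a + b) c = \<kappa> a c + \<kappa> b c) \<and>
     (\<forall>r a b. \<kappa> (scale r a) b = r * \<kappa> a b) \<and>
     (\<forall>a b. \<kappa> a b = \<kappa> b a) \<and>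
     (\<forall>a b c. \<kappa> (lb a b) c = \<kappa> a (lb b c)) \<and>
     (\<forall>a. (\<forall>b. \<kappa> a b = 0) \<longrightarrow> a = 0)"

text \<open>The family \<open>b\<close>, indexed by \<open>J\<close>, is a basis of the subspace \<open>U\<close>.\<close>

definition is_basis ::
  "('k::field \<Rightarrow> 'g::ab_group_add \<Rightarrow> 'g) \<Rightarrow> 'j set \<Rightarrow> ('j \<Rightarrow> 'g) \<Rightarrow> 'g set \<Rightarrow> bool" where
  "is_basis scale J b U \<longleftrightarrow>
     inj_on b J \<and> \<not> module.dependent scale (b ` J) \<and> module.span scale (b ` J) = U"

subsection \<open>Lowest roots and minimal nilpotent elements\<close>

definition cartan_subalgebra ::
  "('k::field \<Rightarrow> 'g::ab_group_add \<Rightarrow> 'g) \<Rightarrow> ('g \<Rightarrow> 'g \<Rightarrow> 'g) \<Rightarrow> 'g set \<Rightarrow> bool" where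
  "cartan_subalgebra scale lb H \<longleftrightarrow>
     module.subspace scale H \<and>
     (\<forall>h\<in>H. \<forall>h'\<in>H. lb h h' = 0) \<and>
     (\<forall>h\<in>H. module.span scale {a. \<exists>c. lb h a = scale c a} = UNIV) \<and>
     {a. \<forall>h\<in>H. lb h a = 0} = H"

text \<open>
  A linear functional on \<open>H\<close> is represented by a function on the whole Lie algebra of which only
  the values on \<open>H\<close> matter.  Linearity on \<open>H\<close> is automatic for a function with a nonzero root space.
\<close>

definition root_space ::
  "('k::field \<Rightarrow> 'g::ab_group_add \<Rightarrow> 'g) \<Rightarrow> ('g \<Rightarrow> 'g \<Rightarrow> 'g) \<Rightarrow> 'g set \<Rightarrow> ('g \<Rightarrow> 'k) \<Rightarrow> 'g set" where
  "root_space scale lb H \<alpha> = {a. \<forall>h\<in>H. lb h a = scale (\<alpha> h) a}"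

definition is_root ::
  "('k::field \<Rightarrow> 'g::ab_group_add \<Rightarrow> 'g) \<Rightarrow> ('g \<Rightarrow> 'g \<Rightarrow> 'g) \<Rightarrow> 'g set \<Rightarrow> ('g \<Rightarrow> 'k) \<Rightarrow> bool" where
  "is_root scale lb H \<alpha> \<longleftrightarrow> (\<exists>h\<in>H. \<alpha> h \<noteq> 0) \<and> root_space scale lb H \<alpha> \<noteq> {0}"

text \<open>The independence clause also ensures that distinct members of \<open>B\<close> differ on \<open>H\<close>.\<close>

definition root_base ::
  "('k::field \<Rightarrow> 'g::ab_group_add \<Rightarrow> 'g) \<Rightarrow> ('g \<Rightarrow> 'g \<Rightarrow> 'g) \<Rightarrow> 'g set \<Rightarrow> ('g \<Rightarrow> 'k) set \<Rightarrow> bool" where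
  "root_base scale lb H B \<longleftrightarrow>
     finite B \<and>
     (\<forall>\<alpha>\<in>B. is_root scale lb H \<alpha>) \<and>
     (\<forall>c. (\<forall>h\<in>H. (\<Sum>\<alpha>\<in>B. c \<alpha> * \<alpha> h) = 0) \<longrightarrow> (\<forall>\<alpha>\<in>B. c \<alpha> = 0)) \<and>
     (\<forall>\<gamma>. is_root scale lb H \<gamma> \<longrightarrow>
        (\<exists>n :: ('g \<Rightarrow> 'k) \<Rightarrow> nat.
           (\<forall>h\<in>H. \<gamma> h = (\<Sum>\<alpha>\<in>B. of_nat (n \<alpha>) * \<alpha> h)) \<or>
           (\<forall>h\<in>H. \<gamma> h = - (\<Sum>\<alpha>\<in>B. of_nat (n \<alpha>) * \<alpha> h))))"

definition lowest_root ::
  "('k::field \<Rightarrow> 'g::ab_group_add \<Rightarrow> 'g) \<Rightarrow> ('g \<Rightarrow> 'g \<Rightarrow> 'g) \<Rightarrow> 'g set \<Rightarrow> ('g \<Rightarrow> 'k) set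
     \<Rightarrow> ('g \<Rightarrow> 'k) \<Rightarrow> bool" where
  "lowest_root scale lb H B \<beta> \<longleftrightarrow>
     is_root scale lb H \<beta> \<and>
     (\<forall>\<gamma>. is_root scale lb H \<gamma> \<longrightarrow>
        (\<exists>n :: ('g \<Rightarrow> 'k) \<Rightarrow> nat. \<forall>h\<in>H. \<gamma> h - \<beta> h = (\<Sum>\<alpha>\<in>B. of_nat (n \<alpha>) * \<alpha> h)))"

definition minimal_nilpotent ::
  "('k::field \<Rightarrow> 'g::ab_group_add \<Rightarrow> 'g) \<Rightarrow> ('g \<Rightarrow> 'g \<Rightarrow> 'g) \<Rightarrow> 'g \<Rightarrow> bool" where
  "minimal_nilpotent scale lb f \<longleftrightarrow>
     f \<noteq> 0 \<and>
     (\<exists>H B \<beta>. cartan_subalgebra scale lb H \<and> root_base scale lb H B \<and>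
        lowest_root scale lb H B \<beta> \<and> f \<in> root_space scale lb H \<beta>)"

subsection \<open>The grading by \<open>ad x\<close>\<close>

text \<open>The \<open>sl\<^sub>2\<close>-triple is \<open>(e, 2x, f)\<close>.\<close>

definition sl2_triple :: "('g::ab_group_add \<Rightarrow> 'g \<Rightarrow> 'g) \<Rightarrow> 'g \<Rightarrow> 'g \<Rightarrow> 'g \<Rightarrow> bool" where
  "sl2_triple lb e x f \<longleftrightarrow> lb e f = x + x \<and> lb x e = e \<and> lb x f = - f"

definition half_ints :: "rat set" where
  "half_ints = range (\<lambda>n::int. of_int n / 2)"

definition grade ::
  "('k::field_char_0 \<Rightarrow> 'g::ab_group_add \<Rightarrow> 'g) \<Rightarrow> ('g \<Rightarrow> 'g \<Rightarrow> 'g) \<Rightarrow> 'g \<Rightarrow> rat \<Rightarrow> 'g set" where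
  "grade scale lb x i = {a. lb x a = scale (of_rat i) a}"

definition grade_le ::
  "('k::field_char_0 \<Rightarrow> 'g::ab_group_add \<Rightarrow> 'g) \<Rightarrow> ('g \<Rightarrow> 'g \<Rightarrow> 'g) \<Rightarrow> 'g \<Rightarrow> rat \<Rightarrow> 'g set" where
  "grade_le scale lb x i = module.span scale (\<Union>j\<in>{j\<in>half_ints. j \<le> i}. grade scale lb x j)"

definition grade_ge ::
  "('k::field_char_0 \<Rightarrow> 'g::ab_group_add \<Rightarrow> 'g) \<Rightarrow> ('g \<Rightarrow> 'g \<Rightarrow> 'g) \<Rightarrow> 'g \<Rightarrow> rat \<Rightarrow> 'g set" where
  "grade_ge scale lb x i = module.span scale (\<Union>j\<in>{j\<in>half_ints. i \<le> j}. grade scale lb x j)"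

definition proj_le_half ::
  "('k::field_char_0 \<Rightarrow> 'g::ab_group_add \<Rightarrow> 'g) \<Rightarrow> ('g \<Rightarrow> 'g \<Rightarrow> 'g) \<Rightarrow> 'g \<Rightarrow> 'g \<Rightarrow> 'g" where
  "proj_le_half scale lb x a =
     (THE b. b \<in> grade_le scale lb x (1/2) \<and> a - b \<in> grade_ge scale lb x 1)"

definition g0_centralizer ::
  "('k::field_char_0 \<Rightarrow> 'g::ab_group_add \<Rightarrow> 'g) \<Rightarrow> ('g \<Rightarrow> 'g \<Rightarrow> 'g) \<Rightarrow> 'g \<Rightarrow> 'g \<Rightarrow> 'g set" where
  "g0_centralizer scale lb x f = {a \<in> grade scale lb x 0. lb f a = 0}"

section \<open>Differential polynomials\<close>

text \<open>
  Polynomials over \<open>'k\<close> in the variables \<open>u\<^sub>i\<^sup>(\<^sup>n\<^sup>)\<close>, where the pair \<open>(i, n)\<close> stands for the \<open>n\<close>-th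
  derivative of \<open>u\<^sub>i\<close>.  A monomial is a finitely supported exponent function.
\<close>

type_synonym ('i, 'k) dpoly = "('i \<times> nat \<Rightarrow>\<^sub>0 nat) \<Rightarrow>\<^sub>0 'k"

definition dconst :: "'k::zero \<Rightarrow> ('i, 'k) dpoly" where
  "dconst c = Poly_Mapping.single 0 c"

definition dvar :: "'i \<times> nat \<Rightarrow> ('i, 'k::zero_neq_one) dpoly" where
  "dvar v = Poly_Mapping.single (Poly_Mapping.single v 1) 1"

definition dscale :: "'k::comm_ring_1 \<Rightarrow> ('i, 'k) dpoly \<Rightarrow> ('i, 'k) dpoly" where
  "dscale c p = dconst c * p"

definition dvars :: "('i, 'k::zero) dpoly \<Rightarrow> ('i \<times> nat) set" where
  "dvars p = (\<Union>m\<in>Poly_Mapping.keys p. Poly_Mapping.keys m)"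

definition dpartial :: "'i \<times> nat \<Rightarrow> ('i, 'k::comm_ring_1) dpoly \<Rightarrow> ('i, 'k) dpoly" where
  "dpartial v p = (\<Sum>m\<in>Poly_Mapping.keys p.
     Poly_Mapping.single (m - Poly_Mapping.single v 1)
       (of_nat (Poly_Mapping.lookup m v) * Poly_Mapping.lookup p m))"

text \<open>The derivation \<open>\<partial>\<close> with \<open>\<partial> u\<^sub>i\<^sup>(\<^sup>n\<^sup>) = u\<^sub>i\<^sup>(\<^sup>n\<^sup>+\<^sup>1\<^sup>)\<close>; see \<open>dD_const\<close>, \<open>dD_var\<close>, \<open>dD_mult\<close> below.\<close>

definition dD :: "('i, 'k::comm_ring_1) dpoly \<Rightarrow> ('i, 'k) dpoly" where
  "dD p = (\<Sum>v\<in>dvars p. dpartial v p * dvar (fst v, Suc (snd v)))"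

definition dsubst ::
  "('j \<times> nat \<Rightarrow> ('i, 'k::comm_ring_1) dpoly) \<Rightarrow> ('j, 'k) dpoly \<Rightarrow> ('i, 'k) dpoly" where
  "dsubst \<sigma> p = (\<Sum>m\<in>Poly_Mapping.keys p. dconst (Poly_Mapping.lookup p m) *
     (\<Prod>v\<in>Poly_Mapping.keys m. \<sigma> v ^ Poly_Mapping.lookup m v))"

text \<open>The homomorphism of differential algebras sending \<open>u\<^sub>j\<close> to \<open>G j\<close>.\<close>

definition diff_hom ::
  "('j \<Rightarrow> ('i, 'k::comm_ring_1) dpoly) \<Rightarrow> ('j, 'k) dpoly \<Rightarrow> ('i, 'k) dpoly" where
  "diff_hom G = dsubst (\<lambda>(j, n). (dD ^^ n) (G j))"

text \<open>The differential subalgebra generated by \<open>S\<close>.\<close>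

inductive_set diff_alg :: "('i, 'k::comm_ring_1) dpoly set \<Rightarrow> ('i, 'k) dpoly set"
  for S :: "('i, 'k) dpoly set" where
  gen: "p \<in> S \<Longrightarrow> p \<in> diff_alg S"
| const: "dconst c \<in> diff_alg S"
| add: "p \<in> diff_alg S \<Longrightarrow> q \<in> diff_alg S \<Longrightarrow> p + q \<in> diff_alg S"
| mult: "p \<in> diff_alg S \<Longrightarrow> q \<in> diff_alg S \<Longrightarrow> p * q \<in> diff_alg S"
| deriv: "p \<in> diff_alg S \<Longrightarrow> dD p \<in> diff_alg S"

text \<open>
  \<open>A\<close> is the algebra of differential polynomials in the family \<open>(G j)\<close>, \<open>j \<in> I\<close>: the elements \<open>\<partial>\<^sup>n (G j)\<close>
  are algebraically independent and generate \<open>A\<close>.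
\<close>

definition diff_polys_in ::
  "('i, 'k::comm_ring_1) dpoly set \<Rightarrow> 'j set \<Rightarrow> ('j \<Rightarrow> ('i, 'k) dpoly) \<Rightarrow> bool" where
  "diff_polys_in A I G \<longleftrightarrow>
     A = diff_alg (G ` I) \<and>
     (\<forall>P. dvars P \<subseteq> I \<times> UNIV \<and> diff_hom G P = 0 \<longrightarrow> P = 0)"

section \<open>The affine Poisson vertex algebra\<close>

text \<open>
  Given a basis \<open>bas\<close> of \<open>\<gg>\<close> with index type \<open>'i\<close>, the algebra \<open>S(\<bbbF>[\<partial>]\<gg>)\<close> is the whole type
  \<open>('i, 'k) dpoly\<close>; \<open>emb scale bas\<close> is the inclusion of \<open>\<gg>\<close>.
\<close>

definition emb ::
  "('k::field \<Rightarrow> 'g::ab_group_add \<Rightarrow> 'g) \<Rightarrow> ('i::finite \<Rightarrow> 'g) \<Rightarrow> 'g \<Rightarrow> ('i, 'k) dpoly" where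
  "emb scale bas a =
     (\<Sum>i\<in>UNIV. dconst (module.representation scale (range bas) a (bas i)) * dvar (i, 0))"

text \<open>
  Elements of \<open>V[\<lambda>]\<close> have type \<open>('i, 'k) dpoly poly\<close>; \<open>lamD\<close> is the operator \<open>\<lambda> + \<partial>\<close> on \<open>V[\<lambda>]\<close>, and
  \<open>larrow P g\<close> is \<open>P(\<lambda> + \<partial>)\<^sub>\<rightarrow> g\<close>.
\<close>

definition lamD :: "('i, 'k::comm_ring_1) dpoly poly \<Rightarrow> ('i, 'k) dpoly poly" where
  "lamD P = map_poly dD P + [:0, 1:] * P"

definition larrow ::
  "('i, 'k::comm_ring_1) dpoly poly \<Rightarrow> ('i, 'k) dpoly \<Rightarrow> ('i, 'k) dpoly poly" where
  "larrow P g = (\<Sum>n\<le>degree P. smult (coeff P n) ((lamD ^^ n) [:g:]))"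

definition is_lambda_bracket ::
  "('k::field \<Rightarrow> 'g::ab_group_add \<Rightarrow> 'g) \<Rightarrow> ('g \<Rightarrow> 'g \<Rightarrow> 'g) \<Rightarrow> ('g \<Rightarrow> 'g \<Rightarrow> 'k) \<Rightarrow> ('i::finite \<Rightarrow> 'g)
     \<Rightarrow> 'g \<Rightarrow> 'k \<Rightarrow> (('i, 'k) dpoly \<Rightarrow> ('i, 'k) dpoly \<Rightarrow> ('i, 'k) dpoly poly) \<Rightarrow> bool" where
  "is_lambda_bracket scale lb \<kappa> bas s z br \<longleftrightarrow>
     (\<forall>g1 g2 h. br (g1 + g2) h = br g1 h + br g2 h) \<and>
     (\<forall>g h1 h2. br g (h1 + h2) = br g h1 + br g h2) \<and>
     (\<forall>c g h. br (dscale c g) h = smult (dconst c) (br g h)) \<and>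
     (\<forall>c g h. br g (dscale c h) = smult (dconst c) (br g h)) \<and>
     (\<forall>g h. br (dD g) h = - ([:0, 1:] * br g h)) \<and>
     (\<forall>g h. br g (dD h) = lamD (br g h)) \<and>
     (\<forall>g h1 h2. br g (h1 * h2) = smult h2 (br g h1) + smult h1 (br g h2)) \<and>
     (\<forall>g1 g2 h. br (g1 * g2) h = larrow (br g1 h) g2 + larrow (br g2 h) g1) \<and>
     (\<forall>a b. br (emb scale bas a) (emb scale bas b) =
        [: emb scale bas (lb a b) + dconst (z * \<kappa> s (lb a b)), dconst (\<kappa> a b) :])"

section \<open>The classical W-algebra\<close>

definition V_le_half ::
  "('k::field_char_0 \<Rightarrow> 'g::ab_group_add \<Rightarrow> 'g) \<Rightarrow> ('g \<Rightarrow> 'g \<Rightarrow> 'g) \<Rightarrow> ('i::finite \<Rightarrow> 'g)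
     \<Rightarrow> 'g \<Rightarrow> ('i, 'k) dpoly set" where
  "V_le_half scale lb bas x = diff_alg (emb scale bas ` grade_le scale lb x (1/2))"

definition rho ::
  "('k::field_char_0 \<Rightarrow> 'g::ab_group_add \<Rightarrow> 'g) \<Rightarrow> ('g \<Rightarrow> 'g \<Rightarrow> 'g) \<Rightarrow> ('g \<Rightarrow> 'g \<Rightarrow> 'k)
     \<Rightarrow> ('i::finite \<Rightarrow> 'g) \<Rightarrow> 'g \<Rightarrow> 'g \<Rightarrow> ('i, 'k) dpoly \<Rightarrow> ('i, 'k) dpoly" where
  "rho scale lb \<kappa> bas x f =
     diff_hom (\<lambda>i. emb scale bas (proj_le_half scale lb x (bas i)) + dconst (\<kappa> f (bas i)))"

definition W_alg ::
  "('k::field_char_0 \<Rightarrow> 'g::ab_group_add \<Rightarrow> 'g) \<Rightarrow> ('g \<Rightarrow> 'g \<Rightarrow> 'g) \<Rightarrow> ('g \<Rightarrow> 'g \<Rightarrow> 'k)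
     \<Rightarrow> ('i::finite \<Rightarrow> 'g) \<Rightarrow> 'g \<Rightarrow> 'g \<Rightarrow> (('i, 'k) dpoly \<Rightarrow> ('i, 'k) dpoly \<Rightarrow> ('i, 'k) dpoly poly)
     \<Rightarrow> ('i, 'k) dpoly set" where
  "W_alg scale lb \<kappa> bas x f br =
     {g \<in> V_le_half scale lb bas x.
        \<forall>a\<in>grade_ge scale lb x (1/2).
          map_poly (rho scale lb \<kappa> bas x f) (br (emb scale bas a) g) = 0}"

text \<open>
  Monomials \<open>b\<^sub>0\<^sup>(\<^sup>m\<^sup>\<^sub>0\<^sup>) \<cdots> b\<^sub>r\<^sub>-\<^sub>1\<^sup>(\<^sup>m\<^sup>\<^sub>r\<^sub>-\<^sub>1\<^sup>)\<close> with \<open>b\<^sub>j\<close> of degree \<open>1 - \<Delta>\<^sub>j \<le> 1/2\<close>, of total conformal weight \<open>\<Delta>\<close>.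
\<close>

definition weight_space ::
  "('k::field_char_0 \<Rightarrow> 'g::ab_group_add \<Rightarrow> 'g) \<Rightarrow> ('g \<Rightarrow> 'g \<Rightarrow> 'g) \<Rightarrow> ('i::finite \<Rightarrow> 'g)
     \<Rightarrow> 'g \<Rightarrow> rat \<Rightarrow> ('i, 'k) dpoly set" where
  "weight_space scale lb bas x \<Delta> = module.span dscale
     {\<Prod>j<r. (dD ^^ m j) (emb scale bas (b j)) | (r::nat) b (m::nat \<Rightarrow> nat) \<delta>.
        (\<forall>j<r. 1 - \<delta> j \<in> half_ints \<and> 1 - \<delta> j \<le> 1/2 \<and> b j \<in> grade scale lb x (1 - \<delta> j)) \<and>
        (\<Sum>j<r. \<delta> j + of_nat (m j)) = \<Delta>}"

definition W_weight ::
  "('k::field_char_0 \<Rightarrow> 'g::ab_group_add \<Rightarrow> 'g) \<Rightarrow> ('g \<Rightarrow> 'g \<Rightarrow> 'g) \<Rightarrow> ('g \<Rightarrow> 'g \<Rightarrow> 'k)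
     \<Rightarrow> ('i::finite \<Rightarrow> 'g) \<Rightarrow> 'g \<Rightarrow> 'g \<Rightarrow> (('i, 'k) dpoly \<Rightarrow> ('i, 'k) dpoly \<Rightarrow> ('i, 'k) dpoly poly)
     \<Rightarrow> rat \<Rightarrow> ('i, 'k) dpoly set" where
  "W_weight scale lb \<kappa> bas x f br \<Delta> =
     W_alg scale lb \<kappa> bas x f br \<inter> weight_space scale lb bas x \<Delta>"

subsection \<open>The generators\<close>

text \<open>
  Below, \<open>\<iota>\<close> is the inclusion of \<open>\<gg>\<close>; lower and upper indices are rendered by \<open>a\<close>, \<open>a'\<close> and \<open>v\<close>, \<open>v'\<close>.
\<close>

definition W_L ::
  "('g \<Rightarrow> ('i, 'k::field_char_0) dpoly) \<Rightarrow> ('g \<Rightarrow> 'g \<Rightarrow> 'g) \<Rightarrow> 'g \<Rightarrow> 'g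
     \<Rightarrow> 'p set \<Rightarrow> ('p \<Rightarrow> 'g) \<Rightarrow> ('p \<Rightarrow> 'g) \<Rightarrow> 'q set \<Rightarrow> ('q \<Rightarrow> 'g) \<Rightarrow> ('q \<Rightarrow> 'g) \<Rightarrow> ('i, 'k) dpoly" where
  "W_L \<iota> lb x f J0 a a' J v v' =
     \<iota> f + dD (\<iota> x)
     + dscale (1/2) (\<Sum>j\<in>J0. \<iota> (a j) * \<iota> (a' j))
     + (\<Sum>k\<in>J. \<iota> (v' k) * \<iota> (lb f (v k)))
     + dscale (1/2) (\<Sum>k\<in>J. \<iota> (v' k) * dD (\<iota> (v k)))"

definition W_phi ::
  "('g \<Rightarrow> ('i, 'k::field_char_0) dpoly) \<Rightarrow> ('g \<Rightarrow> 'g \<Rightarrow> 'g)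
     \<Rightarrow> 'q set \<Rightarrow> ('q \<Rightarrow> 'g) \<Rightarrow> ('q \<Rightarrow> 'g) \<Rightarrow> 'g \<Rightarrow> ('i, 'k) dpoly" where
  "W_phi \<iota> lb J v v' a =
     \<iota> a + dscale (1/2) (\<Sum>k\<in>J. \<iota> (lb a (v k)) * \<iota> (v' k))"

definition W_psi ::
  "('g \<Rightarrow> ('i, 'k::field_char_0) dpoly) \<Rightarrow> ('g \<Rightarrow> 'g \<Rightarrow> 'g) \<Rightarrow> 'g
     \<Rightarrow> 'q set \<Rightarrow> ('q \<Rightarrow> 'g) \<Rightarrow> ('q \<Rightarrow> 'g) \<Rightarrow> 'g \<Rightarrow> ('i, 'k) dpoly" where
  "W_psi \<iota> lb e J v v' u =
     \<iota> u
     + dscale (1/3) (\<Sum>h\<in>J. \<Sum>k\<in>J. \<iota> (lb (lb u (v h)) (v k)) * \<iota> (v' h) * \<iota> (v' k))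
     + (\<Sum>k\<in>J. \<iota> (lb u (v k)) * \<iota> (v' k))
     + dD (\<iota> (lb e u))"

datatype 'g gen_index = Gen_L | Gen_phi 'g | Gen_psi 'g

text \<open>
  \<open>W_gens\<close> is the family consisting of \<open>L\<close>, the \<open>\<phi>(a)\<close> and the \<open>\<psi>(u)\<close>; it is a family, not a set, so
  that independence includes the distinctness of its members.
\<close>

fun W_gens ::
  "('i, 'k) dpoly \<Rightarrow> ('g \<Rightarrow> ('i, 'k) dpoly) \<Rightarrow> ('g \<Rightarrow> ('i, 'k) dpoly) \<Rightarrow> 'g gen_index
     \<Rightarrow> ('i, 'k::zero) dpoly" where
  "W_gens L \<phi> \<psi> Gen_L = L"
| "W_gens L \<phi> \<psi> (Gen_phi a) = \<phi> a"
| "W_gens L \<phi> \<psi> (Gen_psi u) = \<psi> u"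

section \<open>Existence of the \<open>\<lambda>\<close>-bracket\<close>

text \<open>
  The theorem takes the \<open>\<lambda>\<close>-bracket as a variable satisfying \<open>is_lambda_bracket\<close>.  Lemma
  \<open>lambda_bracket_exists\<close> below shows that this hypothesis can always be met: \<open>brB\<close> is the bracket
  given by the Master Formula
  \[ \{g_\lambda h\} = \sum_{i,m,j,n} \frac{\partial h}{\partial u_j^{(n)}} (\lambda+\partial)^n
       \{u_i{}_{\lambda+\partial}u_j\}_\to (-\lambda-\partial)^m \frac{\partial g}{\partial u_i^{(m)}}. \]
\<close>


lemma dconst_add: "dconst (a + b) = dconst a + dconst b"
  by (simp add: dconst_def single_add)

lemma dconst_mult: "dconst (a * b) = dconst a * dconst b"
  by (simp add: dconst_def mult_single)

lemma dconst_0 [simp]: "dconst 0 = 0"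
  by (simp add: dconst_def)

lemma dconst_1 [simp]: "dconst 1 = 1"
  by (simp add: dconst_def)

lemma dconst_sum: "dconst (sum c A) = (\<Sum>i\<in>A. dconst (c i))"
  by (induction A rule: infinite_finite_induct) (auto simp: dconst_add)

lemma poly_mapping_add_induct [case_names zero add]:
  fixes p :: "'a \<Rightarrow>\<^sub>0 'b::monoid_add"
  assumes "P 0" and "\<And>m c p. P p \<Longrightarrow> P (p + Poly_Mapping.single m c)"
  shows "P p"
proof (induction p rule: update_induct)
  case const
  then show ?case using assms(1) .
next
  case (update p m c)
  have "Poly_Mapping.update m c p = p + Poly_Mapping.single m c"
    using update(1)
    by (intro poly_mapping_eqI) (auto simp: lookup_update lookup_add lookup_single when_def not_in_keys_iff_lookup_eq_zero)
  then show ?case using assms(2) update by metis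
qed

lemma dvar_power: "dvar v ^ n = Poly_Mapping.single (Poly_Mapping.single v n) (1::'k::comm_ring_1)"
  by (induction n) (auto simp: dvar_def mult_single simp flip: single_add)

lemma dpoly_induct [case_names const var add mult]:
  fixes p :: "('i, 'k::comm_ring_1) dpoly"
  assumes c: "\<And>c. P (dconst c)" and v: "\<And>v. P (dvar v)"
    and a: "\<And>p q. P p \<Longrightarrow> P q \<Longrightarrow> P (p + q)" and m: "\<And>p q. P p \<Longrightarrow> P q \<Longrightarrow> P (p * q)"
  shows "P p"
proof (induction p rule: poly_mapping_add_induct)
  case zero
  show ?case using c[of 0] by simp
next
  case (add m c p)
  have pw: "P (dvar v ^ n)" for v n
    by (induction n) (use c[of 1] v m in auto)
  have "P (Poly_Mapping.single m (1::'k))"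
  proof (induction m rule: poly_mapping_add_induct)
    case zero
    show ?case using assms(1)[of 1] by (simp add: dconst_def)
  next
    case (add v n m)
    have "Poly_Mapping.single (m + Poly_Mapping.single v n) (1::'k) = Poly_Mapping.single m 1 * dvar v ^ n"
      by (simp add: dvar_power mult_single)
    then show ?case using m[OF add pw] by metis
  qed
  moreover have "Poly_Mapping.single m c = dconst c * Poly_Mapping.single m 1"
    by (simp add: dconst_def mult_single)
  ultimately have "P (Poly_Mapping.single m c)" using m[OF c] by metis
  then show ?case using add a by blast
qed

lemma dpartial_add: "dpartial v (p + q) = dpartial v p + dpartial v q"
  unfolding dpartial_def
  by (rule setsum_keys_plus_distrib) (auto simp: algebra_simps single_add)

lemma dpartial_0 [simp]: "dpartial v 0 = 0"
  by (simp add: dpartial_def)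

lemma dpartial_single:
  "dpartial v (Poly_Mapping.single m c) =
   Poly_Mapping.single (m - Poly_Mapping.single v 1) (of_nat (Poly_Mapping.lookup m v) * c)"
  by (cases "c = 0") (auto simp: dpartial_def)

lemma dpartial_sum: "dpartial v (\<Sum>i\<in>A. p i) = (\<Sum>i\<in>A. dpartial v (p i))"
  by (induction A rule: infinite_finite_induct) (auto simp: dpartial_add)

lemma dpartial_mult_single:
  "dpartial v (Poly_Mapping.single m a * Poly_Mapping.single n b) =
   dpartial v (Poly_Mapping.single m a) * Poly_Mapping.single n b +
   dpartial v (Poly_Mapping.single n b) * Poly_Mapping.single m a"
proof -
  have 1: "m + n - Poly_Mapping.single v 1 = (m - Poly_Mapping.single v 1) + n"
    if "Poly_Mapping.lookup m v \<noteq> 0" for m n :: "'a \<times> nat \<Rightarrow>\<^sub>0 nat"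
    using that by (intro poly_mapping_eqI) (auto simp: lookup_add lookup_minus lookup_single when_def)
  have 2: "Poly_Mapping.lookup m v = 0 \<or> m + n - Poly_Mapping.single v 1 = (m - Poly_Mapping.single v 1) + n"
    using 1 by blast
  have 3: "Poly_Mapping.lookup n v = 0 \<or> m + n - Poly_Mapping.single v 1 = (n - Poly_Mapping.single v 1) + m"
    using 1[of n m] by (auto simp: add.commute)
  have e1: "dpartial v (Poly_Mapping.single m a) * Poly_Mapping.single n b =
     Poly_Mapping.single (m + n - Poly_Mapping.single v 1) (of_nat (Poly_Mapping.lookup m v) * a * b)"
    using 2 by (auto simp: dpartial_single mult_single)
  have e2: "dpartial v (Poly_Mapping.single n b) * Poly_Mapping.single m a =
     Poly_Mapping.single (m + n - Poly_Mapping.single v 1) (of_nat (Poly_Mapping.lookup n v) * a * b)"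
    using 3 by (auto simp: dpartial_single mult_single algebra_simps)
  show ?thesis
    unfolding e1 e2 by (simp add: mult_single dpartial_single lookup_add algebra_simps flip: single_add)
qed

lemma dpartial_mult: "dpartial v (p * q) = dpartial v p * q + dpartial v q * p"
proof (induction p rule: poly_mapping_add_induct)
  case zero
  show ?case by simp
next
  case (add m a p)
  have "dpartial v (Poly_Mapping.single m a * q) =
    dpartial v (Poly_Mapping.single m a) * q + dpartial v q * Poly_Mapping.single m a"
    by (induction q rule: poly_mapping_add_induct)
      (simp_all add: distrib_left distrib_right dpartial_add dpartial_mult_single algebra_simps)
  then show ?case using add by (simp add: dpartial_add algebra_simps)
qed

lemma dpartial_const [simp]: "dpartial v (dconst c) = 0"
  by (simp add: dconst_def dpartial_single)

lemma dpartial_var: "dpartial v (dvar w) = (if v = w then 1 else 0)"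
  by (auto simp: dvar_def dpartial_single lookup_single when_def)

lemma finite_dvars: "finite (dvars p)"
  by (simp add: dvars_def)

lemma dpartial_notin: "v \<notin> dvars p \<Longrightarrow> dpartial v p = 0"
  unfolding dpartial_def dvars_def
  by (rule sum.neutral) (auto simp: in_keys_iff)

lemma dD_superset: "finite A \<Longrightarrow> dvars p \<subseteq> A \<Longrightarrow>
    dD p = (\<Sum>v\<in>A. dpartial v p * dvar (fst v, Suc (snd v)))"
  unfolding dD_def by (rule sum.mono_neutral_left) (auto simp: dpartial_notin)

lemma dD_add: "dD (p + q) = dD p + dD q"
proof -
  let ?A = "dvars p \<union> dvars q \<union> dvars (p + q)"
  have f: "finite ?A" by (simp add: finite_dvars)
  show ?thesis
    by (subst (1 2 3) dD_superset[OF f]) (auto simp: dpartial_add sum.distrib algebra_simps)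
qed

lemma dD_mult: "dD (p * q) = dD p * q + p * dD q"
proof -
  let ?A = "dvars p \<union> dvars q \<union> dvars (p * q)"
  have f: "finite ?A" by (simp add: finite_dvars)
  show ?thesis
    by (subst (1 2 3) dD_superset[OF f])
      (auto simp: dpartial_mult sum.distrib algebra_simps sum_distrib_left sum_distrib_right)
qed

lemma dD_const [simp]: "dD (dconst c) = 0"
  by (simp add: dD_def)

lemma dD_0 [simp]: "dD 0 = 0"
  using dD_const[of 0] by simp

lemma dD_var: "dD (dvar (i, n)) = dvar (i, Suc n)"
  by (subst dD_superset[of "insert (i, n) (dvars (dvar (i, n)))"])
    (auto simp: finite_dvars dpartial_var if_distrib[of "\<lambda>a. a * _"] cong: if_cong)

lemma dD_scale: "dD (dconst c * p) = dconst c * dD p"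
  by (simp add: dD_mult)

lemma dpartial_dD:
  "dpartial (i, m) (dD p) =
     dD (dpartial (i, m) p) + (case m of 0 \<Rightarrow> 0 | Suc k \<Rightarrow> dpartial (i, k) p)"
proof (induction p rule: dpoly_induct)
  case (const c)
  then show ?case by (simp split: nat.split)
next
  case (var v)
  have "dD 1 = 0"
    using dD_const[of 1] by simp
  then show ?case by (cases v) (auto simp: dD_var dpartial_var split: nat.split)
next
  case (add p q)
  then show ?case by (simp add: dD_add dpartial_add algebra_simps split: nat.splits)
next
  case (mult p q)
  then show ?case by (simp add: dD_add dD_mult dpartial_add dpartial_mult algebra_simps split: nat.splits)
qed

lemma coeff_mapD: "coeff (map_poly dD P) n = dD (coeff P n)"
  by (simp add: coeff_map_poly)

lemma coeff_lamD: "coeff (lamD P) n = dD (coeff P n) + (case n of 0 \<Rightarrow> 0 | Suc k \<Rightarrow> coeff P k)"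
  by (simp add: lamD_def coeff_mapD coeff_pCons split: nat.split)

lemma lamD_add: "lamD (P + Q) = lamD P + lamD Q"
  by (rule poly_eqI) (simp add: coeff_lamD dD_add split: nat.split)

lemma lamD_0 [simp]: "lamD 0 = 0"
  by (simp add: lamD_def)

lemma lamD_minus: "lamD (- P) = - lamD P"
  using lamD_add[of P "- P"] by (simp add: eq_neg_iff_add_eq_0 add.commute)

lemma lamD_sum: "lamD (\<Sum>i\<in>A. P i) = (\<Sum>i\<in>A. lamD (P i))"
  by (induction A rule: infinite_finite_induct) (auto simp: lamD_add)

lemma lamD_smult: "lamD (smult p Q) = smult (dD p) Q + smult p (lamD Q)"
  by (rule poly_eqI) (simp add: coeff_lamD dD_mult algebra_simps split: nat.split)

lemma lamD_lam: "lamD ([:0, 1:] * Q) = [:0, 1:] * lamD Q"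
  by (rule poly_eqI) (simp add: coeff_lamD coeff_pCons split: nat.split)

lemma lamD_const: "lamD [:p:] = [:dD p, p:]"
  by (rule poly_eqI) (simp add: coeff_lamD coeff_pCons split: nat.split)

abbreviation mlamD :: "('i, 'k::comm_ring_1) dpoly poly \<Rightarrow> ('i, 'k) dpoly poly" where
  "mlamD P \<equiv> - lamD P"

lemma pow_linear:
  fixes T :: "'a::ab_group_add \<Rightarrow> 'a"
  assumes "\<And>P Q. T (P + Q) = T P + T Q"
  shows "(T ^^ n) (P + Q) = (T ^^ n) P + (T ^^ n) Q"
  by (induction n) (auto simp: assms)

lemma smult_sum: "smult p (\<Sum>i\<in>A. P i) = (\<Sum>i\<in>A. smult p (P i))"
  by (induction A rule: infinite_finite_induct) (auto simp: smult_add_right)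

lemma larrow_eq: "degree P \<le> N \<Longrightarrow> larrow P g = (\<Sum>n\<le>N. smult (coeff P n) ((lamD ^^ n) [:g:]))"
  unfolding larrow_def by (rule sum.mono_neutral_left) (auto simp: coeff_eq_0)

lemma larrow_add: "larrow (P + Q) g = larrow P g + larrow Q g"
proof -
  let ?N = "max (degree P) (degree Q)"
  have "degree (P + Q) \<le> ?N" by (rule degree_add_le) auto
  then show ?thesis
    by (subst (1 2 3) larrow_eq[of _ ?N]) (auto simp: smult_add_left sum.distrib)
qed

lemma larrow_smult: "larrow (smult p P) g = smult p (larrow P g)"
proof -
  have "degree (smult p P) \<le> degree P" by (rule degree_smult_le)
  then show ?thesis
    by (subst larrow_eq[of _ "degree P"])
      (auto simp: larrow_def smult_sum)
qed

lemma larrow_0 [simp]: "larrow 0 g = 0"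
  by (simp add: larrow_def)

lemma larrow_minus: "larrow (- P) g = - larrow P g"
  using larrow_add[of P "- P" g] by (simp add: eq_neg_iff_add_eq_0 add.commute)

lemma larrow_sum: "larrow (\<Sum>i\<in>A. P i) g = (\<Sum>i\<in>A. larrow (P i) g)"
  by (induction A rule: infinite_finite_induct) (auto simp: larrow_add)

lemma larrow_const: "larrow [:p:] g = [:p * g:]"
  by (simp add: larrow_def)

lemma larrow_lamD: "larrow (lamD P) g = lamD (larrow P g)"
proof -
  have d: "degree (lamD P) \<le> Suc (degree P)"
    by (rule degree_le) (auto simp: coeff_lamD coeff_eq_0 split: nat.split)
  let ?T = "\<lambda>n. (lamD ^^ n) [:g:]"
  have "larrow (lamD P) g = (\<Sum>n\<le>Suc (degree P). smult (dD (coeff P n)) (?T n)) +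
     (\<Sum>n\<le>Suc (degree P). smult (case n of 0 \<Rightarrow> 0 | Suc k \<Rightarrow> coeff P k) (?T n))"
    by (simp only: larrow_eq[OF d] coeff_lamD smult_add_left sum.distrib)
  also have "(\<Sum>n\<le>Suc (degree P). smult (dD (coeff P n)) (?T n)) =
      (\<Sum>n\<le>degree P. smult (dD (coeff P n)) (?T n))"
    by (simp add: coeff_eq_0)
  also have "(\<Sum>n\<le>Suc (degree P). smult (case n of 0 \<Rightarrow> 0 | Suc k \<Rightarrow> coeff P k) (?T n)) =
      (\<Sum>n\<le>degree P. smult (coeff P n) (lamD (?T n)))"
    by (subst sum.atMost_Suc_shift) simp
  finally show ?thesis
    by (simp add: larrow_def lamD_sum lamD_smult sum.distrib)
qed


definition dord :: "('i, 'k::comm_ring_1) dpoly \<Rightarrow> nat" where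
  "dord p = Suc (Max (insert 0 (snd ` dvars p)))"

lemma dpartial_dord: "dord p \<le> m \<Longrightarrow> dpartial (i, m) p = 0"
proof -
  assume m: "dord p \<le> m"
  have "n < dord p" if "(i, n) \<in> dvars p" for i n
    using that finite_dvars[of p] unfolding dord_def less_Suc_eq_le
    by (intro Max_ge) (auto intro: rev_image_eqI)
  with m show ?thesis by (intro dpartial_notin) (meson not_le)
qed

definition brK :: "('i, 'k::comm_ring_1) dpoly \<Rightarrow> 'i \<Rightarrow> ('i, 'k) dpoly poly" where
  "brK g i = (\<Sum>m<dord g. (mlamD ^^ m) [:dpartial (i, m) g:])"

lemma ml_add: "(mlamD ^^ m) (P + Q) = (mlamD ^^ m) P + (mlamD ^^ m) Q"
  by (rule pow_linear) (simp add: lamD_add)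

lemma ml_const_add: "(mlamD ^^ m) [:p + q:] = (mlamD ^^ m) [:p:] + (mlamD ^^ m) [:q:]"
  using ml_add[of m "[:p:]" "[:q:]"] by simp

lemma ml_0 [simp]: "(mlamD ^^ m) 0 = 0"
  by (induction m) auto

lemma ml_smult_const: "(mlamD ^^ m) (smult (dconst c) P) = smult (dconst c) ((mlamD ^^ m) P)"
  by (induction m) (auto simp: lamD_smult)

lemma ml_lam: "(mlamD ^^ m) ([:0, 1:] * P) = [:0, 1:] * (mlamD ^^ m) P"
  by (induction m) (simp_all add: lamD_lam del: mult_pCons_left)

lemma l_add: "(lamD ^^ m) (P + Q) = (lamD ^^ m) P + (lamD ^^ m) Q"
  by (rule pow_linear) (simp add: lamD_add)

lemma l_0 [simp]: "(lamD ^^ m) 0 = 0"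
  by (induction m) auto

lemma l_smult_const: "(lamD ^^ m) (smult (dconst c) P) = smult (dconst c) ((lamD ^^ m) P)"
  by (induction m) (auto simp: lamD_smult)

lemma l_lam: "(lamD ^^ m) ([:0, 1:] * P) = [:0, 1:] * (lamD ^^ m) P"
  by (induction m) (simp_all add: lamD_lam del: mult_pCons_left)

lemma larrow_l: "larrow ((lamD ^^ m) P) g = (lamD ^^ m) (larrow P g)"
  by (induction m) (auto simp: larrow_lamD)

lemma larrow_ml: "larrow ((mlamD ^^ m) P) g = (mlamD ^^ m) (larrow P g)"
  by (induction m) (auto simp: larrow_lamD larrow_minus)

lemma brK_eq: "dord g \<le> N \<Longrightarrow> brK g i = (\<Sum>m<N. (mlamD ^^ m) [:dpartial (i, m) g:])"
  unfolding brK_def by (rule sum.mono_neutral_left) (auto simp: dpartial_dord)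

lemma brK_add: "brK (g + h) i = brK g i + brK h i"
proof -
  let ?N = "max (dord (g + h)) (max (dord g) (dord h))"
  show ?thesis
    by (subst (1 2 3) brK_eq[of _ ?N])
      (auto simp: dpartial_add sum.distrib ml_const_add)
qed

lemma brK_scale: "brK (dconst c * g) i = smult (dconst c) (brK g i)"
proof -
  let ?N = "max (dord (dconst c * g)) (dord g)"
  show ?thesis
    by (subst (1 2) brK_eq[of _ ?N])
      (auto simp: dpartial_mult smult_sum mult.commute simp flip: ml_smult_const)
qed

lemma brK_mult: "brK (g * h) i = larrow (brK g i) h + larrow (brK h i) g"
proof -
  let ?N = "max (dord (g * h)) (max (dord g) (dord h))"
  show ?thesis
    by (subst (1 2 3) brK_eq[of _ ?N])
      (auto simp: dpartial_mult sum.distrib larrow_sum larrow_ml larrow_const ml_const_add)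
qed

lemma add_eq_0_solve: "(a::'a::ab_group_add) + c + b = 0 \<Longrightarrow> a = - b - c"
  by (simp add: eq_neg_iff_add_eq_0 eq_diff_eq)

lemma brK_dD: "brK (dD g) i = - ([:0, 1:] * brK g i)"
proof -
  let ?U = "\<lambda>m. (mlamD ^^ m)"
  define N where "N = Suc (max (dord (dD g)) (dord g))"
  obtain M where M: "N = Suc M" "dord g \<le> M" by (auto simp: N_def)
  have 1: "[:dD p:] = lamD [:p:] - [:0, 1:] * [:p:]" for p :: "('a, 'b) dpoly"
    by (simp add: lamD_const)
  have 2: "?U m [:dD p:] = - ?U (Suc m) [:p:] - [:0, 1:] * ?U m [:p:]" for m and p :: "('a, 'b) dpoly"
  proof -
    have "?U m [:dD p:] + ?U m ([:0, 1:] * [:p:]) + ?U m (- lamD [:p:]) = 0"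
      unfolding 1 by (simp flip: ml_add)
    moreover have "?U m (- lamD [:p:]) = ?U (Suc m) [:p:]"
      using funpow_swap1[of "mlamD" m "[:p:]"] by simp
    ultimately have "?U m [:dD p:] + [:0, 1:] * ?U m [:p:] + ?U (Suc m) [:p:] = 0"
      by (simp only: ml_lam)
    then show ?thesis by (rule add_eq_0_solve)
  qed
  have "brK (dD g) i = (\<Sum>m<N. ?U m [:dpartial (i, m) (dD g):])"
    by (rule brK_eq) (simp add: N_def)
  also have "\<dots> = (\<Sum>m<N. ?U m [:dD (dpartial (i, m) g):] +
       ?U m [:case m of 0 \<Rightarrow> 0 | Suc k \<Rightarrow> dpartial (i, k) g:])"
    by (simp add: dpartial_dD flip: ml_add)
  also have "\<dots> = (\<Sum>m<N. - ?U (Suc m) [:dpartial (i, m) g:]) - (\<Sum>m<N. [:0, 1:] * ?U m [:dpartial (i, m) g:])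
     + (\<Sum>m<N. ?U m [:case m of 0 \<Rightarrow> 0 | Suc k \<Rightarrow> dpartial (i, k) g:])"
    by (simp only: 2 sum.distrib sum_subtractf)
  also have "(\<Sum>m<N. ?U m [:case m of 0 \<Rightarrow> 0 | Suc k \<Rightarrow> dpartial (i, k) g:]) =
      (\<Sum>m<M. ?U (Suc m) [:dpartial (i, m) g:])"
    unfolding M(1) by (subst sum.lessThan_Suc_shift) simp
  also have "(\<Sum>m<N. - ?U (Suc m) [:dpartial (i, m) g:]) = - (\<Sum>m<M. ?U (Suc m) [:dpartial (i, m) g:])"
    unfolding M(1) using dpartial_dord[OF M(2)]
    by (simp add: sum_negf)
  also have "(\<Sum>m<N. [:0, 1:] * ?U m [:dpartial (i, m) g:]) = [:0, 1:] * brK g i"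
    by (subst brK_eq[of g N]) (simp_all add: N_def sum_distrib_left distrib_left del: mult_pCons_left)
  finally show ?thesis by simp
qed

definition brR ::
  "('i::finite \<Rightarrow> 'i \<Rightarrow> ('i, 'k::comm_ring_1) dpoly) \<Rightarrow> ('i \<Rightarrow> 'i \<Rightarrow> 'k) \<Rightarrow> ('i, 'k) dpoly \<Rightarrow> 'i
    \<Rightarrow> ('i, 'k) dpoly poly" where
  "brR c k g j = (\<Sum>i\<in>UNIV. smult (c i j) (brK g i) + smult (dconst (k i j)) (lamD (brK g i)))"

lemma brR_add: "brR c k (g + h) j = brR c k g j + brR c k h j"
  by (simp add: brR_def brK_add lamD_add smult_add_right sum.distrib algebra_simps)

lemma brR_scale: "brR c k (dconst r * g) j = smult (dconst r) (brR c k g j)"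
  by (simp add: brR_def brK_scale lamD_smult smult_sum smult_add_right mult.commute[of _ "dconst r"])

lemma brR_mult: "brR c k (g * h) j = larrow (brR c k g j) h + larrow (brR c k h j) g"
  by (simp add: brR_def brK_mult lamD_add larrow_sum larrow_add larrow_smult larrow_lamD smult_add_right
      sum.distrib algebra_simps)

lemma brR_dD: "brR c k (dD g) j = - ([:0, 1:] * brR c k g j)"
proof -
  have "smult p (- ([:0, 1:] * Q)) + smult q (lamD (- ([:0, 1:] * Q))) =
      - ([:0, 1:] * (smult p Q + smult q (lamD Q)))" for p q and Q :: "('a, 'b) dpoly poly"
    by (simp only: lamD_minus lamD_lam distrib_left mult_smult_right smult_minus_right minus_add_distrib)
  then show ?thesis
    by (simp only: brR_def brK_dD sum_negf sum_distrib_left)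
qed

definition brB ::
  "('i::finite \<Rightarrow> 'i \<Rightarrow> ('i, 'k::comm_ring_1) dpoly) \<Rightarrow> ('i \<Rightarrow> 'i \<Rightarrow> 'k) \<Rightarrow> ('i, 'k) dpoly
    \<Rightarrow> ('i, 'k) dpoly \<Rightarrow> ('i, 'k) dpoly poly" where
  "brB c k g h = (\<Sum>j\<in>UNIV. \<Sum>n<dord h. smult (dpartial (j, n) h) ((lamD ^^ n) (brR c k g j)))"

lemma brB_eq: "dord h \<le> N \<Longrightarrow>
   brB c k g h = (\<Sum>j\<in>UNIV. \<Sum>n<N. smult (dpartial (j, n) h) ((lamD ^^ n) (brR c k g j)))"
  unfolding brB_def by (intro sum.cong refl sum.mono_neutral_left) (auto simp: dpartial_dord)

lemma brB_add_left: "brB c k (g1 + g2) h = brB c k g1 h + brB c k g2 h"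
  by (simp add: brB_def brR_add l_add smult_add_right sum.distrib)

lemma brB_scale_left: "brB c k (dconst r * g) h = smult (dconst r) (brB c k g h)"
  by (simp add: brB_def brR_scale l_smult_const smult_sum mult.commute[of _ "dconst r"])

lemma brB_mult_left: "brB c k (g1 * g2) h = larrow (brB c k g1 h) g2 + larrow (brB c k g2 h) g1"
  by (simp add: brB_def brR_mult l_add smult_add_right sum.distrib larrow_sum larrow_smult larrow_l)

lemma l_minus: "(lamD ^^ m) (- P) = - (lamD ^^ m) P"
  by (induction m) (auto simp: lamD_minus)

lemma brB_dD_left: "brB c k (dD g) h = - ([:0, 1:] * brB c k g h)"
proof -
  have "smult p ((lamD ^^ n) (- ([:0, 1:] * Q))) = - ([:0, 1:] * smult p ((lamD ^^ n) Q))"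
    for p n and Q :: "('a, 'b) dpoly poly"
    by (simp only: l_minus l_lam mult_smult_right smult_minus_right)
  then show ?thesis
    by (simp only: brB_def brR_dD sum_negf sum_distrib_left)
qed

lemma brB_add_right: "brB c k g (h1 + h2) = brB c k g h1 + brB c k g h2"
proof -
  let ?N = "max (dord (h1 + h2)) (max (dord h1) (dord h2))"
  show ?thesis
    by (subst (1 2 3) brB_eq[of _ ?N]) (auto simp: dpartial_add smult_add_left sum.distrib)
qed

lemma brB_mult_right: "brB c k g (h1 * h2) = smult h2 (brB c k g h1) + smult h1 (brB c k g h2)"
proof -
  let ?N = "max (dord (h1 * h2)) (max (dord h1) (dord h2))"
  show ?thesis
    by (subst (1 2 3) brB_eq[of _ ?N])
      (auto simp: dpartial_mult smult_add_left sum.distrib smult_sum mult.commute)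
qed

lemma brB_const: "brB c k g (dconst r) = 0"
  by (simp add: brB_def)

lemma brB_scale_right: "brB c k g (dconst r * h) = smult (dconst r) (brB c k g h)"
  by (simp add: brB_mult_right brB_const)

lemma brB_dD_right: "brB c k g (dD h) = lamD (brB c k g h)"
proof -
  define N where "N = Suc (max (dord (dD h)) (dord h))"
  obtain M where M: "N = Suc M" "dord h \<le> M" by (auto simp: N_def)
  have "(\<Sum>n<N. smult (dpartial (j, n) (dD h)) ((lamD ^^ n) Q)) =
      lamD (\<Sum>n<N. smult (dpartial (j, n) h) ((lamD ^^ n) Q))" for j Q
  proof -
    have "(\<Sum>n<N. smult (dpartial (j, n) (dD h)) ((lamD ^^ n) Q)) =
       (\<Sum>n<N. smult (dD (dpartial (j, n) h)) ((lamD ^^ n) Q)) +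
       (\<Sum>n<N. smult (case n of 0 \<Rightarrow> 0 | Suc k \<Rightarrow> dpartial (j, k) h) ((lamD ^^ n) Q))"
      by (simp add: dpartial_dD smult_add_left sum.distrib)
    also have "(\<Sum>n<N. smult (case n of 0 \<Rightarrow> 0 | Suc k \<Rightarrow> dpartial (j, k) h) ((lamD ^^ n) Q)) =
       (\<Sum>n<M. smult (dpartial (j, n) h) (lamD ((lamD ^^ n) Q)))"
      unfolding M(1) by (subst sum.lessThan_Suc_shift) simp
    also have "\<dots> = (\<Sum>n<N. smult (dpartial (j, n) h) (lamD ((lamD ^^ n) Q)))"
      unfolding M(1) using dpartial_dord[OF M(2)] by simp
    finally show ?thesis by (simp add: lamD_sum lamD_smult sum.distrib)
  qed
  then show ?thesis
    by (subst (1 2) brB_eq[of _ N]) (auto simp: N_def lamD_sum)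
qed

lemma brK_lin: "brK (\<Sum>i\<in>UNIV. dconst (r i) * dvar (i, 0)) (i::'i::finite) = [:dconst (r i):]"
proof -
  let ?g = "\<Sum>i\<in>UNIV. dconst (r i) * dvar (i, 0)"
  have d: "dpartial (i, m) ?g = (if m = 0 then dconst (r i) else 0)" for m
    by (auto simp: dpartial_sum dpartial_mult dpartial_var if_distrib[of "\<lambda>a. a * _"] cong: if_cong)
  obtain n where n: "dord ?g = Suc n" by (simp add: dord_def)
  show ?thesis
    unfolding brK_def d n by (subst sum.lessThan_Suc_shift) simp
qed

lemma brB_lin: "brB c k g (\<Sum>i\<in>UNIV. dconst (r i) * dvar (i::'i::finite, 0)) =
   (\<Sum>j\<in>UNIV. smult (dconst (r j)) (brR c k g j))"
proof -
  let ?g = "\<Sum>i\<in>UNIV. dconst (r i) * dvar (i, 0)"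
  have d: "dpartial (i, m) ?g = (if m = 0 then dconst (r i) else 0)" for m i
    by (auto simp: dpartial_sum dpartial_mult dpartial_var if_distrib[of "\<lambda>a. a * _"] cong: if_cong)
  obtain n where n: "dord ?g = Suc n" by (simp add: dord_def)
  show ?thesis
    unfolding brB_def d n by (subst sum.lessThan_Suc_shift) simp
qed

lemma brB_lin_lin:
  fixes c :: "'i::finite \<Rightarrow> 'i \<Rightarrow> ('i, 'b::comm_ring_1) dpoly"
  shows "brB c k (\<Sum>i\<in>UNIV. dconst (q i) * dvar (i::'i::finite, 0)) (\<Sum>i\<in>UNIV. dconst (r i) * dvar (i, 0)) =
   [:\<Sum>j\<in>UNIV. \<Sum>i\<in>UNIV. dconst (q i) * dconst (r j) * c i j, dconst (\<Sum>j\<in>UNIV. \<Sum>i\<in>UNIV. q i * r j * k i j):]"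
proof -
  have s: "(\<Sum>i\<in>A. [:F i, G i:]) = [:\<Sum>i\<in>A. F i, \<Sum>i\<in>A. G i:]" for A :: "'i set" and F G :: "'i \<Rightarrow> ('i, 'b) dpoly"
    by (induction A rule: infinite_finite_induct) auto
  show ?thesis
    by (simp add: brB_lin brR_def brK_lin lamD_const s smult_sum dconst_sum dconst_mult sum_distrib_left algebra_simps)
qed

context
  fixes scale :: "'k::field \<Rightarrow> 'g::ab_group_add \<Rightarrow> 'g" and bas :: "'i::finite \<Rightarrow> 'g"
  assumes vs: "vector_space scale" and bas: "is_basis scale UNIV bas UNIV"
begin

interpretation vector_space scale by (rule vs)

abbreviation "crd a i \<equiv> representation (range bas) a (bas i)"

lemma bas': "independent (range bas)" "span (range bas) = UNIV" "inj bas"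
  using bas by (auto simp: is_basis_def)

lemma crd_sum: "(\<Sum>i\<in>UNIV. scale (crd a i) (bas i)) = a"
proof -
  have "(\<Sum>b\<in>range bas. scale (representation (range bas) a b) b) = a"
    by (rule sum_representation_eq) (auto simp: bas')
  then show ?thesis
    by (simp add: sum.reindex[OF bas'(3)])
qed

lemma emb_linear: "emb scale bas (a + b) = emb scale bas a + emb scale bas b"
  "emb scale bas (scale r a) = dconst r * emb scale bas a"
  by (simp_all add: emb_def representation_add representation_scale bas' dconst_add dconst_mult
      algebra_simps sum.distrib sum_distrib_left)

lemma emb_sum: "emb scale bas (\<Sum>i\<in>A. a i) = (\<Sum>i\<in>A. emb scale bas (a i))"
proof -
  have "emb scale bas 0 = 0" using emb_linear(1)[of 0 0] by simp
  then show ?thesis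
    by (induction A rule: infinite_finite_induct) (auto simp: emb_linear)
qed

lemma lambda_bracket_exists:
  assumes lie: "lie_algebra scale lb" and form: "invariant_form scale lb \<kappa>"
  shows "\<exists>br. is_lambda_bracket scale lb \<kappa> bas s z br"
proof -
  interpret lie_algebra scale lb by (rule lie)
  let ?e = "emb scale bas"
  define c where "c i j = ?e (lb (bas i) (bas j)) + dconst (z * \<kappa> s (lb (bas i) (bas j)))" for i j
  define k where "k i j = \<kappa> (bas i) (bas j)" for i j
  have kl: "\<kappa> (a + b) d = \<kappa> a d + \<kappa> b d" "\<kappa> (scale r a) b = r * \<kappa> a b" "\<kappa> a b = \<kappa> b a" for a b d r
    using form by (auto simp: invariant_form_def)
  have kr: "\<kappa> d (a + b) = \<kappa> d a + \<kappa> d b" "\<kappa> b (scale r a) = r * \<kappa> b a" for a b d r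
    by (metis kl)+
  have k0: "\<kappa> 0 a = 0" "\<kappa> a 0 = 0" for a
    using kl(2)[of 0 0 a] kr(2)[of a 0 0] by (simp_all add: scale_zero_left)
  have l0: "lb 0 a = 0" "lb a 0 = 0" for a
    using lb_add_left[of 0 0 a] lb_add_right[of a 0 0] by auto
  have ks: "\<kappa> (sum F A) a = (\<Sum>i\<in>A. \<kappa> (F i) a)" "\<kappa> a (sum F A) = (\<Sum>i\<in>A. \<kappa> a (F i))" for a and F :: "'i \<Rightarrow> 'g" and A
    by (induction A rule: infinite_finite_induct) (auto simp: kl(1) kr(1) k0)
  have ls: "lb (sum F A) a = (\<Sum>i\<in>A. lb (F i) a)" "lb a (sum F A) = (\<Sum>i\<in>A. lb a (F i))" for a and F :: "'i \<Rightarrow> 'g" and A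
    by (induction A rule: infinite_finite_induct) (auto simp: lb_add_left lb_add_right l0)
  have lab: "lb a b = (\<Sum>j\<in>UNIV. \<Sum>i\<in>UNIV. scale (crd a i * crd b j) (lb (bas i) (bas j)))" for a b
  proof -
    have "lb a b = lb (\<Sum>i\<in>UNIV. scale (crd a i) (bas i)) (\<Sum>i\<in>UNIV. scale (crd b i) (bas i))"
      by (simp add: crd_sum)
    also have "\<dots> = (\<Sum>j\<in>UNIV. \<Sum>i\<in>UNIV. scale (crd a i * crd b j) (lb (bas i) (bas j)))"
      unfolding ls by (simp add: lb_scale_left lb_scale_right mult.commute)
    finally show ?thesis .
  qed
  have kab: "\<kappa> a b = (\<Sum>j\<in>UNIV. \<Sum>i\<in>UNIV. crd a i * crd b j * k i j)" for a b
  proof -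
    have "\<kappa> a b = \<kappa> (\<Sum>i\<in>UNIV. scale (crd a i) (bas i)) (\<Sum>i\<in>UNIV. scale (crd b i) (bas i))"
      by (simp add: crd_sum)
    also have "\<dots> = (\<Sum>j\<in>UNIV. \<Sum>i\<in>UNIV. crd a i * crd b j * k i j)"
      unfolding ks by (simp add: kl(2) kr(2) k_def algebra_simps)
    finally show ?thesis .
  qed
  have cab: "?e (lb a b) + dconst (z * \<kappa> s (lb a b)) =
     (\<Sum>j\<in>UNIV. \<Sum>i\<in>UNIV. dconst (crd a i) * dconst (crd b j) * c i j)" for a b
    unfolding lab[of a b]
    by (simp add: emb_sum emb_linear sum_distrib_left dconst_sum dconst_mult c_def sum.distrib ks kr
        algebra_simps)
  have "brB c k (?e a) (?e b) = [: ?e (lb a b) + dconst (z * \<kappa> s (lb a b)), dconst (\<kappa> a b) :]" for a b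
    unfolding cab kab[of a b] unfolding emb_def by (rule brB_lin_lin)
  then have "is_lambda_bracket scale lb \<kappa> bas s z (brB c k)"
    unfolding is_lambda_bracket_def dscale_def
    by (intro conjI allI brB_add_left brB_add_right brB_scale_left brB_scale_right brB_dD_left
        brB_dD_right brB_mult_left brB_mult_right) auto
  then show ?thesis by blast
qed

end

end

(*
  Minimality gives (ad f)^2 g = F f. Hence on the orthogonal complement of the sl_2-triple the
  operator ad f squares to zero, so only the ad x-eigenvalues 0, 1/2, -1/2 occur there, which yields
  the minimal grading, with g_0 = F x + g_0^f.

  For a in g_{>=1/2} the map D_a g = rho {a_lambda g} is a derivation of V(g_{<=1/2}) compatible with
  the derivative, and W is the common kernel of D_e and of the D_w, w in g_{1/2}. A direct computation
  shows that L, phi(a) and psi(u) are in this kernel. Up to terms in lower variables they are f, a and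
  u, so V(g_{<=1/2}) is the algebra of differential polynomials in L, phi(a), psi(u), x and a basis
  of g_{1/2}. In these variables D_e differentiates with respect to the derivatives of x only, and
  then D_w with respect to those of the basis vectors of g_{1/2} only, so a polynomial in the kernel
  involves neither. The spaces of weight 1 and 3/2 are read off from the weights of the generators.
*)

theory Submission
  imports Defs
begin

section \<open>Homomorphisms of differential polynomials\<close>

text \<open>Diagonalisability of \<open>ad x\<close> is not given. It comes from the identity
  \<open>4 (ad x)^3 = ad x\<close> on the complement of the triple, which also makes the projections
  onto the graded pieces explicit polynomials in \<open>ad x\<close>. The form is not normalised, so
  \<open>\<kappa> e f = 2 \<kappa> x x\<close> survives as a denominator throughout. The parameter
  \<open>z\<close> disappears because \<open>e\<close> commutes with everything of positive degree.

  Eliminating a variable rests on coefficients of \<lambda>: if an operator sends the variable to a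
  constant c, it sends the n-th derivative to c \<lambda>^n, so one equation separates all
  derivatives. The order is forced: D_w maps x to a multiple of w, which is not constant, so x has
  to go before the basis of g_{1/2}.

  The reference basis \<open>bas\<close> of g is unrelated to the grading. Independence of variables
  adapted to the grading therefore needs its own argument, a left inverse of the substitution, and
  conformal weight is carried by a derivation that need not be diagonal in the given
  variables.\<close>

definition dmon :: "('j \<times> nat \<Rightarrow> ('i, 'k::comm_ring_1) dpoly) \<Rightarrow> ('j \<times> nat \<Rightarrow>\<^sub>0 nat) \<Rightarrow> ('i, 'k) dpoly" where
  "dmon \<sigma> m = (\<Prod>v\<in>Poly_Mapping.keys m. \<sigma> v ^ Poly_Mapping.lookup m v)"

lemma dmon_superset:
  "finite S \<Longrightarrow> Poly_Mapping.keys m \<subseteq> S \<Longrightarrow> dmon \<sigma> m = (\<Prod>v\<in>S. \<sigma> v ^ Poly_Mapping.lookup m v)"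
  unfolding dmon_def by (rule prod.mono_neutral_left) (auto simp: in_keys_iff)

lemma dmon_add: "dmon \<sigma> (m + n) = dmon \<sigma> m * dmon \<sigma> n"
proof -
  let ?S = "Poly_Mapping.keys m \<union> Poly_Mapping.keys n \<union> Poly_Mapping.keys (m + n)"
  have f: "finite ?S" by simp
  show ?thesis
    by (subst (1 2 3) dmon_superset[OF f]) (auto simp: lookup_add power_add prod.distrib)
qed

lemma dsubst_altdef: "dsubst \<sigma> p = (\<Sum>m\<in>Poly_Mapping.keys p. dconst (Poly_Mapping.lookup p m) * dmon \<sigma> m)"
  by (simp add: dsubst_def dmon_def)

lemma dsubst_add: "dsubst \<sigma> (p + q) = dsubst \<sigma> p + dsubst \<sigma> q"
  unfolding dsubst_altdef
  by (rule setsum_keys_plus_distrib) (auto simp: dconst_add algebra_simps)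

lemma dsubst_single: "dsubst \<sigma> (Poly_Mapping.single m c) = dconst c * dmon \<sigma> m"
  by (cases "c = 0") (auto simp: dsubst_altdef)

lemma dsubst_0 [simp]: "dsubst \<sigma> 0 = 0"
  by (simp add: dsubst_def)

lemma dsubst_mult: "dsubst \<sigma> (p * q) = dsubst \<sigma> p * dsubst \<sigma> q"
proof (induction p rule: poly_mapping_add_induct)
  case (add m a p)
  have "dsubst \<sigma> (Poly_Mapping.single m a * q) = dsubst \<sigma> (Poly_Mapping.single m a) * dsubst \<sigma> q"
    by (induction q rule: poly_mapping_add_induct)
      (simp_all add: distrib_left dsubst_add mult_single dsubst_single dmon_add dconst_mult algebra_simps)
  with add show ?case by (simp add: distrib_right dsubst_add)
qed simp

lemma dsubst_const [simp]: "dsubst \<sigma> (dconst c) = dconst c"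
  using dsubst_single[of \<sigma> 0 c] by (simp add: dmon_def flip: dconst_def)

lemma dsubst_var [simp]: "dsubst \<sigma> (dvar v) = \<sigma> v"
  by (simp add: dvar_def dsubst_single dmon_def)

lemma diff_hom_add: "diff_hom G (p + q) = diff_hom G p + diff_hom G q"
  by (simp add: diff_hom_def dsubst_add)

lemma diff_hom_mult: "diff_hom G (p * q) = diff_hom G p * diff_hom G q"
  by (simp add: diff_hom_def dsubst_mult)

lemma diff_hom_const [simp]: "diff_hom G (dconst c) = dconst c"
  by (simp add: diff_hom_def)

lemma diff_hom_0 [simp]: "diff_hom G 0 = 0"
  by (simp add: diff_hom_def)

lemma diff_hom_1 [simp]: "diff_hom G 1 = 1"
  using diff_hom_const[of G 1] by simp

lemma diff_hom_minus: "diff_hom G (- p) = - diff_hom G p"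
  using diff_hom_add[of G p "- p"] by (simp add: eq_neg_iff_add_eq_0 add.commute)

lemma diff_hom_diff: "diff_hom G (p - q) = diff_hom G p - diff_hom G q"
  using diff_hom_add[of G p "- q"] by (simp add: diff_hom_minus)

lemma diff_hom_sum: "diff_hom G (\<Sum>i\<in>A. p i) = (\<Sum>i\<in>A. diff_hom G (p i))"
  by (induction A rule: infinite_finite_induct) (auto simp: diff_hom_add)

lemma diff_hom_var [simp]: "diff_hom G (dvar (j, n)) = (dD ^^ n) (G j)"
  by (simp add: diff_hom_def)

lemma diff_hom_dD: "diff_hom G (dD p) = dD (diff_hom G p)"
proof (induction p rule: dpoly_induct)
  case (var v)
  show ?case by (cases v) (simp add: dD_var)
qed (simp_all add: dD_add dD_mult diff_hom_add diff_hom_mult)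

lemma diff_hom_dD_pow: "diff_hom G ((dD ^^ n) p) = (dD ^^ n) (diff_hom G p)"
  by (induction n) (simp_all add: diff_hom_dD)

lemma diff_hom_comp: "diff_hom G (diff_hom H p) = diff_hom (\<lambda>j. diff_hom G (H j)) p"
proof (induction p rule: dpoly_induct)
  case (var v)
  show ?case by (cases v) (simp add: diff_hom_dD_pow)
qed (simp_all add: diff_hom_add diff_hom_mult)

lemma dD_pow_dvar: "(dD ^^ n) (dvar (j, 0)) = dvar (j, n)"
  by (induction n) (simp_all add: dD_var)

lemma diff_hom_id: "diff_hom (\<lambda>j. dvar (j, 0)) p = p"
proof (induction p rule: dpoly_induct)
  case (var v)
  show ?case by (cases v) (simp add: dD_pow_dvar)
qed (simp_all add: diff_hom_add diff_hom_mult)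

lemma diff_hom_cong:
  assumes "dvars p \<subseteq> I \<times> UNIV" and "\<And>j. j \<in> I \<Longrightarrow> G j = H j"
  shows "diff_hom G p = diff_hom H p"
  unfolding diff_hom_def dsubst_def
proof (rule sum.cong[OF refl], rule arg_cong[where f = "\<lambda>a. dconst (Poly_Mapping.lookup p m) * a" for m],
    rule prod.cong[OF refl])
  fix m v assume "m \<in> Poly_Mapping.keys p" "v \<in> Poly_Mapping.keys m"
  then have "v \<in> dvars p" by (auto simp: dvars_def)
  then have "fst v \<in> I" using assms(1) by auto
  then show "(case v of (j, n) \<Rightarrow> (dD ^^ n) (G j)) ^ Poly_Mapping.lookup m v =
      (case v of (j, n) \<Rightarrow> (dD ^^ n) (H j)) ^ Poly_Mapping.lookup m v"
    by (cases v) (simp add: assms(2))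
qed

section \<open>Occurring variables and partial derivatives\<close>

lemma dvars_add: "dvars (p + q) \<subseteq> dvars p \<union> dvars q"
  unfolding dvars_def using keys_add[of p q] by blast

lemma dvars_mult: "dvars (p * q) \<subseteq> dvars p \<union> dvars q"
proof
  fix v assume "v \<in> dvars (p * q)"
  then obtain m where "m \<in> Poly_Mapping.keys (p * q)" "v \<in> Poly_Mapping.keys m"
    by (auto simp: dvars_def)
  moreover then obtain a b where "m = a + b" "a \<in> Poly_Mapping.keys p" "b \<in> Poly_Mapping.keys q"
    using keys_mult[of p q] by blast
  ultimately show "v \<in> dvars p \<union> dvars q"
    using keys_add[of a b] by (auto simp: dvars_def)
qed

lemma dvars_const [simp]: "dvars (dconst c) = {}"
  by (auto simp: dvars_def dconst_def)

lemma dvars_0 [simp]: "dvars 0 = {}"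
  by (simp add: dvars_def)

lemma dvars_var [simp]: "dvars (dvar v :: ('i, 'k::comm_ring_1) dpoly) = {v}"
  by (simp add: dvars_def dvar_def)

lemma dvars_sum: "dvars (\<Sum>i\<in>A. p i) \<subseteq> (\<Union>i\<in>A. dvars (p i))"
proof (induction A rule: infinite_finite_induct)
  case (insert i A)
  then show ?case using dvars_add[of "p i" "sum p A"] by auto
qed auto

lemma lookup_dpartial:
  "Poly_Mapping.lookup (dpartial v p) m =
     of_nat (Suc (Poly_Mapping.lookup m v)) * Poly_Mapping.lookup p (m + Poly_Mapping.single v 1)"
proof (induction p rule: poly_mapping_add_induct)
  case (add n c p)
  have "Poly_Mapping.lookup (dpartial v (Poly_Mapping.single n c)) m =
     of_nat (Suc (Poly_Mapping.lookup m v)) * Poly_Mapping.lookup (Poly_Mapping.single n c) (m + Poly_Mapping.single v 1)"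
  proof (cases "Poly_Mapping.lookup n v")
    case 0
    then have "n \<noteq> m + Poly_Mapping.single v 1"
      by (auto simp: lookup_add)
    with 0 show ?thesis by (simp add: dpartial_single lookup_single)
  next
    case (Suc k)
    then have "n - Poly_Mapping.single v 1 + Poly_Mapping.single v 1 = n"
      by (intro poly_mapping_eqI) (auto simp: lookup_add lookup_minus lookup_single when_def)
    then have "n - Poly_Mapping.single v 1 = m \<longleftrightarrow> n = m + Poly_Mapping.single v 1"
      by auto
    then show ?thesis
      by (auto simp: dpartial_single lookup_single when_def lookup_add)
  qed
  with add show ?case by (simp add: dpartial_add lookup_add algebra_simps)
qed simp

lemma dvars_dpartial: "dvars (dpartial v p) \<subseteq> dvars p"
proof
  fix w assume "w \<in> dvars (dpartial v p)"
  then obtain m where m: "Poly_Mapping.lookup (dpartial v p) m \<noteq> 0" "w \<in> Poly_Mapping.keys m"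
    by (auto simp: dvars_def in_keys_iff)
  then have "m + Poly_Mapping.single v 1 \<in> Poly_Mapping.keys p"
    by (auto simp: lookup_dpartial in_keys_iff)
  moreover have "w \<in> Poly_Mapping.keys (m + Poly_Mapping.single v 1)"
    using m(2) by (simp add: in_keys_iff lookup_add)
  ultimately show "w \<in> dvars p" unfolding dvars_def by blast
qed

text \<open>A coefficient of \<open>p\<close> at a monomial containing \<open>v\<close> reappears in
  the partial derivative, multiplied by the exponent of \<open>v\<close>, which is nonzero in
  characteristic 0.\<close>

lemma dpartial_eq_0_iff:
  fixes p :: "('i, 'k::field_char_0) dpoly"
  shows "dpartial v p = 0 \<longleftrightarrow> v \<notin> dvars p"
proof
  assume 0: "dpartial v p = 0"
  show "v \<notin> dvars p"
  proof
    assume "v \<in> dvars p"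
    then obtain m where m: "m \<in> Poly_Mapping.keys p" "v \<in> Poly_Mapping.keys m"
      by (auto simp: dvars_def)
    have "m - Poly_Mapping.single v 1 + Poly_Mapping.single v 1 = m"
      using m(2) by (intro poly_mapping_eqI) (auto simp: lookup_add lookup_minus lookup_single when_def in_keys_iff)
    then have "Poly_Mapping.lookup p m = 0"
      using lookup_dpartial[of v p "m - Poly_Mapping.single v 1"] 0
      by (simp del: of_nat_Suc)
    with m(1) show False by (simp add: in_keys_iff)
  qed
qed (rule dpartial_notin)

lemma dvars_dD: "dvars p \<subseteq> I \<times> UNIV \<Longrightarrow> dvars (dD p) \<subseteq> I \<times> UNIV"
proof -
  assume p: "dvars p \<subseteq> I \<times> UNIV"
  have "dvars (dpartial v p * dvar (fst v, Suc (snd v))) \<subseteq> I \<times> UNIV" if "v \<in> dvars p" for v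
  proof -
    have "dvars (dpartial v p * dvar (fst v, Suc (snd v))) \<subseteq> dvars p \<union> {(fst v, Suc (snd v))}"
      using dvars_mult[of "dpartial v p" "dvar (fst v, Suc (snd v))"] dvars_dpartial[of v p] by auto
    also have "\<dots> \<subseteq> I \<times> UNIV" using p that by auto
    finally show ?thesis .
  qed
  then show ?thesis unfolding dD_def by (intro order_trans[OF dvars_sum] UN_least)
qed

section \<open>Differential subalgebras, derivations and changes of variables\<close>

lemma diff_alg_sum: "(\<And>i. i \<in> A \<Longrightarrow> p i \<in> diff_alg S) \<Longrightarrow> (\<Sum>i\<in>A. p i) \<in> diff_alg S"
  by (induction A rule: infinite_finite_induct)
    (use diff_alg.const[of 0 S] in \<open>auto intro: diff_alg.add\<close>)

lemma diff_alg_power: "p \<in> diff_alg S \<Longrightarrow> p ^ n \<in> diff_alg S"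
  by (induction n) (use diff_alg.const[of 1 S] in \<open>auto intro: diff_alg.mult\<close>)

lemma diff_alg_prod: "(\<And>i. i \<in> A \<Longrightarrow> p i \<in> diff_alg S) \<Longrightarrow> (\<Prod>i\<in>A. p i) \<in> diff_alg S"
  by (induction A rule: infinite_finite_induct)
    (use diff_alg.const[of 1 S] in \<open>auto intro: diff_alg.mult\<close>)

lemma diff_alg_dD_pow: "p \<in> diff_alg S \<Longrightarrow> (dD ^^ n) p \<in> diff_alg S"
  by (induction n) (auto intro: diff_alg.deriv)

lemma diff_alg_minus: "p \<in> diff_alg S \<Longrightarrow> - p \<in> diff_alg S"
proof -
  assume "p \<in> diff_alg S"
  then have "dconst (- 1) * p \<in> diff_alg S" by (intro diff_alg.mult diff_alg.const)
  moreover have "dconst (- 1) + 1 = (0 :: ('a, 'b) dpoly)"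
    using dconst_add[of "- 1" "1 :: 'b"] by simp
  then have "dconst (- 1) = (- 1 :: ('a, 'b) dpoly)"
    by (rule eq_neg_iff_add_eq_0[THEN iffD2])
  ultimately show ?thesis by simp
qed

lemma diff_alg_diff: "p \<in> diff_alg S \<Longrightarrow> q \<in> diff_alg S \<Longrightarrow> p - q \<in> diff_alg S"
  using diff_alg.add[OF _ diff_alg_minus] by fastforce

lemma diff_alg_dscale: "p \<in> diff_alg S \<Longrightarrow> dscale c p \<in> diff_alg S"
  by (simp add: dscale_def diff_alg.mult diff_alg.const)

lemma diff_alg_subset: "S \<subseteq> diff_alg T \<Longrightarrow> diff_alg S \<subseteq> diff_alg T"
proof
  fix p assume "p \<in> diff_alg S" "S \<subseteq> diff_alg T"
  then show "p \<in> diff_alg T"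
    by (induction rule: diff_alg.induct) (auto intro: diff_alg.intros)
qed

text \<open>Turns the inductive description of a differential subalgebra into one by polynomials in
  the generators, which is what allows an element of V to be expanded and its variables to be
  inspected.\<close>

lemma diff_alg_image: "diff_alg (G ` I) = diff_hom G ` {p. dvars p \<subseteq> I \<times> UNIV}"
proof (intro equalityI subsetI)
  fix g assume "g \<in> diff_alg (G ` I)"
  then have "\<exists>p. dvars p \<subseteq> I \<times> UNIV \<and> g = diff_hom G p"
  proof (induction rule: diff_alg.induct)
    case (gen g)
    then obtain j where "j \<in> I" "g = G j" by auto
    then show ?case by (intro exI[of _ "dvar (j, 0)"]) auto
  next
    case (const c)
    show ?case by (intro exI[of _ "dconst c"]) auto
  next
    case (add g h)
    then obtain p q where "dvars p \<subseteq> I \<times> UNIV" "g = diff_hom G p" "dvars q \<subseteq> I \<times> UNIV" "h = diff_hom G q"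
      by blast
    then show ?case
      using dvars_add[of p q] by (intro exI[of _ "p + q"]) (auto simp: diff_hom_add)
  next
    case (mult g h)
    then obtain p q where "dvars p \<subseteq> I \<times> UNIV" "g = diff_hom G p" "dvars q \<subseteq> I \<times> UNIV" "h = diff_hom G q"
      by blast
    then show ?case
      using dvars_mult[of p q] by (intro exI[of _ "p * q"]) (auto simp: diff_hom_mult)
  next
    case (deriv g)
    then obtain p where "dvars p \<subseteq> I \<times> UNIV" "g = diff_hom G p"
      by blast
    then show ?case
      using dvars_dD[of p I] by (intro exI[of _ "dD p"]) (auto simp: diff_hom_dD)
  qed
  then show "g \<in> diff_hom G ` {p. dvars p \<subseteq> I \<times> UNIV}" by auto
next
  fix g assume "g \<in> diff_hom G ` {p. dvars p \<subseteq> I \<times> UNIV}"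
  then obtain p where p: "dvars p \<subseteq> I \<times> UNIV" "g = diff_hom G p" by auto
  have var: "(case v of (j, n) \<Rightarrow> (dD ^^ n) (G j)) \<in> diff_alg (G ` I)" if "v \<in> dvars p" for v
  proof -
    obtain j n where v: "v = (j, n)" by (cases v)
    with that p(1) have "G j \<in> G ` I" by auto
    then show ?thesis by (simp add: v diff_alg_dD_pow diff_alg.gen)
  qed
  show "g \<in> diff_alg (G ` I)"
    unfolding p(2) diff_hom_def dsubst_def
  proof (rule diff_alg_sum, rule diff_alg.mult, rule diff_alg.const, rule diff_alg_prod, rule diff_alg_power)
    fix m v assume "m \<in> Poly_Mapping.keys p" "v \<in> Poly_Mapping.keys m"
    then have "v \<in> dvars p" by (auto simp: dvars_def)
    then show "(case v of (j, n) \<Rightarrow> (dD ^^ n) (G j)) \<in> diff_alg (G ` I)" by (rule var)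
  qed
qed

lemma diff_hom_in_diff_alg: "dvars p \<subseteq> I \<times> UNIV \<Longrightarrow> diff_hom G p \<in> diff_alg (G ` I)"
  unfolding diff_alg_image by (rule imageI) simp

lemma diff_algE:
  assumes "g \<in> diff_alg (G ` I)"
  obtains p where "dvars p \<subseteq> I \<times> UNIV" "g = diff_hom G p"
  using assms unfolding diff_alg_image by blast

text \<open>A derivation along \<open>\<theta>\<close> is determined by its values on the variables.
  The target ring is left abstract because the derivations of interest take values in
  V[\<lambda>].\<close>

lemma derivation_expand:
  fixes \<theta> \<delta> :: "('j, 'k::comm_ring_1) dpoly \<Rightarrow> 'r::comm_ring_1"
  assumes \<theta>: "\<And>p q. \<theta> (p + q) = \<theta> p + \<theta> q" "\<And>p q. \<theta> (p * q) = \<theta> p * \<theta> q" "\<theta> 0 = 0" "\<theta> 1 = 1"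
    and \<delta>: "\<And>p q. \<delta> (p + q) = \<delta> p + \<delta> q" "\<And>p q. \<delta> (p * q) = \<theta> p * \<delta> q + \<theta> q * \<delta> p"
      "\<And>c. \<delta> (dconst c) = 0"
  shows "\<delta> p = (\<Sum>v\<in>dvars p. \<theta> (dpartial v p) * \<delta> (dvar v))"
proof -
  define \<epsilon> where "\<epsilon> p = (\<Sum>v\<in>dvars p. \<theta> (dpartial v p) * \<delta> (dvar v))" for p
  have sup: "\<epsilon> p = (\<Sum>v\<in>S. \<theta> (dpartial v p) * \<delta> (dvar v))" if "finite S" "dvars p \<subseteq> S" for S p
    unfolding \<epsilon>_def using that by (intro sum.mono_neutral_left) (auto simp: dpartial_notin \<theta>)
  have "\<epsilon> p = \<delta> p"
  proof (induction p rule: dpoly_induct)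
    case (const c)
    show ?case by (simp add: \<epsilon>_def \<delta>)
  next
    case (var v)
    show ?case by (simp add: \<epsilon>_def dpartial_var \<theta>)
  next
    case (add p q)
    let ?S = "dvars p \<union> dvars q \<union> dvars (p + q)"
    have f: "finite ?S" by (simp add: finite_dvars)
    have "\<epsilon> (p + q) = \<epsilon> p + \<epsilon> q"
      by (subst (1 2 3) sup[OF f]) (auto simp: dpartial_add \<theta> algebra_simps sum.distrib)
    with add show ?case by (simp add: \<delta>)
  next
    case (mult p q)
    let ?S = "dvars p \<union> dvars q \<union> dvars (p * q)"
    have f: "finite ?S" by (simp add: finite_dvars)
    have "\<epsilon> (p * q) = \<theta> p * \<epsilon> q + \<theta> q * \<epsilon> p"
      by (subst (1 2 3) sup[OF f])
        (auto simp: dpartial_mult \<theta> algebra_simps sum.distrib sum_distrib_left)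
    with mult show ?case by (simp add: \<delta>)
  qed
  then show ?thesis by (simp add: \<epsilon>_def)
qed

text \<open>A triangular change of variables is invertible: the inverse substitution \<open>T\<close> solves
  \<open>T j = u\<^sub>j - T(R j)\<close>, and it is reached after finitely many iterations because \<open>R j\<close> only
  involves variables of lower level.\<close>

lemma diff_polys_in_triangular:
  fixes B G :: "'j \<Rightarrow> ('i, 'k::comm_ring_1) dpoly" and lev :: "'j \<Rightarrow> nat"
  assumes B: "diff_polys_in V K B"
    and low: "\<And>j. j \<in> K \<Longrightarrow> G j - B j \<in> diff_alg (B ` {i \<in> K. lev i < lev j})"
    and bound: "\<And>j. j \<in> K \<Longrightarrow> lev j < N"
  shows "diff_polys_in V K G"
proof -
  have ex: "\<exists>R. dvars R \<subseteq> {i \<in> K. lev i < lev j} \<times> UNIV \<and> G j - B j = diff_hom B R" if "j \<in> K" for j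
    by (rule diff_algE[OF low[OF that]]) (intro exI conjI)
  define R where "R j = (SOME R. dvars R \<subseteq> {i \<in> K. lev i < lev j} \<times> UNIV \<and> G j - B j = diff_hom B R)" for j
  have R: "dvars (R j) \<subseteq> {i \<in> K. lev i < lev j} \<times> UNIV" "G j - B j = diff_hom B (R j)" if "j \<in> K" for j
    unfolding R_def by (rule conjunct1[OF someI_ex[OF ex[OF that]]], rule conjunct2[OF someI_ex[OF ex[OF that]]])
  define T where "T = rec_nat (\<lambda>j. dvar (j, 0)) (\<lambda>_ t j. dvar (j, 0) - diff_hom t (R j))"
  have T_Suc: "T (Suc n) j = dvar (j, 0) - diff_hom (T n) (R j)" for n j
    by (simp add: T_def)
  \<comment> \<open>After \<open>n\<close> rounds the values on levels below \<open>n\<close> are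
    final, so \<open>T N\<close> solves the equation on all of \<open>K\<close>.\<close>
  have stable: "T (Suc n) j = T n j" if "j \<in> K" "lev j < n" for n j
    using that
  proof (induction n arbitrary: j)
    case (Suc n)
    have "diff_hom (T (Suc n)) (R j) = diff_hom (T n) (R j)"
      using Suc by (intro diff_hom_cong[OF R(1)]) auto
    then show ?case by (simp add: T_Suc)
  qed simp
  have TN: "T N j + diff_hom (T N) (R j) = dvar (j, 0)" if "j \<in> K" for j
    using stable[OF that bound[OF that]] by (simp add: T_Suc algebra_simps)
  \<comment> \<open>\<open>\<Phi>\<close> writes the \<open>G j\<close> in terms of the
    \<open>B j\<close>. As \<open>T N\<close> inverts it from the left, a relation among the
    \<open>G j\<close> vanishes as soon as its image, a relation among the \<open>B j\<close>,
    does.\<close>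
  define \<Phi> where "\<Phi> = diff_hom (\<lambda>j. dvar (j, 0) + R j)"
  have G: "diff_hom G p = diff_hom B (\<Phi> p)" if "dvars p \<subseteq> K \<times> UNIV" for p
    unfolding \<Phi>_def diff_hom_comp
    using R(2) by (intro diff_hom_cong[OF that]) (simp add: diff_hom_add algebra_simps)
  have \<Phi>K: "dvars (\<Phi> p) \<subseteq> K \<times> UNIV" if "dvars p \<subseteq> K \<times> UNIV" for p
  proof -
    have "\<Phi> p \<in> diff_alg ((\<lambda>j. dvar (j, 0) + R j) ` K)"
      unfolding \<Phi>_def by (rule diff_hom_in_diff_alg[OF that])
    also have "\<dots> \<subseteq> diff_alg ((\<lambda>j. dvar (j, 0)) ` K)"
    proof (rule diff_alg_subset, safe)
      fix j assume j: "j \<in> K"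
      have "diff_hom (\<lambda>j. dvar (j, 0)) (R j) \<in> diff_alg ((\<lambda>j. dvar (j, 0)) ` K)"
        using R(1)[OF j] by (intro diff_hom_in_diff_alg) auto
      then show "dvar (j, 0) + R j \<in> diff_alg ((\<lambda>j. dvar (j, 0)) ` K)"
        using j by (intro diff_alg.add[OF diff_alg.gen]) (auto simp: diff_hom_id)
    qed
    also have "\<dots> = {p. dvars p \<subseteq> K \<times> UNIV}"
      by (simp add: diff_alg_image diff_hom_id)
    finally show ?thesis by simp
  qed
  have inv: "diff_hom (T N) (\<Phi> p) = p" if "dvars p \<subseteq> K \<times> UNIV" for p
  proof -
    have "diff_hom (T N) (\<Phi> p) = diff_hom (\<lambda>j. dvar (j, 0)) p"
      unfolding \<Phi>_def diff_hom_comp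
      by (intro diff_hom_cong[OF that]) (simp add: diff_hom_add TN)
    then show ?thesis by (simp add: diff_hom_id)
  qed
  have ind: "p = 0" if p: "dvars p \<subseteq> K \<times> UNIV" "diff_hom G p = 0" for p
  proof -
    have "\<Phi> p = 0"
      using B G[OF p(1)] \<Phi>K[OF p(1)] p(2) by (auto simp: diff_polys_in_def)
    with inv[OF p(1)] show ?thesis by simp
  qed
  \<comment> \<open>Generation needs no inverse: by induction on the level, \<open>B j\<close> is
    \<open>G j\<close> minus terms already reached.\<close>
  have "B j \<in> diff_alg (G ` K)" if "j \<in> K" for j
    using that
  proof (induction "lev j" arbitrary: j rule: less_induct)
    case less
    have "G j - B j \<in> diff_alg (G ` K)"
    proof -
      have "B ` {i \<in> K. lev i < lev j} \<subseteq> diff_alg (G ` K)"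
        using less(1) by blast
      then show ?thesis using diff_alg_subset low[OF less(2)] by blast
    qed
    then have "G j - (G j - B j) \<in> diff_alg (G ` K)"
      by (rule diff_alg_diff[OF diff_alg.gen[OF imageI[OF less(2)]]])
    then show ?case by simp
  qed
  moreover have "G j \<in> diff_alg (B ` K)" if "j \<in> K" for j
  proof -
    have "B ` {i \<in> K. lev i < lev j} \<subseteq> diff_alg (B ` K)"
      by (auto intro: diff_alg.gen)
    then have "G j - B j \<in> diff_alg (B ` K)"
      using diff_alg_subset low[OF that] by blast
    then have "(G j - B j) + B j \<in> diff_alg (B ` K)"
      using that by (rule diff_alg.add[OF _ diff_alg.gen[OF imageI]])
    then show ?thesis by simp
  qed
  ultimately have "diff_alg (B ` K) = diff_alg (G ` K)"
    by (intro equalityI diff_alg_subset image_subsetI)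
  with B ind show ?thesis unfolding diff_polys_in_def by blast
qed

section \<open>Weights of monomials and derivations with prescribed values\<close>

definition mon_weight :: "('j \<times> nat \<Rightarrow> rat) \<Rightarrow> ('j \<times> nat \<Rightarrow>\<^sub>0 nat) \<Rightarrow> rat" where
  "mon_weight w m = (\<Sum>v\<in>Poly_Mapping.keys m. of_nat (Poly_Mapping.lookup m v) * w v)"

text \<open>The Euler derivation for the weights \<open>w\<close>. It is defined on coefficients, so
  that an eigenvalue equation can be read off monomial by monomial.\<close>

definition weight_op :: "('j \<times> nat \<Rightarrow> rat) \<Rightarrow> ('j, 'k::field_char_0) dpoly \<Rightarrow> ('j, 'k) dpoly" where
  "weight_op w = Poly_Mapping.mapp (\<lambda>m c. of_rat (mon_weight w m) * c)"

lemma mon_weight_superset: "finite S \<Longrightarrow> Poly_Mapping.keys m \<subseteq> S \<Longrightarrow>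
    mon_weight w m = (\<Sum>v\<in>S. of_nat (Poly_Mapping.lookup m v) * w v)"
  unfolding mon_weight_def by (rule sum.mono_neutral_left) (auto simp: in_keys_iff)

lemma mon_weight_add: "mon_weight w (m + n) = mon_weight w m + mon_weight w n"
proof -
  let ?S = "Poly_Mapping.keys m \<union> Poly_Mapping.keys n \<union> Poly_Mapping.keys (m + n)"
  have f: "finite ?S" by simp
  show ?thesis
    by (subst (1 2 3) mon_weight_superset[OF f]) (auto simp: lookup_add algebra_simps sum.distrib)
qed

lemma lookup_weight_op:
  "Poly_Mapping.lookup (weight_op w p) m = of_rat (mon_weight w m) * Poly_Mapping.lookup p m"
  by (simp add: weight_op_def lookup_mapp when_def in_keys_iff)

lemma weight_op_add: "weight_op w (p + q) = weight_op w p + weight_op w q"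
  by (rule poly_mapping_eqI) (simp add: lookup_weight_op lookup_add algebra_simps)

lemma weight_op_0 [simp]: "weight_op w 0 = 0"
  by (rule poly_mapping_eqI) (simp add: lookup_weight_op)

lemma weight_op_single:
  "weight_op w (Poly_Mapping.single m c) = Poly_Mapping.single m (of_rat (mon_weight w m) * c)"
  by (rule poly_mapping_eqI) (auto simp: lookup_weight_op lookup_single when_def)

lemma weight_op_mult: "weight_op w (p * q) = weight_op w p * q + weight_op w q * p"
proof (induction p rule: poly_mapping_add_induct)
  case (add m a p)
  have "weight_op w (Poly_Mapping.single m a * q) =
     weight_op w (Poly_Mapping.single m a) * q + weight_op w q * Poly_Mapping.single m a"
    by (induction q rule: poly_mapping_add_induct)
      (simp_all add: distrib_left distrib_right weight_op_add weight_op_single mult_single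
        mon_weight_add of_rat_add algebra_simps flip: single_add)
  with add show ?case by (simp add: weight_op_add distrib_right distrib_left algebra_simps)
qed simp

lemma weight_op_const: "weight_op w (dconst c) = 0"
  by (simp add: dconst_def weight_op_single mon_weight_def)

lemma weight_op_var: "weight_op w (dvar v) = dconst (of_rat (w v)) * dvar v"
  by (simp add: dvar_def dconst_def weight_op_single mon_weight_def mult_single)

lemma mon_weight_ge_1:
  assumes w: "\<And>v. 1 \<le> w v" and m: "m \<noteq> 0"
  shows "1 \<le> mon_weight w m"
proof -
  obtain v where v: "v \<in> Poly_Mapping.keys m" using m by (meson all_not_in_conv keys_eq_empty)
  have nonneg: "0 \<le> of_nat (Poly_Mapping.lookup m u) * w u" for u
    using w[of u] by simp
  have "1 * 1 \<le> of_nat (Poly_Mapping.lookup m v) * w v"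
    using v w[of v] by (intro mult_mono) (auto simp: in_keys_iff)
  also have "\<dots> \<le> mon_weight w m"
    unfolding mon_weight_def by (rule member_le_sum[OF v]) (simp_all add: nonneg)
  finally show ?thesis by simp
qed

text \<open>Every variable has weight at least 1, so two factors already reach weight 2.\<close>

lemma mon_weight_less_2:
  assumes w: "\<And>v. 1 \<le> w v" and m: "0 < mon_weight w m" "mon_weight w m < 2"
  shows "\<exists>v. m = Poly_Mapping.single v 1 \<and> w v = mon_weight w m"
proof -
  have "m \<noteq> 0" using m(1) by (auto simp: mon_weight_def)
  then obtain v where v: "v \<in> Poly_Mapping.keys m" by (meson all_not_in_conv keys_eq_empty)
  define n where "n = m - Poly_Mapping.single v 1"
  have mn: "m = n + Poly_Mapping.single v 1"
    unfolding n_def using v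
    by (intro poly_mapping_eqI) (auto simp: lookup_add lookup_minus lookup_single when_def in_keys_iff)
  have wm: "mon_weight w m = mon_weight w n + w v"
    by (simp add: mn mon_weight_add) (simp add: mon_weight_def)
  then have "n = 0" using mon_weight_ge_1[of w n] w[of v] w m(2) by fastforce
  then have "m = Poly_Mapping.single v 1" "w v = mon_weight w m"
    using mn wm by (simp_all add: mon_weight_def)
  then show ?thesis by blast
qed

text \<open>Serves to define the conformal weight operator on V. The diagonal
  \<open>weight_op\<close> would not do there, because the members of \<open>bas\<close> need not be
  homogeneous.\<close>

definition deriv_ext :: "('i \<times> nat \<Rightarrow> ('i, 'k::comm_ring_1) dpoly) \<Rightarrow> ('i, 'k) dpoly \<Rightarrow> ('i, 'k) dpoly" where
  "deriv_ext c p = (\<Sum>v\<in>dvars p. dpartial v p * c v)"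

lemma deriv_ext_superset:
  "finite S \<Longrightarrow> dvars p \<subseteq> S \<Longrightarrow> deriv_ext c p = (\<Sum>v\<in>S. dpartial v p * c v)"
  unfolding deriv_ext_def by (rule sum.mono_neutral_left) (auto simp: dpartial_notin)

lemma deriv_ext_add: "deriv_ext c (p + q) = deriv_ext c p + deriv_ext c q"
proof -
  let ?S = "dvars p \<union> dvars q \<union> dvars (p + q)"
  have f: "finite ?S" by (simp add: finite_dvars)
  show ?thesis
    by (subst (1 2 3) deriv_ext_superset[OF f]) (auto simp: dpartial_add sum.distrib algebra_simps)
qed

lemma deriv_ext_mult: "deriv_ext c (p * q) = deriv_ext c p * q + p * deriv_ext c q"
proof -
  let ?S = "dvars p \<union> dvars q \<union> dvars (p * q)"
  have f: "finite ?S" by (simp add: finite_dvars)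
  show ?thesis
    by (subst (1 2 3) deriv_ext_superset[OF f])
      (auto simp: dpartial_mult sum.distrib algebra_simps sum_distrib_left sum_distrib_right)
qed

lemma deriv_ext_const [simp]: "deriv_ext c (dconst r) = 0"
  by (simp add: deriv_ext_def)

lemma deriv_ext_var [simp]: "deriv_ext c (dvar v) = c v"
  by (simp add: deriv_ext_def dpartial_var)

section \<open>Minimal nilpotent elements\<close>

context lie_algebra
begin

lemma lb_0 [simp]: "lb 0 a = 0" "lb a 0 = 0"
  using lb_add_left[of 0 0 a] lb_add_right[of a 0 0] by auto

lemma lb_minus: "lb (- a) b = - lb a b" "lb a (- b) = - lb a b"
  using lb_add_left[of a "- a" b] lb_add_right[of a b "- b"]
  by (simp_all add: eq_neg_iff_add_eq_0 add.commute)

lemma lb_diff: "lb (a - b) c = lb a c - lb b c" "lb c (a - b) = lb c a - lb c b"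
  using lb_add_left[of a "- b" c] lb_add_right[of c a "- b"] by (simp_all add: lb_minus)

lemma lb_sum: "lb (\<Sum>i\<in>A. F i) a = (\<Sum>i\<in>A. lb (F i) a)" "lb a (\<Sum>i\<in>A. F i) = (\<Sum>i\<in>A. lb a (F i))"
  by (induction A rule: infinite_finite_induct) (auto simp: lb_add_left lb_add_right)

lemma lb_anti: "lb a b = - lb b a"
proof -
  have "lb a b + lb b a = 0"
    using lb_self[of "a + b"] lb_self[of a] lb_self[of b]
    by (simp add: lb_add_left lb_add_right add.commute)
  then show ?thesis by (simp add: eq_neg_iff_add_eq_0)
qed

lemma lb_jacobi: "lb a (lb b c) = lb (lb a b) c + lb b (lb a c)"
proof -
  have "lb a (lb b c) + lb b (lb c a) + lb c (lb a b) = 0" by (rule jacobi)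
  moreover have "lb b (lb c a) = - lb b (lb a c)" by (simp add: lb_anti[of c a] lb_minus)
  moreover have "lb c (lb a b) = - lb (lb a b) c" by (rule lb_anti)
  ultimately show ?thesis by (simp add: algebra_simps)
qed

section \<open>Eigenvectors and the root space decomposition\<close>

lemma eigenvectors_sum_zero:
  assumes "finite M" "\<And>\<mu>. \<mu> \<in> M \<Longrightarrow> lb h (y \<mu>) = scale \<mu> (y \<mu>)" "(\<Sum>\<mu>\<in>M. y \<mu>) = 0" "\<mu> \<in> M"
  shows "y \<mu> = 0"
  using assms
proof (induction M arbitrary: y \<mu> rule: finite_induct)
  case (insert \<nu> M)
  have y: "y \<mu> = 0" if "\<mu> \<in> M" for \<mu>
  proof -
    \<comment> \<open>\<open>ad h - \<nu>\<close> kills the summand at \<open>\<nu>\<close> and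
      multiplies the others by nonzero factors, so the induction hypothesis applies to the shorter
      sum.\<close>
    have "(\<Sum>\<mu>\<in>insert \<nu> M. scale (\<mu> - \<nu>) (y \<mu>)) =
        (\<Sum>\<mu>\<in>insert \<nu> M. lb h (y \<mu>) - scale \<nu> (y \<mu>))"
      by (intro sum.cong refl) (simp add: insert.prems(1) scale_left_diff_distrib)
    also have "\<dots> = lb h (\<Sum>\<mu>\<in>insert \<nu> M. y \<mu>) - scale \<nu> (\<Sum>\<mu>\<in>insert \<nu> M. y \<mu>)"
      by (simp only: lb_sum sum_subtractf scale_sum_right)
    also have "\<dots> = 0"
      by (simp only: insert.prems(2)) simp
    finally have "(\<Sum>\<mu>\<in>M. scale (\<mu> - \<nu>) (y \<mu>)) = 0"
      using insert.hyps by simp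
    then have "scale (\<mu> - \<nu>) (y \<mu>) = 0"
      using insert.prems(1) that
      by (intro insert.IH[of "\<lambda>\<mu>. scale (\<mu> - \<nu>) (y \<mu>)" \<mu>]) (auto simp: lb_scale_right mult.commute)
    with that insert.hyps(2) show ?thesis by (auto simp: scale_eq_0_iff)
  qed
  with insert have "y \<nu> = 0" by simp
  with y insert.prems(3) show ?case by auto
qed simp

lemma eigenvector_decomposition:
  assumes "span {a. \<exists>c. lb h a = scale c a} = UNIV"
  shows "\<exists>M y. finite M \<and> (\<forall>\<mu>\<in>M. lb h (y \<mu>) = scale \<mu> (y \<mu>)) \<and> a = (\<Sum>\<mu>\<in>M. y \<mu>)"
proof -
  have "a \<in> span {a. \<exists>c. lb h a = scale c a}" using assms by simp
  then obtain t r where t: "finite t" "t \<subseteq> {a. \<exists>c. lb h a = scale c a}" "a = (\<Sum>s\<in>t. scale (r s) s)"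
    unfolding span_explicit by blast
  have "\<forall>s\<in>t. \<exists>c. lb h s = scale c s" using t(2) by auto
  then obtain c where c: "\<And>s. s \<in> t \<Longrightarrow> lb h s = scale (c s) s" by metis
  define y where "y \<mu> = (\<Sum>s\<in>{s\<in>t. c s = \<mu>}. scale (r s) s)" for \<mu>
  have "a = (\<Sum>\<mu>\<in>c ` t. y \<mu>)"
    unfolding t(3) y_def by (rule sum.image_gen[OF t(1)])
  moreover have "lb h (y \<mu>) = scale \<mu> (y \<mu>)" for \<mu>
    unfolding y_def lb_sum scale_sum_right
    by (rule sum.cong) (auto simp: lb_scale_right c mult.commute)
  ultimately show ?thesis using t(1) by blast
qed

text \<open>The components under \<open>ad k\<close> of a common eigenvector of \<open>C\<close> are
  again eigenvectors of each \<open>h\<close> in \<open>C\<close>: since \<open>h\<close> and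
  \<open>k\<close> commute, the defects \<open>lb h y - c y\<close> are eigenvectors of
  \<open>ad k\<close> for distinct eigenvalues, and they sum to zero.\<close>

lemma simultaneous_eigenvectors:
  assumes "finite C" "\<And>h. h \<in> C \<Longrightarrow> span {a. \<exists>c. lb h a = scale c a} = UNIV"
    and "\<And>h h'. h \<in> C \<Longrightarrow> h' \<in> C \<Longrightarrow> lb h h' = 0"
  shows "span {a. \<forall>h\<in>C. \<exists>c. lb h a = scale c a} = UNIV"
  using assms
proof (induction C rule: finite_induct)
  case empty
  show ?case by simp
next
  case (insert k C)
  let ?S = "\<lambda>C. {a. \<forall>h\<in>C. \<exists>c. lb h a = scale c a}"
  have "?S C \<subseteq> span (?S (insert k C))"
  proof
    fix a assume a: "a \<in> ?S C"
    obtain M y where "finite M \<and> (\<forall>\<mu>\<in>M. lb k (y \<mu>) = scale \<mu> (y \<mu>)) \<and> a = (\<Sum>\<mu>\<in>M. y \<mu>)"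
      using eigenvector_decomposition[OF insert.prems(1)[OF insertI1], of a] by (elim exE)
    then have M: "finite M" "\<And>\<mu>. \<mu> \<in> M \<Longrightarrow> lb k (y \<mu>) = scale \<mu> (y \<mu>)" "a = (\<Sum>\<mu>\<in>M. y \<mu>)"
      by auto
    have "y \<mu> \<in> ?S (insert k C)" if \<mu>: "\<mu> \<in> M" for \<mu>
    proof -
      have "\<exists>c. lb h (y \<mu>) = scale c (y \<mu>)" if h: "h \<in> C" for h
      proof -
        obtain c where c: "lb h a = scale c a" using a h by auto
        have comm: "lb k h = 0" using insert.prems(2) h by auto
        have "lb h (y \<mu>) - scale c (y \<mu>) = 0"
        proof (rule eigenvectors_sum_zero[OF M(1) _ _ \<mu>])
          show "lb k (lb h (y \<nu>) - scale c (y \<nu>)) = scale \<nu> (lb h (y \<nu>) - scale c (y \<nu>))" if "\<nu> \<in> M" for \<nu>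
            using M(2)[OF that]
            by (simp add: lb_diff lb_jacobi[of k h] comm lb_scale_right scale_right_diff_distrib mult.commute)
          have "(\<Sum>\<nu>\<in>M. lb h (y \<nu>) - scale c (y \<nu>)) = lb h a - scale c a"
            by (simp add: M(3) lb_sum sum_subtractf scale_sum_right)
          then show "(\<Sum>\<nu>\<in>M. lb h (y \<nu>) - scale c (y \<nu>)) = 0" by (simp add: c)
        qed
        then show ?thesis by auto
      qed
      with M(2)[OF \<mu>] show ?thesis by blast
    qed
    then show "a \<in> span (?S (insert k C))"
      unfolding M(3) by (intro span_sum span_base)
  qed
  then have "span (?S C) \<subseteq> span (?S (insert k C))"
    by (intro span_minimal subspace_span)
  then show ?case using insert by auto
qed

text \<open>Simultaneous diagonalisation is done for a finite basis \<open>C\<close> of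
  \<open>H\<close>. It extends to \<open>H\<close> because the elements that act on a given vector
  by a scalar form a subspace.\<close>

lemma root_spaces_span:
  assumes B: "finite B" "span B = UNIV" and H: "cartan_subalgebra scale lb H"
  shows "span (\<Union>\<gamma>. root_space scale lb H \<gamma>) = UNIV"
proof -
  obtain C where C: "C \<subseteq> H" "independent C" "H \<subseteq> span C"
    by (rule maximal_independent_subset[of H])
  have "finite C" using independent_span_bound[OF B(1) C(2)] B(2) by auto
  have sp: "span {a. \<forall>h\<in>C. \<exists>c. lb h a = scale c a} = UNIV"
  proof (rule simultaneous_eigenvectors[OF \<open>finite C\<close>])
    have cart: "\<forall>h\<in>H. \<forall>h'\<in>H. lb h h' = 0" "\<forall>h\<in>H. span {a. \<exists>c. lb h a = scale c a} = UNIV"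
      using H unfolding cartan_subalgebra_def by simp_all
    show "span {a. \<exists>c. lb h a = scale c a} = UNIV" if "h \<in> C" for h
      using cart(2) C(1) that by blast
    show "lb h h' = 0" if "h \<in> C" "h' \<in> C" for h h'
      using cart(1) C(1) that by blast
  qed
  have "{a. \<forall>h\<in>C. \<exists>c. lb h a = scale c a} \<subseteq> (\<Union>\<gamma>. root_space scale lb H \<gamma>)"
  proof
    fix a assume a: "a \<in> {a. \<forall>h\<in>C. \<exists>c. lb h a = scale c a}"
    have "subspace {h. \<exists>c. lb h a = scale c a}"
    proof (rule subspaceI)
      show "0 \<in> {h. \<exists>c. lb h a = scale c a}" by (auto intro: exI[of _ 0])
      show "h + k \<in> {h. \<exists>c. lb h a = scale c a}"
        if "h \<in> {h. \<exists>c. lb h a = scale c a}" "k \<in> {h. \<exists>c. lb h a = scale c a}" for h k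
        using that by (auto simp: lb_add_left scale_left_distrib[symmetric])
      show "scale r h \<in> {h. \<exists>c. lb h a = scale c a}" if "h \<in> {h. \<exists>c. lb h a = scale c a}" for r h
        using that by (auto simp: lb_scale_left)
    qed
    moreover have "C \<subseteq> {h. \<exists>c. lb h a = scale c a}" using a by auto
    ultimately have "span C \<subseteq> {h. \<exists>c. lb h a = scale c a}" by (rule span_minimal[rotated])
    then have "\<forall>h\<in>H. \<exists>c. lb h a = scale c a" using C(3) by auto
    then have "\<forall>h\<in>H. lb h a = scale (SOME c. lb h a = scale c a) a" by (auto intro: someI_ex)
    then have "a \<in> root_space scale lb H (\<lambda>h. SOME c. lb h a = scale c a)"
      by (simp add: root_space_def)
    then show "a \<in> (\<Union>\<gamma>. root_space scale lb H \<gamma>)" by blast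
  qed
  then have "span {a. \<forall>h\<in>C. \<exists>c. lb h a = scale c a} \<subseteq> span (\<Union>\<gamma>. root_space scale lb H \<gamma>)"
    by (rule span_mono)
  then show ?thesis unfolding sp by (rule top_le)
qed

lemma is_rootI:
  "a \<in> root_space scale lb H \<gamma> \<Longrightarrow> a \<noteq> 0 \<Longrightarrow> h \<in> H \<Longrightarrow> \<gamma> h \<noteq> 0 \<Longrightarrow> is_root scale lb H \<gamma>"
  unfolding is_root_def by blast

lemma is_root_cong:
  assumes "\<forall>h\<in>H. \<gamma> h = \<delta> h"
  shows "is_root scale lb H \<gamma> = is_root scale lb H \<delta>"
proof -
  have "root_space scale lb H \<gamma> = root_space scale lb H \<delta>"
    unfolding root_space_def using assms by simp
  then show ?thesis unfolding is_root_def using assms by simp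
qed

lemma root_space_lb:
  assumes "a \<in> root_space scale lb H \<gamma>" "b \<in> root_space scale lb H \<delta>"
  shows "lb a b \<in> root_space scale lb H (\<lambda>h. \<gamma> h + \<delta> h)"
  using assms by (auto simp: root_space_def lb_jacobi[of _ a b] lb_scale_left lb_scale_right
      scale_left_distrib)

end

section \<open>Invariant forms and the square of ad f\<close>

locale invariant_lie = lie_algebra scale lb
  for scale :: "'k::field_char_0 \<Rightarrow> 'g::ab_group_add \<Rightarrow> 'g" and lb +
  fixes \<kappa> :: "'g \<Rightarrow> 'g \<Rightarrow> 'k"
  assumes form: "invariant_form scale lb \<kappa>"
begin

lemma form_add: "\<kappa> (a + b) d = \<kappa> a d + \<kappa> b d" "\<kappa> d (a + b) = \<kappa> d a + \<kappa> d b"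
  using form unfolding invariant_form_def by metis+

lemma form_scale: "\<kappa> (scale r a) b = r * \<kappa> a b" "\<kappa> a (scale r b) = r * \<kappa> a b"
  using form unfolding invariant_form_def by metis+

lemma form_sym: "\<kappa> a b = \<kappa> b a"
  using form unfolding invariant_form_def by blast

lemma form_inv: "\<kappa> (lb a b) d = \<kappa> a (lb b d)"
  using form unfolding invariant_form_def by blast

lemma form_nondeg: "(\<And>b. \<kappa> a b = 0) \<Longrightarrow> a = 0"
  using form unfolding invariant_form_def by blast

lemma form_0 [simp]: "\<kappa> 0 a = 0" "\<kappa> a 0 = 0"
  using form_scale(1)[of 0 0 a] form_scale(2)[of a 0 0] by simp_all

lemma form_minus: "\<kappa> (- a) b = - \<kappa> a b" "\<kappa> a (- b) = - \<kappa> a b"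
  using form_add(1)[of a "- a" b] form_add(2)[of a b "- b"]
  by (simp_all add: eq_neg_iff_add_eq_0 add.commute)

lemma form_diff: "\<kappa> (a - b) d = \<kappa> a d - \<kappa> b d" "\<kappa> d (a - b) = \<kappa> d a - \<kappa> d b"
  using form_add(1)[of a "- b" d] form_add(2)[of d a "- b"] by (simp_all add: form_minus)

lemma form_sum: "\<kappa> (\<Sum>i\<in>A. F i) a = (\<Sum>i\<in>A. \<kappa> (F i) a)" "\<kappa> a (\<Sum>i\<in>A. F i) = (\<Sum>i\<in>A. \<kappa> a (F i))"
  by (induction A rule: infinite_finite_induct) (auto simp: form_add)

lemma form_inv': "\<kappa> (lb h a) b = - \<kappa> a (lb h b)"
  by (simp add: lb_anti[of h a] form_minus form_inv)

lemma eigen_orth: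
  assumes "lb h a = scale r a" "lb h b = scale s b" "r + s \<noteq> 0"
  shows "\<kappa> a b = 0"
proof -
  have "r * \<kappa> a b + s * \<kappa> a b = 0"
    using form_inv'[of h a b] assms by (simp add: form_scale)
  then have "(r + s) * \<kappa> a b = 0" by (simp add: algebra_simps)
  with assms(3) show ?thesis by simp
qed

text \<open>A vector of root \<open>\<gamma>\<close> is orthogonal to every root space except the
  one of \<open>-\<gamma>\<close>. If that one were zero, the vector would lie in the radical of the
  form.\<close>

lemma is_root_uminus:
  assumes sp: "span (\<Union>\<gamma>. root_space scale lb H \<gamma>) = UNIV" and \<gamma>: "is_root scale lb H \<gamma>"
  shows "is_root scale lb H (\<lambda>h. - \<gamma> h)"
proof -
  have z: "0 \<in> root_space scale lb H \<delta>" for \<delta> by (simp add: root_space_def)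
  obtain a where a: "a \<in> root_space scale lb H \<gamma>" "a \<noteq> 0"
    using \<gamma> z[of \<gamma>] by (auto simp: is_root_def)
  have "root_space scale lb H (\<lambda>h. - \<gamma> h) \<noteq> {0}"
  proof
    assume triv: "root_space scale lb H (\<lambda>h. - \<gamma> h) = {0}"
    have 0: "\<kappa> a b = 0" if b: "b \<in> root_space scale lb H \<delta>" for b \<delta>
    proof (cases "\<forall>h\<in>H. \<gamma> h + \<delta> h = 0")
      case True
      then have "\<forall>h\<in>H. \<delta> h = - \<gamma> h" by (auto simp: eq_neg_iff_add_eq_0 add.commute)
      then have "b \<in> root_space scale lb H (\<lambda>h. - \<gamma> h)"
        using b by (simp add: root_space_def)
      then show ?thesis using triv by simp
    next
      case False
      then obtain h where "h \<in> H" "\<gamma> h + \<delta> h \<noteq> 0" by auto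
      then show ?thesis using a(1) b by (intro eigen_orth[of h a "\<gamma> h" b "\<delta> h"]) (auto simp: root_space_def)
    qed
    have "\<kappa> a b = 0" for b
    proof -
      have "subspace {b. \<kappa> a b = 0}"
        by (rule subspaceI) (auto simp: form_add form_scale)
      moreover have "(\<Union>\<gamma>. root_space scale lb H \<gamma>) \<subseteq> {b. \<kappa> a b = 0}" using 0 by blast
      ultimately have "span (\<Union>\<gamma>. root_space scale lb H \<gamma>) \<subseteq> {b. \<kappa> a b = 0}"
        by (rule span_minimal[rotated])
      with sp show ?thesis by auto
    qed
    with a(2) show False using form_nondeg by blast
  qed
  with \<gamma> show ?thesis by (simp add: is_root_def)
qed

text \<open>If \<open>\<gamma> + 2\<beta>\<close> is a root, then \<open>\<gamma> + \<beta>\<close> and \<open>-\<gamma> - \<beta>\<close> are both sums of simple roots, so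
  \<open>\<gamma> = -\<beta>\<close>; hence \<open>(ad f)\<^sup>2\<close> lands in the line of \<open>f\<close>.\<close>

lemma minimal_nilpotent_square:
  assumes B0: "finite B0" "span B0 = UNIV" and min: "minimal_nilpotent scale lb f"
  shows "\<exists>c. lb f (lb f a) = scale c f"
proof -
  obtain H B \<beta> where H: "cartan_subalgebra scale lb H" and B: "root_base scale lb H B"
    and \<beta>: "lowest_root scale lb H B \<beta>" and f: "f \<in> root_space scale lb H \<beta>"
    using min by (auto simp: minimal_nilpotent_def)
  have sp: "span (\<Union>\<gamma>. root_space scale lb H \<gamma>) = UNIV"
    by (rule root_spaces_span[OF B0 H])
  have indep: "c \<alpha> = 0" if "\<forall>h\<in>H. (\<Sum>\<alpha>\<in>B. c \<alpha> * \<alpha> h) = 0" "\<alpha> \<in> B" for c \<alpha>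
  proof -
    have "\<forall>c. (\<forall>h\<in>H. (\<Sum>\<alpha>\<in>B. c \<alpha> * \<alpha> h) = 0) \<longrightarrow> (\<forall>\<alpha>\<in>B. c \<alpha> = 0)"
      using B unfolding root_base_def by simp
    then show ?thesis using that by simp
  qed
  have lowest: "\<exists>n :: _ \<Rightarrow> nat. \<forall>h\<in>H. \<gamma> h - \<beta> h = (\<Sum>\<alpha>\<in>B. of_nat (n \<alpha>) * \<alpha> h)"
    if "is_root scale lb H \<gamma>" for \<gamma>
  proof -
    have "\<forall>\<gamma>. is_root scale lb H \<gamma> \<longrightarrow> (\<exists>n :: _ \<Rightarrow> nat. \<forall>h\<in>H. \<gamma> h - \<beta> h = (\<Sum>\<alpha>\<in>B. of_nat (n \<alpha>) * \<alpha> h))"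
      using \<beta> unfolding lowest_root_def by (rule conjunct2)
    then show ?thesis using that by (elim allE impE)
  qed
  have \<beta>root: "is_root scale lb H \<beta>" using \<beta> by (simp add: lowest_root_def)
  \<comment> \<open>Independence of the base makes the coefficients
    \<open>n \<alpha> * k + m \<alpha>\<close> vanish in the field, hence as natural numbers in
    characteristic 0; as \<open>k > 0\<close>, each \<open>n \<alpha>\<close> is zero.\<close>
  have cancel: "\<forall>h\<in>H. (\<Sum>\<alpha>\<in>B. of_nat (n \<alpha>) * \<alpha> h) = 0"
    if nm: "\<forall>h\<in>H. (\<Sum>\<alpha>\<in>B. of_nat (n \<alpha>) * \<alpha> h) * of_nat k + (\<Sum>\<alpha>\<in>B. of_nat (m \<alpha>) * \<alpha> h) = 0" and "k > 0"
    for n m :: "_ \<Rightarrow> nat" and k :: nat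
  proof -
    have "of_nat (n \<alpha> * k + m \<alpha>) = (0 :: 'k)" if \<alpha>: "\<alpha> \<in> B" for \<alpha>
    proof (rule indep[where c = "\<lambda>\<alpha>. of_nat (n \<alpha> * k + m \<alpha>)", OF _ \<alpha>])
      show "\<forall>h\<in>H. (\<Sum>\<alpha>\<in>B. of_nat (n \<alpha> * k + m \<alpha>) * \<alpha> h) = 0"
      proof
        fix h assume "h \<in> H"
        then have "(\<Sum>\<alpha>\<in>B. of_nat (n \<alpha>) * \<alpha> h) * of_nat k + (\<Sum>\<alpha>\<in>B. of_nat (m \<alpha>) * \<alpha> h) = 0"
          using nm by simp
        moreover have "(\<Sum>\<alpha>\<in>B. of_nat (n \<alpha> * k + m \<alpha>) * \<alpha> h) =
            (\<Sum>\<alpha>\<in>B. of_nat (n \<alpha>) * \<alpha> h) * of_nat k + (\<Sum>\<alpha>\<in>B. of_nat (m \<alpha>) * \<alpha> h)"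
          unfolding sum_distrib_right by (simp add: algebra_simps flip: sum.distrib)
        ultimately show "(\<Sum>\<alpha>\<in>B. of_nat (n \<alpha> * k + m \<alpha>) * \<alpha> h) = 0" by simp
      qed
    qed
    then have "\<forall>\<alpha>\<in>B. n \<alpha> * k + m \<alpha> = 0" using of_nat_eq_0_iff by blast
    with \<open>k > 0\<close> show ?thesis by simp
  qed
  have not2\<beta>: "\<not> is_root scale lb H (\<lambda>h. 2 * \<beta> h)"
  proof
    assume r: "is_root scale lb H (\<lambda>h. 2 * \<beta> h)"
    obtain n :: "_ \<Rightarrow> nat" where n: "\<forall>h\<in>H. 2 * \<beta> h - \<beta> h = (\<Sum>\<alpha>\<in>B. of_nat (n \<alpha>) * \<alpha> h)"
      using lowest[OF r] by (elim exE)
    obtain m :: "_ \<Rightarrow> nat" where m: "\<forall>h\<in>H. - (2 * \<beta> h) - \<beta> h = (\<Sum>\<alpha>\<in>B. of_nat (m \<alpha>) * \<alpha> h)"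
      using lowest[OF is_root_uminus[OF sp r]] by (elim exE)
    \<comment> \<open>Lowestness makes both \<open>\<beta>\<close> and \<open>-3\<beta>\<close>
      nonnegative combinations of simple roots, whence the factor 3.\<close>
    have "\<forall>h\<in>H. (\<Sum>\<alpha>\<in>B. of_nat (n \<alpha>) * \<alpha> h) * of_nat 3 + (\<Sum>\<alpha>\<in>B. of_nat (m \<alpha>) * \<alpha> h) = 0"
      using n m by (auto simp flip: n m)
    from cancel[OF this] have "\<forall>h\<in>H. (\<Sum>\<alpha>\<in>B. of_nat (n \<alpha>) * \<alpha> h) = 0" by simp
    with n have "\<forall>h\<in>H. \<beta> h = 0" by auto
    with \<beta>root show False by (auto simp: is_root_def)
  qed
  have zero: "b \<in> H" if "b \<in> root_space scale lb H \<gamma>" "\<forall>h\<in>H. \<gamma> h = 0" for b \<gamma>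
  proof -
    have "b \<in> {a. \<forall>h\<in>H. lb h a = 0}" using that by (auto simp: root_space_def)
    moreover have "{a. \<forall>h\<in>H. lb h a = 0} = H" using H unfolding cartan_subalgebra_def by simp
    ultimately show ?thesis by simp
  qed
  have main: "\<exists>c. lb f (lb f a) = scale c f" if a: "a \<in> root_space scale lb H \<gamma>" for a \<gamma>
  proof -
    have fh: "lb f h = scale (- \<beta> h) f" if "h \<in> H" for h
      using f that by (simp add: root_space_def lb_anti[of f h])
    have fa: "lb f a \<in> root_space scale lb H (\<lambda>h. \<beta> h + \<gamma> h)"
      by (rule root_space_lb[OF f a])
    have ffa: "lb f (lb f a) \<in> root_space scale lb H (\<lambda>h. \<beta> h + (\<beta> h + \<gamma> h))"
      by (rule root_space_lb[OF f fa])
    consider "lb f (lb f a) = 0" | "\<forall>h\<in>H. \<gamma> h = 0" | "is_root scale lb H \<gamma>" "lb f (lb f a) \<noteq> 0"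
    proof -
      have "is_root scale lb H \<gamma>" if "lb f (lb f a) \<noteq> 0" "h \<in> H" "\<gamma> h \<noteq> 0" for h
      proof -
        have "a \<noteq> 0" using that(1) by auto
        then show ?thesis using that(2,3) by (rule is_rootI[OF a])
      qed
      then show thesis using that by blast
    qed
    then show ?thesis
    proof cases
      case 1
      then show ?thesis by (intro exI[of _ 0]) simp
    next
      case 2
      then have "a \<in> H" using zero[OF a] by simp
      then show ?thesis using fh[of a] by (intro exI[of _ 0]) (simp add: lb_minus lb_scale_right lb_self)
    next
      case 3
      \<comment> \<open>If \<open>\<gamma> + 2\<beta>\<close> vanished on \<open>H\<close>, then
        \<open>-\<gamma> = 2\<beta>\<close> would be a root, which \<open>not2\<beta>\<close>
        excludes.\<close>
      have r: "is_root scale lb H (\<lambda>h. \<beta> h + (\<beta> h + \<gamma> h))"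
      proof -
        have "\<exists>h\<in>H. \<beta> h + (\<beta> h + \<gamma> h) \<noteq> 0"
        proof (rule ccontr)
          assume "\<not> (\<exists>h\<in>H. \<beta> h + (\<beta> h + \<gamma> h) \<noteq> 0)"
          then have "\<forall>h\<in>H. \<beta> h + (\<beta> h + \<gamma> h) = 0" by simp
          then have "\<forall>h\<in>H. - \<gamma> h = 2 * \<beta> h"
            by (metis add.assoc minus_unique mult_2 add.commute)
          then have "is_root scale lb H (\<lambda>h. 2 * \<beta> h)"
            using is_root_uminus[OF sp 3(1)] is_root_cong[of H "\<lambda>h. - \<gamma> h" "\<lambda>h. 2 * \<beta> h"] by blast
          with not2\<beta> show False by simp
        qed
        then show ?thesis using is_rootI[OF ffa 3(2)] by blast
      qed
      obtain n :: "_ \<Rightarrow> nat" where n: "\<forall>h\<in>H. \<beta> h + (\<beta> h + \<gamma> h) - \<beta> h = (\<Sum>\<alpha>\<in>B. of_nat (n \<alpha>) * \<alpha> h)"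
        using lowest[OF r] by (elim exE)
      obtain m :: "_ \<Rightarrow> nat" where m: "\<forall>h\<in>H. - \<gamma> h - \<beta> h = (\<Sum>\<alpha>\<in>B. of_nat (m \<alpha>) * \<alpha> h)"
        using lowest[OF is_root_uminus[OF sp 3(1)]] by (elim exE)
      have "\<forall>h\<in>H. (\<Sum>\<alpha>\<in>B. of_nat (n \<alpha>) * \<alpha> h) * of_nat 1 + (\<Sum>\<alpha>\<in>B. of_nat (m \<alpha>) * \<alpha> h) = 0"
        by (auto simp flip: n m)
      from cancel[OF this] have "\<forall>h\<in>H. \<beta> h + \<gamma> h = 0" using n by auto
      \<comment> \<open>An element of weight zero lies in the Cartan subalgebra, and
        \<open>ad f\<close> maps that into the line of \<open>f\<close>.\<close>
      then have "lb f a \<in> H" using zero[OF fa] by simp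
      then show ?thesis using fh by blast
    qed
  qed
  have "subspace {a. \<exists>c. lb f (lb f a) = scale c f}"
  proof (rule subspaceI)
    show "0 \<in> {a. \<exists>c. lb f (lb f a) = scale c f}" by (auto intro: exI[of _ 0])
    show "a + b \<in> {a. \<exists>c. lb f (lb f a) = scale c f}"
      if "a \<in> {a. \<exists>c. lb f (lb f a) = scale c f}" "b \<in> {a. \<exists>c. lb f (lb f a) = scale c f}" for a b
      using that by (auto simp: lb_add_right scale_left_distrib[symmetric])
    show "scale r a \<in> {a. \<exists>c. lb f (lb f a) = scale c f}" if "a \<in> {a. \<exists>c. lb f (lb f a) = scale c f}" for r a
      using that by (auto simp: lb_scale_right)
  qed
  moreover have "(\<Union>\<gamma>. root_space scale lb H \<gamma>) \<subseteq> {a. \<exists>c. lb f (lb f a) = scale c f}" using main by blast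
  ultimately have "span (\<Union>\<gamma>. root_space scale lb H \<gamma>) \<subseteq> {a. \<exists>c. lb f (lb f a) = scale c f}"
    by (rule span_minimal[rotated])
  with sp show ?thesis by auto
qed

end

section \<open>The minimal grading\<close>

text \<open>Minimality is kept only in the form of \<open>square\<close> and
  \<open>f \<noteq> 0\<close>; the Cartan subalgebra and the roots are forgotten from here
  on.\<close>

locale minimal_grading = invariant_lie scale lb \<kappa>
  for scale :: "'k::field_char_0 \<Rightarrow> 'g::ab_group_add \<Rightarrow> 'g" and lb \<kappa> +
  fixes e x f :: 'g
  assumes triple: "sl2_triple lb e x f" and f_nz: "f \<noteq> 0"
    and square: "\<And>a. \<exists>c. lb f (lb f a) = scale c f"
begin

abbreviation "gr \<equiv> grade scale lb x"

lemma lb_e_f: "lb e f = x + x" and lb_x_e: "lb x e = e" and lb_x_f: "lb x f = - f"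
  using triple by (simp_all add: sl2_triple_def)

lemma lb_f_e: "lb f e = - x - x" and lb_e_x: "lb e x = - e" and lb_f_x: "lb f x = f"
  using lb_anti[of f e] lb_anti[of e x] lb_anti[of f x] by (simp_all add: lb_e_f lb_x_e lb_x_f)

lemma in_gr: "a \<in> gr i \<longleftrightarrow> lb x a = scale (of_rat i) a"
  by (simp add: grade_def)

lemma gr_add: "a \<in> gr i \<Longrightarrow> b \<in> gr i \<Longrightarrow> a + b \<in> gr i"
  by (simp add: in_gr lb_add_right scale_right_distrib)

lemma gr_diff: "a \<in> gr i \<Longrightarrow> b \<in> gr i \<Longrightarrow> a - b \<in> gr i"
  by (simp add: in_gr lb_diff scale_right_diff_distrib)

lemma gr_scale: "a \<in> gr i \<Longrightarrow> scale r a \<in> gr i"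
  by (simp add: in_gr lb_scale_right scale_left_commute)

lemma gr_0 [simp]: "0 \<in> gr i"
  by (simp add: in_gr)

lemma subspace_gr: "subspace (gr i)"
  by (intro subspaceI gr_add gr_scale gr_0)

lemma gr_lb: "a \<in> gr i \<Longrightarrow> b \<in> gr j \<Longrightarrow> lb a b \<in> gr (i + j)"
  by (simp add: in_gr lb_jacobi[of x a b] lb_scale_left lb_scale_right of_rat_add scale_left_distrib)

lemma gr_lb': "a \<in> gr i \<Longrightarrow> b \<in> gr j \<Longrightarrow> k = i + j \<Longrightarrow> lb a b \<in> gr k"
  using gr_lb by simp

lemma gr_orth: "a \<in> gr i \<Longrightarrow> b \<in> gr j \<Longrightarrow> i + j \<noteq> 0 \<Longrightarrow> \<kappa> a b = 0"
  unfolding in_gr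
  by (rule eigen_orth) (auto simp flip: of_rat_add)

lemma gr_unique: "a \<in> gr i \<Longrightarrow> a \<in> gr j \<Longrightarrow> i \<noteq> j \<Longrightarrow> a = 0"
  by (auto simp: in_gr)

lemma e_gr: "e \<in> gr 1" and f_gr: "f \<in> gr (- 1)" and x_gr: "x \<in> gr 0"
  by (simp_all add: in_gr lb_x_e lb_x_f lb_self of_rat_minus)

text \<open>Pair \<open>[f,[f,a]] = r f\<close> with \<open>e\<close>.\<close>

lemma form_e_f_nz: "\<kappa> e f \<noteq> 0"
proof
  assume 0: "\<kappa> e f = 0"
  have "\<kappa> f a = 0" for a
  proof -
    obtain r where r: "lb f (lb f a) = scale r f" using square by blast
    have "\<kappa> (lb f (lb f a)) e = \<kappa> (lb f (lb f e)) a"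
      using form_inv'[of f "lb f a" e] form_inv'[of f a "lb f e"] form_sym[of a] by simp
    also have "lb f (lb f e) = - f - f" by (simp add: lb_f_e lb_diff lb_minus lb_f_x)
    finally have "r * \<kappa> e f = - (2 * \<kappa> f a)"
      by (simp add: r form_scale form_diff form_minus form_sym[of f e])
    with 0 show ?thesis by simp
  qed
  then have "f = 0" by (rule form_nondeg)
  with f_nz show False by simp
qed

text \<open>The scalar is found by pairing with \<open>e\<close> and using
  \<open>[f,[f,e]] = -2f\<close>. In particular \<open>ad f\<close> squares to zero on everything
  orthogonal to \<open>f\<close>.\<close>

lemma lb_f_f: "lb f (lb f a) = scale (- 2 * \<kappa> f a / \<kappa> e f) f"
proof -
  obtain r where r: "lb f (lb f a) = scale r f" using square by blast
  have "\<kappa> (lb f (lb f a)) e = \<kappa> (lb f (lb f e)) a"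
    using form_inv'[of f "lb f a" e] form_inv'[of f a "lb f e"] form_sym[of a] by simp
  also have "lb f (lb f e) = - f - f" by (simp add: lb_f_e lb_diff lb_minus lb_f_x)
  finally have "r * \<kappa> e f = - 2 * \<kappa> f a"
    by (simp add: r form_scale form_diff form_minus form_sym[of f e])
  then have "r = - 2 * \<kappa> f a / \<kappa> e f" using form_e_f_nz by (simp add: field_simps)
  with r show ?thesis by simp
qed

lemma form_x_x: "2 * \<kappa> x x = \<kappa> e f"
proof -
  have "\<kappa> (lb x e) f = \<kappa> x (lb e f)" by (rule form_inv)
  then show ?thesis by (simp add: lb_x_e lb_e_f form_add)
qed

lemma form_x_x_nz: "\<kappa> x x \<noteq> 0"
  using form_x_x form_e_f_nz by auto

section \<open>The orthogonal complement of the triple\<close>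

definition "perp = {a. \<kappa> e a = 0 \<and> \<kappa> f a = 0 \<and> \<kappa> x a = 0}"

lemma perp_add: "a \<in> perp \<Longrightarrow> b \<in> perp \<Longrightarrow> a + b \<in> perp"
  and perp_diff: "a \<in> perp \<Longrightarrow> b \<in> perp \<Longrightarrow> a - b \<in> perp"
  and perp_scale: "a \<in> perp \<Longrightarrow> scale r a \<in> perp"
  by (auto simp: perp_def form_add form_diff form_scale)

lemma perp_e: "a \<in> perp \<Longrightarrow> lb e a \<in> perp" and perp_f: "a \<in> perp \<Longrightarrow> lb f a \<in> perp"
  and perp_x: "a \<in> perp \<Longrightarrow> lb x a \<in> perp"
  by (auto simp: perp_def form_inv[symmetric] lb_self lb_e_f lb_f_e lb_e_x lb_x_e lb_f_x lb_x_f
      form_add form_diff form_minus)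

lemma halve: "a + a = b + b \<Longrightarrow> a = (b::'g)"
proof -
  assume "a + a = b + b"
  then have "scale 2 (a - b) = 0"
    using scale_left_distrib[of 1 1 "a - b"] by (simp add: algebra_simps)
  then show ?thesis by (simp add: scale_eq_0_iff)
qed

text \<open>Put \<open>h = 2x\<close>. Bracketing \<open>[f,[f,a]] = 0\<close> with
  \<open>e\<close>, and using that \<open>[e,a]\<close> is again in \<open>perp\<close>, gives
  \<open>h f a + f h a = 0\<close>; the relation \<open>h f = f h - 2f\<close> turns this into
  \<open>f h a = f a\<close>. Everything about the weights on \<open>perp\<close> follows from this
  relation.\<close>

lemma perp_f_x: "a \<in> perp \<Longrightarrow> lb f (lb x a + lb x a) = lb f a"
proof (rule halve)
  assume a: "a \<in> perp"
  have z: "lb f (lb f b) = 0" if "b \<in> perp" for b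
    using that by (simp add: lb_f_f perp_def)
  have ef: "lb e (lb f b) = lb x b + lb x b + lb f (lb e b)" for b
    by (simp add: lb_jacobi[of e f b] lb_e_f lb_add_left)
  have xf: "lb x (lb f b) = lb f (lb x b) - lb f b" for b
    by (simp add: lb_jacobi[of x f b] lb_x_f lb_minus)
  have "0 = lb e (lb f (lb f a))" by (simp add: z[OF a])
  also have "\<dots> = lb x (lb f a) + lb x (lb f a) + lb f (lb e (lb f a))" by (rule ef)
  also have "lb f (lb e (lb f a)) = lb f (lb x a) + lb f (lb x a)"
    by (simp add: ef lb_add_right z[OF perp_e[OF a]])
  finally show "lb f (lb x a + lb x a) + lb f (lb x a + lb x a) = lb f a + lb f a"
    by (simp add: xf lb_add_right algebra_simps)
qed

text \<open>On \<open>perp\<close> the square of \<open>ad f\<close> vanishes, so only the \<open>sl\<^sub>2\<close>-weights \<open>0, \<plusminus>1/2\<close> occur there.\<close>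

lemma perp_cubic: "a \<in> perp \<Longrightarrow> lb x (scale 4 (lb x (lb x a))) = lb x a"
proof -
  assume a: "a \<in> perp"
  define X where "X b = lb x b + lb x b" for b
  \<comment> \<open>With \<open>h = 2x\<close>, \<open>b = h h a - a\<close>. Since
    \<open>f h = f\<close> on \<open>perp\<close>, \<open>f\<close> kills \<open>b\<close>; since
    \<open>e h = (h - 2) e\<close>, \<open>f e b\<close> has total coefficient
    \<open>1 - 4 + 3 = 0\<close>. Hence \<open>h b = e f b - f e b = 0\<close>, that is
    \<open>h^3 = h\<close>, which is the claim after dividing by 2.\<close>
  define b where "b = X (X a) - a"
  have perpX: "X c \<in> perp" if "c \<in> perp" for c
    unfolding X_def by (intro perp_add perp_x that)
  have fX: "lb f (X c) = lb f c" if "c \<in> perp" for c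
    unfolding X_def by (rule perp_f_x[OF that])
  have eX: "lb e (X c) = X (lb e c) - lb e c - lb e c" for c
    by (simp add: X_def lb_jacobi[of x e c] lb_x_e lb_add_right algebra_simps)
  have X: "X (c + d) = X c + X d" "X (c - d) = X c - X d" for c d
    by (simp_all add: X_def lb_add_right lb_diff)
  have "lb f b = 0"
    by (simp add: b_def lb_diff fX[OF perpX[OF a]] fX[OF a])
  moreover have "lb f (lb e b) = 0"
  proof -
    have ea: "lb e a \<in> perp" by (rule perp_e[OF a])
    have "lb e b = X (X (lb e a)) - X (lb e a) - X (lb e a) - X (lb e a) - X (lb e a) + lb e a + lb e a + lb e a"
      by (simp add: b_def eX X lb_diff algebra_simps)
    then show ?thesis
      by (simp add: lb_diff lb_add_right fX[OF perpX[OF ea]] fX[OF ea])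
  qed
  moreover have "lb e (lb f b) = X b + lb f (lb e b)"
    by (simp add: lb_jacobi[of e f b] lb_e_f lb_add_left X_def)
  ultimately have "X b = 0" by simp
  then have "lb x b = 0" using halve[of "lb x b" 0] by (simp add: X_def)
  moreover have "scale 4 c = c + c + c + c" for c
    using scale_left_distrib[of 2 2 c] scale_left_distrib[of 1 1 c] by simp
  ultimately show ?thesis
    by (simp add: b_def X_def lb_diff lb_add_right algebra_simps)
qed

section \<open>Projections onto the graded pieces\<close>

definition "to_perp a = a - scale (\<kappa> f a / \<kappa> e f) e - scale (\<kappa> e a / \<kappa> e f) f - scale (\<kappa> x a / \<kappa> x x) x"
text \<open>These are the Lagrange interpolation polynomials \<open>1 - 4X^2\<close>,
  \<open>2X^2 + X\<close>, \<open>2X^2 - X\<close> for the eigenvalues 0, 1/2, -1/2, evaluated at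
  \<open>X = ad x\<close> on \<open>perp\<close>.\<close>

definition "pr_0 a = to_perp a - scale 4 (lb x (lb x (to_perp a)))"
definition "pr_p a = scale 2 (lb x (lb x (to_perp a))) + lb x (to_perp a)"
definition "pr_m a = scale 2 (lb x (lb x (to_perp a))) - lb x (to_perp a)"

lemma form_triple: "\<kappa> e e = 0" "\<kappa> f f = 0" "\<kappa> e x = 0" "\<kappa> x e = 0" "\<kappa> f x = 0" "\<kappa> x f = 0"
    "\<kappa> f e = \<kappa> e f"
  using gr_orth[OF e_gr e_gr] gr_orth[OF f_gr f_gr] gr_orth[OF e_gr x_gr] gr_orth[OF f_gr x_gr]
  by (simp_all add: form_sym[of x] form_sym[of f e])

lemma to_perp: "to_perp a \<in> perp"
  using form_e_f_nz form_x_x_nz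
  by (simp add: to_perp_def perp_def form_diff form_scale form_triple)

lemma to_perp_add: "to_perp (a + b) = to_perp a + to_perp b"
  by (simp add: to_perp_def form_add scale_left_distrib add_divide_distrib algebra_simps)

lemma to_perp_scale: "to_perp (scale r a) = scale r (to_perp a)"
  by (simp add: to_perp_def form_scale scale_right_diff_distrib)

lemma pr_add: "pr_0 (a + b) = pr_0 a + pr_0 b" "pr_p (a + b) = pr_p a + pr_p b" "pr_m (a + b) = pr_m a + pr_m b"
  by (simp_all add: pr_0_def pr_p_def pr_m_def to_perp_add lb_add_right scale_right_distrib algebra_simps)

lemma pr_scale: "pr_0 (scale r a) = scale r (pr_0 a)" "pr_p (scale r a) = scale r (pr_p a)"
    "pr_m (scale r a) = scale r (pr_m a)"
  by (simp_all add: pr_0_def pr_p_def pr_m_def to_perp_scale lb_scale_right scale_right_distrib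
      scale_right_diff_distrib mult.commute)

lemma decomposition: "a = scale (\<kappa> f a / \<kappa> e f) e + scale (\<kappa> e a / \<kappa> e f) f + scale (\<kappa> x a / \<kappa> x x) x
    + pr_0 a + pr_p a + pr_m a"
proof -
  have "scale 4 c = scale 2 c + scale 2 c" for c
    using scale_left_distrib[of 2 2 c] by simp
  then have "pr_0 a + pr_p a + pr_m a = to_perp a"
    by (simp add: pr_0_def pr_p_def pr_m_def)
  then show ?thesis by (simp add: to_perp_def algebra_simps)
qed

lemma pr_perp: "pr_0 a \<in> perp" "pr_p a \<in> perp" "pr_m a \<in> perp"
  by (simp_all add: pr_0_def pr_p_def pr_m_def to_perp perp_add perp_diff perp_scale perp_x)

lemma pr_gr: "pr_0 a \<in> gr 0" "pr_p a \<in> gr (1/2)" "pr_m a \<in> gr (-(1/2))"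
proof -
  let ?q = "to_perp a"
  let ?X = "lb x"
  have c: "scale 4 (?X (?X (?X ?q))) = ?X ?q"
    using perp_cubic[OF to_perp] by (simp add: lb_scale_right)
  have "scale (1/2) (scale 4 (?X (?X (?X ?q)))) = scale (1/2) (?X ?q)" by (simp only: c)
  then have c2: "scale 2 (?X (?X (?X ?q))) = scale (1/2) (?X ?q)" by simp
  show "pr_0 a \<in> gr 0"
    by (simp add: in_gr pr_0_def lb_diff lb_scale_right c)
  show "pr_p a \<in> gr (1/2)"
    by (simp add: in_gr pr_p_def lb_add_right lb_scale_right c2 of_rat_divide scale_right_distrib)
  show "pr_m a \<in> gr (-(1/2))"
    by (simp add: in_gr pr_m_def lb_diff lb_scale_right c2 of_rat_divide of_rat_minus scale_right_diff_distrib)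
qed

text \<open>In degree 0 the left side of \<open>perp_f_x\<close> vanishes.\<close>

lemma perp_gr_0: "a \<in> perp \<Longrightarrow> a \<in> gr 0 \<Longrightarrow> lb f a = 0"
  using perp_f_x[of a] by (simp add: in_gr)

lemma perp_gr_nz:
  assumes "a \<in> perp" "a \<in> gr i" "a \<noteq> 0"
  shows "i = 0 \<or> i = 1/2 \<or> i = -(1/2)"
proof -
  have "scale (of_rat (4 * i * i * i)) a = scale (of_rat i) a"
    using perp_cubic[OF assms(1)] assms(2)
    by (simp add: in_gr lb_scale_right of_rat_mult mult_ac)
  then have "of_rat (4 * i * i * i) = (of_rat i :: 'k)" using assms(3) by simp
  then have "4 * i * i * i = i" by simp
  then have "i * ((2 * i - 1) * (2 * i + 1)) = 0" by (simp add: algebra_simps)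
  then show ?thesis by auto
qed

lemma gr_perp: "a \<in> gr i \<Longrightarrow> i \<noteq> 0 \<Longrightarrow> i \<noteq> 1 \<Longrightarrow> i \<noteq> - 1 \<Longrightarrow> a \<in> perp"
  using gr_orth[OF e_gr, of a i] gr_orth[OF f_gr, of a i] gr_orth[OF x_gr, of a i]
  by (simp add: perp_def add_eq_0_iff)

lemma to_perp_id: "a \<in> perp \<Longrightarrow> to_perp a = a"
  by (simp add: to_perp_def perp_def)

lemma gr_1:
  assumes "a \<in> gr 1"
  shows "a = scale (\<kappa> f a / \<kappa> e f) e"
proof -
  have "to_perp a = a - scale (\<kappa> f a / \<kappa> e f) e"
    using gr_orth[OF e_gr assms] gr_orth[OF x_gr assms] by (simp add: to_perp_def)
  moreover have "a - scale (\<kappa> f a / \<kappa> e f) e \<in> gr 1"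
    by (intro gr_diff gr_scale assms e_gr)
  ultimately have "to_perp a \<in> gr 1" by simp
  then have "to_perp a = 0" using perp_gr_nz[OF to_perp] by fastforce
  with \<open>to_perp a = a - _\<close> show ?thesis by simp
qed

lemma gr_ge_half:
  assumes "a \<in> gr i" "i \<ge> 1/2"
  shows "i = 1/2 \<or> a = scale (\<kappa> f a / \<kappa> e f) e"
proof (cases "i = 1")
  case True
  then show ?thesis using gr_1 assms(1) by simp
next
  case False
  then have "a \<in> perp" using assms(2) by (intro gr_perp[OF assms(1)]) auto
  from perp_gr_nz[OF this assms(1)] have "a = 0 \<or> i = 1/2" using assms(2) by auto
  then show ?thesis by auto
qed

text \<open>If \<open>f\<close> kills \<open>a\<close>, then \<open>2 \<kappa> x a = \<kappa> (lb e
  f) a = \<kappa> e (lb f a) = 0\<close>; orthogonality to \<open>e\<close> and \<open>f\<close> is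
  automatic in degree 0. Thus the centralizer is the complement of \<open>x\<close> in degree
  0.\<close>

lemma centralizer_eq: "g0_centralizer scale lb x f = {a \<in> gr 0. a \<in> perp}"
proof (intro equalityI subsetI)
  fix a assume "a \<in> g0_centralizer scale lb x f"
  then have a: "a \<in> gr 0" "lb f a = 0" by (auto simp: g0_centralizer_def)
  have "2 * \<kappa> x a = \<kappa> (lb e f) a" by (simp add: lb_e_f form_add)
  also have "\<dots> = 0" by (simp add: form_inv a(2))
  finally show "a \<in> {a \<in> gr 0. a \<in> perp}"
    using a(1) gr_orth[OF e_gr a(1)] gr_orth[OF f_gr a(1)] by (simp add: perp_def)
qed (auto simp: g0_centralizer_def perp_gr_0)

section \<open>The subspaces cut out by degree\<close>

lemma half_ints: "0 \<in> half_ints" "1 \<in> half_ints" "-1 \<in> half_ints" "1/2 \<in> half_ints"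
  "-(1/2) \<in> half_ints"
  unfolding half_ints_def
  by (auto intro: image_eqI[of _ _ 0] image_eqI[of _ _ 2] image_eqI[of _ _ "-2"]
      image_eqI[of _ _ 1] image_eqI[of _ _ "-1"])

text \<open>Only the \<open>e\<close>-component has degree above 1/2, and \<open>\<kappa> f\<close>
  reads it off. The same observation makes the subspace of degree at least 1 the line of
  \<open>e\<close> and gives the projection its closed form.\<close>

lemma grade_le_half: "grade_le scale lb x (1/2) = {a. \<kappa> f a = 0}"
proof (intro equalityI subsetI)
  have "subspace {a. \<kappa> f a = 0}" by (rule subspaceI) (auto simp: form_add form_scale)
  moreover have "gr j \<subseteq> {a. \<kappa> f a = 0}" if "j \<le> 1/2" for j
    using gr_orth[OF f_gr, of _ j] that by auto
  ultimately have "grade_le scale lb x (1/2) \<subseteq> {a. \<kappa> f a = 0}"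
    unfolding grade_le_def by (intro span_minimal) auto
  then show "a \<in> {a. \<kappa> f a = 0}" if "a \<in> grade_le scale lb x (1/2)" for a using that by blast
next
  fix a assume "a \<in> {a. \<kappa> f a = 0}"
  then have a: "a = scale (\<kappa> e a / \<kappa> e f) f + scale (\<kappa> x a / \<kappa> x x) x + pr_0 a + pr_p a + pr_m a"
    using decomposition[of a] by simp
  have b: "b \<in> grade_le scale lb x (1/2)" if "b \<in> gr j" "j \<in> half_ints" "j \<le> 1/2" for b j
    unfolding grade_le_def using that by (intro span_base) auto
  have "scale (\<kappa> e a / \<kappa> e f) f \<in> grade_le scale lb x (1/2)"
    "scale (\<kappa> x a / \<kappa> x x) x \<in> grade_le scale lb x (1/2)"
    "pr_0 a \<in> grade_le scale lb x (1/2)" "pr_p a \<in> grade_le scale lb x (1/2)"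
    "pr_m a \<in> grade_le scale lb x (1/2)"
    by (rule b, rule gr_scale[OF f_gr] gr_scale[OF x_gr] pr_gr, simp_all add: half_ints)+
  then show "a \<in> grade_le scale lb x (1/2)"
    by (subst a) (simp only: grade_le_def span_add)
qed

lemma grade_ge_1: "grade_ge scale lb x 1 = {a. a = scale (\<kappa> f a / \<kappa> e f) e}"
proof (intro equalityI subsetI)
  have "subspace {a. a = scale (\<kappa> f a / \<kappa> e f) e}"
  proof (rule subspaceI)
    show "a + b \<in> {a. a = scale (\<kappa> f a / \<kappa> e f) e}"
      if "a \<in> {a. a = scale (\<kappa> f a / \<kappa> e f) e}" "b \<in> {a. a = scale (\<kappa> f a / \<kappa> e f) e}" for a b
    proof -
      have "a + b = scale (\<kappa> f a / \<kappa> e f) e + scale (\<kappa> f b / \<kappa> e f) e"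
        using that by simp
      then show ?thesis unfolding mem_Collect_eq form_add add_divide_distrib scale_left_distrib .
    qed
    show "scale r a \<in> {a. a = scale (\<kappa> f a / \<kappa> e f) e}" if "a \<in> {a. a = scale (\<kappa> f a / \<kappa> e f) e}" for r a
    proof -
      have "scale r a = scale (r * \<kappa> f a / \<kappa> e f) e"
        using arg_cong[where f = "scale r", OF that[unfolded mem_Collect_eq]]
        by (simp only: scale_scale times_divide_eq_right)
      then show ?thesis unfolding mem_Collect_eq form_scale .
    qed
  qed simp
  moreover have "gr j \<subseteq> {a. a = scale (\<kappa> f a / \<kappa> e f) e}" if "1 \<le> j" for j
    using gr_ge_half[of _ j] that by auto
  ultimately have "grade_ge scale lb x 1 \<subseteq> {a. a = scale (\<kappa> f a / \<kappa> e f) e}"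
    unfolding grade_ge_def by (intro span_minimal) auto
  then show "a \<in> {a. a = scale (\<kappa> f a / \<kappa> e f) e}" if "a \<in> grade_ge scale lb x 1" for a using that by blast
next
  fix a assume "a \<in> {a. a = scale (\<kappa> f a / \<kappa> e f) e}"
  then have "a \<in> gr 1" using gr_scale[OF e_gr, of "\<kappa> f a / \<kappa> e f"] by simp
  then show "a \<in> grade_ge scale lb x 1"
    unfolding grade_ge_def using half_ints(2) by (intro span_base) auto
qed

lemma gr_half_ge: "a \<in> gr (1/2) \<Longrightarrow> a \<in> grade_ge scale lb x (1/2)"
  unfolding grade_ge_def using half_ints(4) by (intro span_base) auto

lemma e_ge: "e \<in> grade_ge scale lb x (1/2)"
  unfolding grade_ge_def using half_ints(2) e_gr by (intro span_base) auto

lemma grade_ge_half: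
  assumes "a \<in> grade_ge scale lb x (1/2)"
  shows "\<exists>w t. w \<in> gr (1/2) \<and> a = w + scale t e"
proof -
  have "subspace {w + scale t e | w t. w \<in> gr (1/2)}"
  proof (rule subspaceI)
    show "0 \<in> {w + scale t e | w t. w \<in> gr (1/2)}"
      by (rule CollectI, rule exI[of _ 0], rule exI[of _ 0]) simp
    show "a + b \<in> {w + scale t e | w t. w \<in> gr (1/2)}"
      if "a \<in> {w + scale t e | w t. w \<in> gr (1/2)}" "b \<in> {w + scale t e | w t. w \<in> gr (1/2)}" for a b
    proof -
      obtain w t w' t' where "a = w + scale t e" "w \<in> gr (1/2)" "b = w' + scale t' e" "w' \<in> gr (1/2)"
        using \<open>a \<in> _\<close> \<open>b \<in> _\<close> by auto
      then have "a + b = (w + w') + scale (t + t') e" "w + w' \<in> gr (1/2)"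
        by (simp_all add: scale_left_distrib gr_add)
      then show ?thesis by blast
    qed
    show "scale r a \<in> {w + scale t e | w t. w \<in> gr (1/2)}"
      if a: "a \<in> {w + scale t e | w t. w \<in> gr (1/2)}" for r a
    proof -
      obtain w t where "a = w + scale t e" "w \<in> gr (1/2)"
        using a unfolding mem_Collect_eq by blast
      then have "scale r a = scale r w + scale (r * t) e" "scale r w \<in> gr (1/2)"
        by (simp_all add: scale_right_distrib gr_scale)
      then show ?thesis by blast
    qed
  qed
  moreover have "gr j \<subseteq> {w + scale t e | w t. w \<in> gr (1/2)}" if "1/2 \<le> j" for j
  proof
    fix a assume a: "a \<in> gr j"
    from gr_ge_half[OF this that] show "a \<in> {w + scale t e | w t. w \<in> gr (1/2)}"
    proof
      assume "j = 1/2"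
      then have "a = a + scale 0 e" "a \<in> gr (1/2)" using a by (simp, simp only:)
      then show ?thesis by blast
    next
      assume "a = scale (\<kappa> f a / \<kappa> e f) e"
      then have "a = 0 + scale (\<kappa> f a / \<kappa> e f) e" by simp
      then show ?thesis using gr_0 by blast
    qed
  qed
  ultimately have "grade_ge scale lb x (1/2) \<subseteq> {w + scale t e | w t. w \<in> gr (1/2)}"
    unfolding grade_ge_def by (intro span_minimal) auto
  with assms show ?thesis by blast
qed

lemma proj_le_half_eq: "proj_le_half scale lb x a = a - scale (\<kappa> f a / \<kappa> e f) e"
  unfolding proj_le_half_def grade_le_half grade_ge_1
proof (rule the_equality)
  have "\<kappa> f (a - scale (\<kappa> f a / \<kappa> e f) e) = 0"
    using form_e_f_nz by (simp add: form_diff form_scale form_triple)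
  then show "a - scale (\<kappa> f a / \<kappa> e f) e \<in> {a. \<kappa> f a = 0} \<and>
      a - (a - scale (\<kappa> f a / \<kappa> e f) e) \<in> {a. a = scale (\<kappa> f a / \<kappa> e f) e}"
    using form_e_f_nz by (simp add: form_scale form_triple)
next
  fix b assume "b \<in> {a. \<kappa> f a = 0} \<and> a - b \<in> {a. a = scale (\<kappa> f a / \<kappa> e f) e}"
  then have b: "\<kappa> f b = 0" "a - b = scale (\<kappa> f (a - b) / \<kappa> e f) e" by auto
  have "\<kappa> f (a - b) = \<kappa> f a" by (simp add: form_diff b(1))
  with b(2) have "a - b = scale (\<kappa> f a / \<kappa> e f) e" by simp
  then show "b = a - scale (\<kappa> f a / \<kappa> e f) e" by (simp add: algebra_simps)
qed

text \<open>Degree 3/2 does not occur.\<close>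

lemma lb_e_half: "w \<in> gr (1/2) \<Longrightarrow> lb e w = 0"
proof (rule ccontr)
  assume w: "w \<in> gr (1/2)" and nz: "lb e w \<noteq> 0"
  have "lb e w \<in> gr (3/2)" by (rule gr_lb'[OF e_gr w]) simp
  then show False using perp_gr_nz[OF gr_perp[OF \<open>lb e w \<in> gr (3/2)\<close>]] nz by fastforce
qed

end

section \<open>The operators defining the W-algebra\<close>

lemma dconst_minus: "dconst (- c) = - dconst (c :: 'k::comm_ring_1)"
  using dconst_add[of c "- c"] by (simp add: eq_neg_iff_add_eq_0 add.commute)

lemma dconst_half: "dconst (1/2 :: 'k::field_char_0) * (p + p) = p"
proof -
  have "dconst (1/2 :: 'k) * (p + p) = (dconst (1/2) + dconst (1/2)) * p"
    by (simp add: algebra_simps)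
  also have "dconst (1/2 :: 'k) + dconst (1/2) = 1"
    by (simp flip: dconst_add)
  finally show ?thesis by simp
qed

lemma dconst_third: "dconst (1/3 :: 'k::field_char_0) * (p + p + p) = p"
proof -
  have "dconst (1/3 :: 'k) * (p + p + p) = (dconst (1/3) + dconst (1/3) + dconst (1/3)) * p"
    by (simp add: algebra_simps)
  also have "dconst (1/3 :: 'k) + dconst (1/3) + dconst (1/3) = 1"
    by (simp flip: dconst_add)
  finally show ?thesis by simp
qed

lemma sum_const_poly: "(\<Sum>i\<in>A. [:F i:]) = [:\<Sum>i\<in>A. F i:]"
  by (induction A rule: infinite_finite_induct) auto

text \<open>The products \<open>y h * y k\<close> commute, so only the symmetric part of
  \<open>C\<close> contributes.\<close>

lemma antisymmetric_sum:
  fixes y :: "'q \<Rightarrow> ('i, 'k::field_char_0) dpoly"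
  assumes "\<And>h k. h \<in> J \<Longrightarrow> k \<in> J \<Longrightarrow> C h k + C k h = 0"
  shows "(\<Sum>h\<in>J. \<Sum>k\<in>J. dconst (C h k) * y h * y k) = 0"
proof -
  let ?s = "\<Sum>h\<in>J. \<Sum>k\<in>J. dconst (C h k) * y h * y k"
  have "?s + ?s = ?s + (\<Sum>h\<in>J. \<Sum>k\<in>J. dconst (C k h) * y k * y h)"
    using sum.swap[of "\<lambda>h k. dconst (C h k) * y h * y k" J J] by simp
  also have "\<dots> = (\<Sum>h\<in>J. \<Sum>k\<in>J. dconst (C h k + C k h) * y h * y k)"
    by (simp add: dconst_add sum.distrib algebra_simps)
  also have "\<dots> = 0" by (simp add: assms)
  finally have "dconst (1/2) * (?s + ?s) = 0" by simp
  then show ?thesis by (simp only: dconst_half)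
qed

lemma map_poly_diff_hom:
  "map_poly (diff_hom G) (P + Q) = map_poly (diff_hom G) P + map_poly (diff_hom G) Q"
  "map_poly (diff_hom G) (smult p P) = smult (diff_hom G p) (map_poly (diff_hom G) P)"
  "map_poly (diff_hom G) (lamD P) = lamD (map_poly (diff_hom G) P)"
  by (rule poly_eqI; simp add: coeff_map_poly diff_hom_add diff_hom_mult coeff_lamD diff_hom_dD split: nat.split)+

text \<open>\<open>c\<close> and \<open>c'\<close> are the dual bases written with \<open>a\<close>
  and lower or upper index in the theorem; the letter \<open>a\<close> is kept for elements of the
  Lie algebra.\<close>

locale minimal_W = minimal_grading scale lb \<kappa> e x f
  for scale :: "'k::field_char_0 \<Rightarrow> 'g::ab_group_add \<Rightarrow> 'g" and lb \<kappa> e x f +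
  fixes bas :: "'i::finite \<Rightarrow> 'g"
    and c c' :: "'p \<Rightarrow> 'g" and J0 :: "'p set"
    and v v' :: "'q \<Rightarrow> 'g" and J :: "'q set"
    and z :: 'k
    and br :: "('i, 'k) dpoly \<Rightarrow> ('i, 'k) dpoly \<Rightarrow> ('i, 'k) dpoly poly"
  assumes bas: "is_basis scale UNIV bas UNIV"
    and basis_c: "is_basis scale J0 c (grade scale lb x 0)"
    and basis_c': "is_basis scale J0 c' (grade scale lb x 0)"
    and dual_c: "\<And>i j. i \<in> J0 \<Longrightarrow> j \<in> J0 \<Longrightarrow> \<kappa> (c i) (c' j) = (if i = j then 1 else 0)"
    and basis_v: "is_basis scale J v (grade scale lb x (1/2))"
    and basis_v': "is_basis scale J v' (grade scale lb x (1/2))"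
    and dual_v: "\<And>h k. h \<in> J \<Longrightarrow> k \<in> J \<Longrightarrow> \<kappa> f (lb (v h) (v' k)) = (if h = k then 1 else 0)"
    and bracket: "is_lambda_bracket scale lb \<kappa> bas e z br"
begin

abbreviation \<iota> where "\<iota> \<equiv> emb scale bas"
abbreviation \<rho> where "\<rho> \<equiv> rho scale lb \<kappa> bas x f"
abbreviation V where "V \<equiv> V_le_half scale lb bas x"
abbreviation \<omega> where "\<omega> s t \<equiv> \<kappa> f (lb s t)"

lemma \<iota>_add: "\<iota> (a + b) = \<iota> a + \<iota> b" and \<iota>_scale: "\<iota> (scale r a) = dconst r * \<iota> a"
  and \<iota>_sum: "\<iota> (\<Sum>i\<in>A. F i) = (\<Sum>i\<in>A. \<iota> (F i))"
  by (rule emb_linear[OF vector_space_axioms bas] emb_sum[OF vector_space_axioms bas])+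

lemma \<iota>_0 [simp]: "\<iota> 0 = 0"
  using \<iota>_add[of 0 0] by simp

lemma \<iota>_minus: "\<iota> (- a) = - \<iota> a"
  using \<iota>_add[of a "- a"] by (simp add: eq_neg_iff_add_eq_0 add.commute)

lemma \<iota>_diff: "\<iota> (a - b) = \<iota> a - \<iota> b"
  using \<iota>_add[of a "- b"] by (simp add: \<iota>_minus)

section \<open>Dual bases and contractions\<close>

lemma finite_basis: "is_basis scale I b U \<Longrightarrow> finite I"
proof -
  assume I: "is_basis scale I b U"
  have "span (range bas) = UNIV" "independent (b ` I)"
    using bas I unfolding is_basis_def by blast+
  then have "finite (b ` I)" using independent_span_bound[of "range bas" "b ` I"] by simp
  then show ?thesis using I unfolding is_basis_def by (blast dest: finite_imageD)
qed

lemma basis_expansion: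
  assumes I: "is_basis scale I b U" and a: "a \<in> U"
  shows "\<exists>r. a = (\<Sum>i\<in>I. scale (r i) (b i))"
proof -
  have b: "inj_on b I" "span (b ` I) = U" using I unfolding is_basis_def by blast+
  have "a \<in> range (\<lambda>u. \<Sum>y\<in>b ` I. scale (u y) y)"
    using a span_finite[of "b ` I"] finite_basis[OF I] b(2) by simp
  then obtain u where "a = (\<Sum>y\<in>b ` I. scale (u y) y)" by blast
  then have "a = (\<Sum>i\<in>I. scale (u (b i)) (b i))" by (simp add: sum.reindex[OF b(1)])
  then show ?thesis by (rule exI[where x = "\<lambda>i. u (b i)"])
qed

lemma finite_J: "finite J" and finite_J0: "finite J0"
  by (rule finite_basis[OF basis_v] finite_basis[OF basis_c])+

lemma basis_in: "is_basis scale I b U \<Longrightarrow> i \<in> I \<Longrightarrow> b i \<in> U"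
  unfolding is_basis_def using span_base[of "b i" "b ` I"] by blast

lemma v_gr: "k \<in> J \<Longrightarrow> v k \<in> gr (1/2)" "k \<in> J \<Longrightarrow> v' k \<in> gr (1/2)"
  by (rule basis_in[OF basis_v] basis_in[OF basis_v'], assumption)+

lemma c_gr: "j \<in> J0 \<Longrightarrow> c j \<in> gr 0" "j \<in> J0 \<Longrightarrow> c' j \<in> gr 0"
  by (rule basis_in[OF basis_c] basis_in[OF basis_c'], assumption)+

lemma \<omega>_anti: "\<omega> s t = - \<omega> t s"
  by (subst lb_anti) (simp add: form_minus)

text \<open>The pairing \<open>\<omega>\<close> is skew, so the order of its arguments matters: it
  fixes the signs in every contraction below.\<close>

lemma v_expand:
  assumes "w \<in> gr (1/2)"
  shows "(\<Sum>k\<in>J. scale (\<omega> w (v' k)) (v k)) = w" and "(\<Sum>k\<in>J. scale (\<omega> (v k) w) (v' k)) = w"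
proof -
  obtain r where r: "w = (\<Sum>k\<in>J. scale (r k) (v k))" using basis_expansion[OF basis_v assms] by (elim exE)
  have "\<omega> w (v' h) = r h" if "h \<in> J" for h
    by (simp add: r lb_sum form_sum lb_scale_left form_scale dual_v that finite_J if_distrib cong: if_cong)
  then show "(\<Sum>k\<in>J. scale (\<omega> w (v' k)) (v k)) = w" by (subst r) (intro sum.cong, auto)
  obtain s where s: "w = (\<Sum>k\<in>J. scale (s k) (v' k))" using basis_expansion[OF basis_v' assms] by (elim exE)
  have "\<omega> (v h) w = s h" if "h \<in> J" for h
    by (simp add: s lb_sum form_sum lb_scale_right form_scale dual_v that finite_J if_distrib cong: if_cong)
  then show "(\<Sum>k\<in>J. scale (\<omega> (v k) w) (v' k)) = w" by (subst s) (intro sum.cong, auto)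
qed

lemma c_expand:
  assumes "y \<in> gr 0"
  shows "(\<Sum>j\<in>J0. scale (\<kappa> y (c' j)) (c j)) = y" and "(\<Sum>j\<in>J0. scale (\<kappa> y (c j)) (c' j)) = y"
proof -
  obtain r where r: "y = (\<Sum>k\<in>J0. scale (r k) (c k))" using basis_expansion[OF basis_c assms] by (elim exE)
  have "\<kappa> y (c' h) = r h" if "h \<in> J0" for h
    by (simp add: r form_sum form_scale dual_c that finite_J0 if_distrib cong: if_cong)
  then show "(\<Sum>j\<in>J0. scale (\<kappa> y (c' j)) (c j)) = y" by (subst r) (intro sum.cong, auto)
  obtain s where s: "y = (\<Sum>k\<in>J0. scale (s k) (c' k))" using basis_expansion[OF basis_c' assms] by (elim exE)
  have "\<kappa> y (c h) = s h" if "h \<in> J0" for h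
    by (simp add: s form_sum form_scale form_sym[of _ "c h"] dual_c that finite_J0 if_distrib cong: if_cong)
  then show "(\<Sum>j\<in>J0. scale (\<kappa> y (c j)) (c' j)) = y" by (subst s) (intro sum.cong, auto)
qed

text \<open>\<open>\<omega> w (v' k)\<close> is the value of \<open>Dop w\<close> on
  \<open>v' k\<close>. Contracting it against an expression linear in \<open>v k\<close> replaces
  \<open>v k\<close> by \<open>w\<close>; this is how the sums in the generators collapse.\<close>

lemma v_sum:
  assumes "w \<in> gr (1/2)" "\<And>a b. T (a + b) = T a + T b" "\<And>r a. T (scale r a) = scale r (T a)"
  shows "(\<Sum>k\<in>J. dconst (\<omega> w (v' k)) * \<iota> (T (v k))) = \<iota> (T w)"
proof -
  have T0: "T 0 = 0" using assms(3)[of 0 0] by simp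
  have "T (\<Sum>k\<in>A. F k) = (\<Sum>k\<in>A. T (F k))" for A and F :: "'q \<Rightarrow> 'g"
    by (induction A rule: infinite_finite_induct) (simp_all add: T0 assms(2))
  then have "T w = (\<Sum>k\<in>J. scale (\<omega> w (v' k)) (T (v k)))"
    by (subst v_expand(1)[OF assms(1), symmetric]) (simp add: assms(3))
  then show ?thesis by (simp add: \<iota>_sum \<iota>_scale)
qed

lemma v'_sum: "w \<in> gr (1/2) \<Longrightarrow> (\<Sum>k\<in>J. dconst (\<omega> (v k) w) * \<iota> (v' k)) = \<iota> w"
  using arg_cong[OF v_expand(2), of w \<iota>] by (simp add: \<iota>_sum \<iota>_scale)

lemma c_sum: "y \<in> gr 0 \<Longrightarrow> (\<Sum>j\<in>J0. dconst (\<kappa> y (c' j)) * \<iota> (c j)) = \<iota> y"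
  "y \<in> gr 0 \<Longrightarrow> (\<Sum>j\<in>J0. dconst (\<kappa> y (c j)) * \<iota> (c' j)) = \<iota> y"
  using arg_cong[OF c_expand(1), of y \<iota>] arg_cong[OF c_expand(2), of y \<iota>] by (simp_all add: \<iota>_sum \<iota>_scale)

section \<open>The bracket and the projection rho\<close>

lemma br_simps:
  "br (g1 + g2) h = br g1 h + br g2 h" "br g (h1 + h2) = br g h1 + br g h2"
  "br (dconst r * g) h = smult (dconst r) (br g h)" "br g (dconst r * h) = smult (dconst r) (br g h)"
  "br g (dD h) = lamD (br g h)" "br g (h1 * h2) = smult h2 (br g h1) + smult h1 (br g h2)"
  "br (\<iota> a) (\<iota> b) = [: \<iota> (lb a b) + dconst (z * \<kappa> e (lb a b)), dconst (\<kappa> a b) :]"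
proof -
  note b = bracket[unfolded is_lambda_bracket_def dscale_def]
  note b1 = b[THEN conjunct2] note b2 = b1[THEN conjunct2] note b3 = b2[THEN conjunct2]
  note b5 = b3[THEN conjunct2, THEN conjunct2] note b6 = b5[THEN conjunct2]
  show "br (g1 + g2) h = br g1 h + br g2 h" by (rule b[THEN conjunct1, rule_format])
  show "br g (h1 + h2) = br g h1 + br g h2" by (rule b1[THEN conjunct1, rule_format])
  show "br (dconst r * g) h = smult (dconst r) (br g h)" by (rule b2[THEN conjunct1, rule_format])
  show "br g (dconst r * h) = smult (dconst r) (br g h)" by (rule b3[THEN conjunct1, rule_format])
  show "br g (dD h) = lamD (br g h)" by (rule b5[THEN conjunct1, rule_format])
  show "br g (h1 * h2) = smult h2 (br g h1) + smult h1 (br g h2)" by (rule b6[THEN conjunct1, rule_format])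
  show "br (\<iota> a) (\<iota> b) = [: \<iota> (lb a b) + dconst (z * \<kappa> e (lb a b)), dconst (\<kappa> a b) :]"
    by (rule b6[THEN conjunct2, THEN conjunct2, rule_format])
qed

lemma \<rho>_hom: "\<rho> (p + q) = \<rho> p + \<rho> q" "\<rho> (p * q) = \<rho> p * \<rho> q" "\<rho> (dconst r) = dconst r" "\<rho> 0 = 0"
    "\<rho> (dD p) = dD (\<rho> p)"
  unfolding rho_def by (simp_all add: diff_hom_add diff_hom_mult diff_hom_dD)

lemma diff_hom_\<iota>:
  assumes add: "\<And>a b. R (a + b) = R a + R b" and sc: "\<And>r a. R (scale r a) = dconst r * R a"
  shows "diff_hom (\<lambda>i. R (bas i)) (\<iota> y) = R y"
proof -
  have "R 0 = 0" using sc[of 0 0] by simp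
  then have sum: "R (\<Sum>i\<in>A. F i) = (\<Sum>i\<in>A. R (F i))" for A and F :: "'i \<Rightarrow> 'g"
    by (induction A rule: infinite_finite_induct) (simp_all add: add)
  have "diff_hom (\<lambda>i. R (bas i)) (\<iota> y) = (\<Sum>i\<in>UNIV. dconst (representation (range bas) y (bas i)) * R (bas i))"
    unfolding emb_def[of scale bas y] diff_hom_sum diff_hom_mult by simp
  also have "\<dots> = R (\<Sum>i\<in>UNIV. scale (representation (range bas) y (bas i)) (bas i))"
    by (simp add: sum sc)
  also have "\<dots> = R y" by (simp only: crd_sum[OF vector_space_axioms bas])
  finally show ?thesis .
qed

lemma \<rho>_\<iota>: "\<rho> (\<iota> y) = \<iota> (y - scale (\<kappa> f y / \<kappa> e f) e) + dconst (\<kappa> f y)"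
proof -
  define R where "R y = \<iota> (y - scale (\<kappa> f y / \<kappa> e f) e) + dconst (\<kappa> f y)" for y
  have add: "R (a + b) = R a + R b" for a b
    by (simp add: R_def form_add add_divide_distrib scale_left_distrib \<iota>_add \<iota>_diff dconst_add algebra_simps)
  have sc: "R (scale r a) = dconst r * R a" for r a
    by (simp add: R_def form_scale \<iota>_diff \<iota>_scale dconst_mult algebra_simps flip: times_divide_eq_right)
  have "\<rho> (\<iota> y) = diff_hom (\<lambda>i. R (bas i)) (\<iota> y)"
    by (simp add: rho_def R_def proj_le_half_eq)
  also have "\<dots> = R y" by (rule diff_hom_\<iota>[OF add sc])
  finally show ?thesis by (simp add: R_def)
qed

lemma V_eq: "V = diff_alg (\<iota> ` {a. \<kappa> f a = 0})"
  by (simp add: V_le_half_def grade_le_half)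

lemma \<rho>_V: "g \<in> V \<Longrightarrow> \<rho> g = g"
  unfolding V_eq by (induction rule: diff_alg.induct) (auto simp: \<rho>_hom \<rho>_\<iota>)

lemma \<iota>_V: "\<kappa> f a = 0 \<Longrightarrow> \<iota> a \<in> V"
  unfolding V_eq by (rule diff_alg.gen) simp

lemma gr_V: "a \<in> gr i \<Longrightarrow> i \<noteq> 1 \<Longrightarrow> \<iota> a \<in> V"
  by (intro \<iota>_V gr_orth[OF f_gr]) auto

lemma V_closed: "p \<in> V \<Longrightarrow> q \<in> V \<Longrightarrow> p + q \<in> V" "p \<in> V \<Longrightarrow> q \<in> V \<Longrightarrow> p * q \<in> V"
    "dconst r \<in> V" "p \<in> V \<Longrightarrow> dD p \<in> V" "p \<in> V \<Longrightarrow> dscale r p \<in> V"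
    "(\<And>i. i \<in> A \<Longrightarrow> F i \<in> V) \<Longrightarrow> (\<Sum>i\<in>A. F i) \<in> V"
  unfolding V_eq by (auto intro: diff_alg.intros diff_alg_dscale diff_alg_sum)

section \<open>The operators obtained from the bracket\<close>

definition Dop :: "'g \<Rightarrow> ('i, 'k) dpoly \<Rightarrow> ('i, 'k) dpoly poly" where
  "Dop a g = map_poly \<rho> (br (\<iota> a) g)"

lemma map_\<rho>: "map_poly \<rho> (P + Q) = map_poly \<rho> P + map_poly \<rho> Q"
  "map_poly \<rho> (smult p P) = smult (\<rho> p) (map_poly \<rho> P)" "map_poly \<rho> (lamD P) = lamD (map_poly \<rho> P)"
  unfolding rho_def by (rule map_poly_diff_hom)+

lemma Dop_add: "Dop a (g + h) = Dop a g + Dop a h"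
  by (simp add: Dop_def br_simps map_\<rho>)

text \<open>The bracket obeys the Leibniz rule, but \<open>\<rho>\<close> would alter the factors;
  on V it fixes them, whence the restriction.\<close>

lemma Dop_mult: "g \<in> V \<Longrightarrow> h \<in> V \<Longrightarrow> Dop a (g * h) = smult h (Dop a g) + smult g (Dop a h)"
  by (simp add: Dop_def br_simps map_\<rho> \<rho>_V)

lemma Dop_dD: "Dop a (dD g) = lamD (Dop a g)"
  by (simp add: Dop_def br_simps map_\<rho>)

lemma Dop_dD_pow: "Dop a ((dD ^^ n) g) = (lamD ^^ n) (Dop a g)"
  by (induction n) (simp_all add: Dop_dD)

lemma Dop_const [simp]: "Dop a (dconst r) = 0"
proof -
  have "br (\<iota> a) (1 * 1) = br (\<iota> a) 1 + br (\<iota> a) 1" by (subst br_simps) simp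
  then have "br (\<iota> a) 1 = 0" by simp
  then have "br (\<iota> a) (dconst r * 1) = 0" by (simp only: br_simps(4) smult_0_right)
  then show ?thesis by (simp add: Dop_def)
qed

lemma Dop_dscale: "Dop a (dscale r g) = smult (dconst r) (Dop a g)"
  by (simp add: Dop_def dscale_def br_simps(4) map_\<rho> \<rho>_hom)

lemma Dop_sum: "Dop a (\<Sum>i\<in>A. F i) = (\<Sum>i\<in>A. Dop a (F i))"
  by (induction A rule: infinite_finite_induct) (use Dop_const[of a 0] in \<open>auto simp: Dop_add\<close>)

lemma Dop_left: "Dop (a + b) g = Dop a g + Dop b g" "Dop (scale r a) g = smult (dconst r) (Dop a g)"
  by (simp_all add: Dop_def \<iota>_add \<iota>_scale br_simps map_\<rho> \<rho>_hom)

text \<open>Invariance rewrites the factor of \<open>z\<close> as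
  \<open>\<kappa> e (lb a b) = \<kappa> (lb e a) b = 0\<close>. This is why the W-algebra does not
  depend on \<open>z\<close>.\<close>

lemma Dop_\<iota>:
  assumes "lb e a = 0"
  shows "Dop a (\<iota> b) = [: \<iota> (lb a b - scale (\<omega> a b / \<kappa> e f) e) + dconst (\<omega> a b), dconst (\<kappa> a b) :]"
proof -
  have "\<kappa> e (lb a b) = 0" using form_inv[of e a b] assms by simp
  then show ?thesis by (simp add: Dop_def br_simps map_poly_pCons \<rho>_hom \<rho>_\<iota>)
qed

lemma lb_half_half: "s \<in> gr (1/2) \<Longrightarrow> t \<in> gr (1/2) \<Longrightarrow> lb s t = scale (\<omega> s t / \<kappa> e f) e"
  by (rule gr_1) (rule gr_lb', auto)

text \<open>Degrees decide which terms of \<open>Dop_\<iota>\<close> survive. For \<open>b\<close>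
  of degree 1/2 the bracket \<open>lb w b\<close> is a multiple of \<open>e\<close>, which
  \<open>\<rho>\<close> turns into the constant \<open>\<omega> w b\<close>.\<close>

lemma Dop_half:
  assumes w: "w \<in> gr (1/2)"
  shows "b \<in> gr (1/2) \<Longrightarrow> Dop w (\<iota> b) = [:dconst (\<omega> w b):]"
    and "b \<in> gr 0 \<Longrightarrow> Dop w (\<iota> b) = [:\<iota> (lb w b):]"
    and "b \<in> gr (-(1/2)) \<Longrightarrow> Dop w (\<iota> b) = [:\<iota> (lb w b), dconst (\<kappa> w b):]"
    and "Dop w (\<iota> f) = [:\<iota> (lb w f):]"
proof -
  note D = Dop_\<iota>[OF lb_e_half[OF w]]
  show "Dop w (\<iota> b) = [:dconst (\<omega> w b):]" if "b \<in> gr (1/2)"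
    using lb_half_half[OF w that] gr_orth[OF w that] by (simp add: D)
  show "Dop w (\<iota> b) = [:\<iota> (lb w b):]" if "b \<in> gr 0"
    using gr_orth[OF f_gr gr_lb[OF w that]] gr_orth[OF w that] by (simp add: D)
  show "Dop w (\<iota> b) = [:\<iota> (lb w b), dconst (\<kappa> w b):]" if "b \<in> gr (-(1/2))"
    using gr_orth[OF f_gr gr_lb[OF w that]] by (simp add: D)
  show "Dop w (\<iota> f) = [:\<iota> (lb w f):]"
    using gr_orth[OF f_gr gr_lb[OF w f_gr]] gr_orth[OF w f_gr] by (simp add: D)
qed

lemma form_f_e: "\<kappa> f (lb e b) = - 2 * \<kappa> x b"
  by (simp add: form_inv[symmetric] lb_f_e form_diff form_minus)

text \<open>On degree 0 the bracket with \<open>e\<close> becomes a constant under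
  \<open>\<rho>\<close>. It vanishes on the centralizer of \<open>f\<close>, and on \<open>x\<close>
  it is \<open>-2 \<kappa> x x\<close>, the pivot for eliminating \<open>x\<close>.\<close>

lemma Dop_e:
  shows "b \<in> gr (1/2) \<Longrightarrow> Dop e (\<iota> b) = 0"
    and "b \<in> gr 0 \<Longrightarrow> Dop e (\<iota> b) = [:dconst (- 2 * \<kappa> x b):]"
    and "b \<in> gr (-(1/2)) \<Longrightarrow> Dop e (\<iota> b) = [:\<iota> (lb e b):]"
    and "Dop e (\<iota> f) = [:\<iota> x + \<iota> x, dconst (\<kappa> e f):]"
proof -
  note D = Dop_\<iota>[OF lb_self, unfolded form_f_e]
  show "Dop e (\<iota> b) = 0" if "b \<in> gr (1/2)"
    using lb_e_half[OF that] gr_orth[OF e_gr that] gr_orth[OF x_gr that] by (simp add: D)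
  show "Dop e (\<iota> b) = [:dconst (- 2 * \<kappa> x b):]" if b: "b \<in> gr 0"
  proof -
    have "lb e b \<in> gr 1" by (rule gr_lb'[OF e_gr b]) simp
    from gr_1[OF this] have "lb e b = scale (- 2 * \<kappa> x b / \<kappa> e f) e" by (simp only: form_f_e)
    then show ?thesis using gr_orth[OF e_gr b] by (simp add: D)
  qed
  show "Dop e (\<iota> b) = [:\<iota> (lb e b):]" if "b \<in> gr (-(1/2))"
    using gr_orth[OF e_gr that] gr_orth[OF x_gr that] by (simp add: D)
  show "Dop e (\<iota> f) = [:\<iota> x + \<iota> x, dconst (\<kappa> e f):]"
    by (simp add: D lb_e_f form_triple \<iota>_add)
qed

definition kill :: "('i, 'k) dpoly \<Rightarrow> bool" where
  "kill g \<longleftrightarrow> Dop e g = 0 \<and> (\<forall>w\<in>gr (1/2). Dop w g = 0)"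

lemma W_alg_eq: "W_alg scale lb \<kappa> bas x f br = {g \<in> V. kill g}"
proof -
  have "(\<forall>a\<in>grade_ge scale lb x (1/2). Dop a g = 0) \<longleftrightarrow> kill g" for g
  proof
    assume "\<forall>a\<in>grade_ge scale lb x (1/2). Dop a g = 0"
    then show "kill g" unfolding kill_def using gr_half_ge e_ge by blast
  next
    assume g: "kill g"
    show "\<forall>a\<in>grade_ge scale lb x (1/2). Dop a g = 0"
    proof
      fix a assume "a \<in> grade_ge scale lb x (1/2)"
      then obtain w t where "w \<in> gr (1/2)" "a = w + scale t e" using grade_ge_half by blast
      then show "Dop a g = 0" using g by (simp add: kill_def Dop_left)
    qed
  qed
  then show ?thesis unfolding W_alg_def Dop_def by simp
qed

end

section \<open>The generators lie in the W-algebra\<close>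

lemma dD_minus: "dD (- p) = - dD p"
  using dD_add[of p "- p"] by (simp add: eq_neg_iff_add_eq_0 add.commute)

context minimal_W
begin

abbreviation \<phi> where "\<phi> \<equiv> W_phi \<iota> lb J v v'"
abbreviation \<psi> where "\<psi> \<equiv> W_psi \<iota> lb e J v v'"
abbreviation L where "L \<equiv> W_L \<iota> lb x f J0 c c' J v v'"
abbreviation g0f where "g0f \<equiv> g0_centralizer scale lb x f"

lemma gr_V': "a \<in> gr 0 \<Longrightarrow> \<iota> a \<in> V" "a \<in> gr (1/2) \<Longrightarrow> \<iota> a \<in> V" "a \<in> gr (-(1/2)) \<Longrightarrow> \<iota> a \<in> V"
    "\<iota> f \<in> V"
  using gr_V[of _ 0] gr_V[of _ "1/2"] gr_V[of _ "-(1/2)"] gr_V[OF f_gr] by simp_all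

lemma lb_gr:
  "a \<in> gr 0 \<Longrightarrow> b \<in> gr (1/2) \<Longrightarrow> lb a b \<in> gr (1/2)"
  "a \<in> gr (1/2) \<Longrightarrow> b \<in> gr 0 \<Longrightarrow> lb a b \<in> gr (1/2)"
  "a \<in> gr (-(1/2)) \<Longrightarrow> b \<in> gr (1/2) \<Longrightarrow> lb a b \<in> gr 0"
  "a \<in> gr (1/2) \<Longrightarrow> b \<in> gr (-(1/2)) \<Longrightarrow> lb a b \<in> gr 0"
  "b \<in> gr (-(1/2)) \<Longrightarrow> lb e b \<in> gr (1/2)"
  "b \<in> gr (1/2) \<Longrightarrow> lb f b \<in> gr (-(1/2))"
proof -
  show "lb a b \<in> gr (1/2)" if "a \<in> gr 0" "b \<in> gr (1/2)" by (rule gr_lb'[OF that]) simp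
  show "lb a b \<in> gr (1/2)" if "a \<in> gr (1/2)" "b \<in> gr 0" by (rule gr_lb'[OF that]) simp
  show "lb a b \<in> gr 0" if "a \<in> gr (-(1/2))" "b \<in> gr (1/2)" by (rule gr_lb'[OF that]) simp
  show "lb a b \<in> gr 0" if "a \<in> gr (1/2)" "b \<in> gr (-(1/2))" by (rule gr_lb'[OF that]) simp
  show "lb e b \<in> gr (1/2)" if "b \<in> gr (-(1/2))" by (rule gr_lb'[OF e_gr that]) simp
  show "lb f b \<in> gr (-(1/2))" if "b \<in> gr (1/2)" by (rule gr_lb'[OF f_gr that]) simp
qed

lemma \<phi>_V: "a \<in> gr 0 \<Longrightarrow> \<phi> a \<in> V"
  unfolding W_phi_def by (intro V_closed gr_V' lb_gr v_gr)

lemma \<psi>_V: "u \<in> gr (-(1/2)) \<Longrightarrow> \<psi> u \<in> V"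
  unfolding W_psi_def by (simp add: gr_V' V_closed lb_gr v_gr)

text \<open>Brings sums into quadratic form in the \<open>v'\<close>, so that identities between
  them reduce to symmetrised identities between coefficients. The two versions differ in which
  summation index carries \<open>T\<close>.\<close>

lemma v'_double_sum:
  assumes "\<And>k. k \<in> J \<Longrightarrow> T k \<in> gr (1/2)"
  shows "(\<Sum>k\<in>J. \<iota> (T k) * \<iota> (v' k)) =
    (\<Sum>h\<in>J. \<Sum>k\<in>J. dconst (\<omega> (v h) (T k)) * \<iota> (v' h) * \<iota> (v' k))"
    and "(\<Sum>h\<in>J. \<iota> (T h) * \<iota> (v' h)) =
    (\<Sum>h\<in>J. \<Sum>k\<in>J. dconst (\<omega> (v k) (T h)) * \<iota> (v' h) * \<iota> (v' k))"
proof -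
  have *: "\<iota> (T k) * \<iota> (v' k) = (\<Sum>h\<in>J. dconst (\<omega> (v h) (T k)) * \<iota> (v' h) * \<iota> (v' k))" if "k \<in> J" for k
    by (subst v'_sum[OF assms[OF that], symmetric]) (simp add: sum_distrib_right)
  have "(\<Sum>k\<in>J. \<iota> (T k) * \<iota> (v' k)) =
      (\<Sum>k\<in>J. \<Sum>h\<in>J. dconst (\<omega> (v h) (T k)) * \<iota> (v' h) * \<iota> (v' k))"
    by (intro sum.cong refl *)
  then show "(\<Sum>k\<in>J. \<iota> (T k) * \<iota> (v' k)) =
    (\<Sum>h\<in>J. \<Sum>k\<in>J. dconst (\<omega> (v h) (T k)) * \<iota> (v' h) * \<iota> (v' k))"
    by (subst sum.swap)
  have "(\<Sum>h\<in>J. \<iota> (T h) * \<iota> (v' h)) =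
      (\<Sum>h\<in>J. \<Sum>k\<in>J. dconst (\<omega> (v k) (T h)) * \<iota> (v' k) * \<iota> (v' h))"
    by (intro sum.cong refl *)
  then show "(\<Sum>h\<in>J. \<iota> (T h) * \<iota> (v' h)) =
    (\<Sum>h\<in>J. \<Sum>k\<in>J. dconst (\<omega> (v k) (T h)) * \<iota> (v' h) * \<iota> (v' k))"
    by (simp add: mult_ac)
qed

text \<open>\<open>ad y\<close> annihilates \<open>f\<close>, so it preserves the form
  \<open>\<omega>\<close>.\<close>

lemma \<omega>_invariant: "y \<in> g0f \<Longrightarrow> \<omega> w (lb y t) = \<omega> (lb w y) t"
proof -
  assume "y \<in> g0f"
  then have fy: "lb f y = 0" by (simp add: g0_centralizer_def)
  have "\<omega> w (lb y t) = \<kappa> f (lb (lb w y) t) + \<kappa> f (lb y (lb w t))"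
    by (simp add: lb_jacobi[of w y t] form_add)
  also have "\<kappa> f (lb y (lb w t)) = 0"
    by (simp add: form_inv[symmetric] fy)
  finally show ?thesis by simp
qed

text \<open>\<open>Dop w\<close> maps \<open>a\<close> to \<open>[w,a]\<close>, and each of the two
  factors of the quadratic term contributes \<open>-[w,a]\<close>; hence the coefficient 1/2.
  \<open>Dop e\<close> sees only \<open>\<kappa> x a\<close>, which is zero.\<close>

lemma kill_phi:
  assumes a: "a \<in> g0f"
  shows "kill (\<phi> a)"
  unfolding kill_def
proof (intro conjI ballI)
  have a0: "a \<in> gr 0" and ax: "\<kappa> x a = 0" using a by (simp_all add: centralizer_eq perp_def)
  show "Dop e (\<phi> a) = 0"
    by (simp add: W_phi_def Dop_add Dop_dscale Dop_sum Dop_mult Dop_e gr_V' lb_gr v_gr a0 ax)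
  fix w assume w: "w \<in> gr (1/2)"
  have wa: "lb w a \<in> gr (1/2)" by (rule lb_gr(2)[OF w a0])
  have 1: "(\<Sum>k\<in>J. dconst (\<omega> w (lb a (v k))) * \<iota> (v' k)) = - \<iota> (lb w a)"
  proof -
    have "(\<Sum>k\<in>J. dconst (\<omega> w (lb a (v k))) * \<iota> (v' k)) = - (\<Sum>k\<in>J. dconst (\<omega> (v k) (lb w a)) * \<iota> (v' k))"
      by (simp add: \<omega>_invariant[OF a] \<omega>_anti[of "lb w a"] dconst_minus sum_negf)
    then show ?thesis by (simp add: v'_sum[OF wa])
  qed
  have 2: "(\<Sum>k\<in>J. dconst (\<omega> w (v' k)) * \<iota> (lb a (v k))) = - \<iota> (lb w a)"
    by (subst v_sum[OF w]) (simp_all add: lb_add_right lb_scale_right lb_anti[of a w] \<iota>_minus)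
  have "Dop w (\<iota> (lb a (v k)) * \<iota> (v' k)) =
      [:dconst (\<omega> w (lb a (v k))) * \<iota> (v' k) + dconst (\<omega> w (v' k)) * \<iota> (lb a (v k)):]" if "k \<in> J" for k
    by (simp add: Dop_mult Dop_half[OF w] gr_V' lb_gr v_gr a0 that algebra_simps)
  then have "Dop w (\<Sum>k\<in>J. \<iota> (lb a (v k)) * \<iota> (v' k)) = [:(\<Sum>k\<in>J. dconst (\<omega> w (lb a (v k))) * \<iota> (v' k)) +
      (\<Sum>k\<in>J. dconst (\<omega> w (v' k)) * \<iota> (lb a (v k))):]"
    by (simp add: Dop_sum sum_const_poly sum.distrib cong: sum.cong)
  then have "Dop w (\<phi> a) = [:\<iota> (lb w a) + dconst (1/2) * ((\<Sum>k\<in>J. dconst (\<omega> w (lb a (v k))) * \<iota> (v' k)) +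
      (\<Sum>k\<in>J. dconst (\<omega> w (v' k)) * \<iota> (lb a (v k)))):]"
    by (simp add: W_phi_def Dop_add Dop_dscale Dop_half[OF w] a0)
  also have "\<dots> = 0"
    by (simp add: 1 2 dconst_half[of "- \<iota> (lb w a)", simplified])
  finally show "Dop w (\<phi> a) = 0" .
qed

text \<open>Rests on \<open>[e,[f,s]] = [2x,s] = s\<close>. It is the reason why the derivative of
  \<open>[e,u]\<close> appears in \<open>\<psi> u\<close>: its \<lambda>-term cancels the one of
  \<open>u\<close>.\<close>

lemma \<omega>_lb_e:
  assumes s: "s \<in> gr (1/2)"
  shows "\<omega> s (lb e u) = - \<kappa> u s"
proof -
  have "lb e (lb f s) = lb (x + x) s" by (simp add: lb_jacobi[of e f s] lb_e_f lb_e_half[OF s])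
  also have "\<dots> = scale (1/2 + 1/2) s"
    using s by (simp only: in_gr lb_add_left scale_left_distrib) (simp add: of_rat_divide)
  finally have "lb (lb f s) e = - s" using lb_anti[of "lb f s" e] by simp
  moreover have "\<omega> s (lb e u) = \<kappa> (lb (lb f s) e) u" by (simp add: form_inv)
  ultimately show ?thesis by (simp add: form_minus form_sym[of u])
qed

text \<open>\<open>R1\<close> comes from \<open>ad [u,q]\<close> acting on \<open>[s,t]\<close>,
  \<open>R2\<close> from \<open>ad u\<close> acting on \<open>[w,t]\<close>. Both inner brackets are
  multiples of \<open>e\<close>, so the errors are products of \<open>\<kappa> u\<close> and
  \<open>\<omega>\<close> divided by \<open>\<kappa> e f\<close>, and these cancel after
  symmetrisation in \<open>s\<close> and \<open>t\<close>.\<close>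

lemma psi_identity:
  assumes u: "u \<in> gr (-(1/2))" and w: "w \<in> gr (1/2)" and s: "s \<in> gr (1/2)" and t: "t \<in> gr (1/2)"
  shows "(\<omega> w (lb (lb u s) t) - 2 * \<omega> t (lb (lb u s) w) + \<omega> s (lb (lb u w) t)) +
    (\<omega> w (lb (lb u t) s) - 2 * \<omega> s (lb (lb u t) w) + \<omega> t (lb (lb u w) s)) = 0"
proof -
  have R1: "\<omega> s (lb (lb u q) t) - \<omega> t (lb (lb u q) s) = - \<kappa> u q * \<omega> s t / \<kappa> e f"
    if q: "q \<in> gr (1/2)" and s: "s \<in> gr (1/2)" and t: "t \<in> gr (1/2)" for q s t
  proof -
    let ?y = "lb u q"
    have y: "?y \<in> gr 0" by (rule lb_gr(3)[OF u q])
    have "\<omega> s (lb ?y t) - \<omega> t (lb ?y s) = \<kappa> f (lb ?y (lb s t))"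
      using \<omega>_anti[of t "lb ?y s"] by (simp add: lb_jacobi[of ?y s t] form_add)
    also have "\<dots> = \<omega> s t / \<kappa> e f * \<kappa> f (lb ?y e)"
      by (subst lb_half_half[OF s t]) (simp add: lb_scale_right form_scale)
    also have "\<kappa> f (lb ?y e) = 2 * \<kappa> x ?y"
      by (subst lb_anti) (simp add: form_minus form_f_e)
    also have "2 * \<kappa> x ?y = 2 * \<kappa> (lb x u) q" by (simp add: form_inv)
    also have "\<dots> = - \<kappa> u q" using u by (simp add: in_gr of_rat_minus of_rat_divide form_scale form_minus)
    finally show ?thesis by simp
  qed
  have R2: "\<omega> s (lb (lb u w) t) - \<omega> s (lb (lb u t) w) = \<omega> w t * \<kappa> u s / \<kappa> e f"
    if w: "w \<in> gr (1/2)" and s: "s \<in> gr (1/2)" and t: "t \<in> gr (1/2)" for w s t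
  proof -
    have "lb u (lb w t) = lb (lb u w) t + lb w (lb u t)" by (rule lb_jacobi)
    moreover have "lb w (lb u t) = - lb (lb u t) w" by (rule lb_anti)
    ultimately have "\<omega> s (lb (lb u w) t) - \<omega> s (lb (lb u t) w) = \<omega> s (lb u (lb w t))"
      by (simp add: lb_add_right lb_minus form_add form_minus lb_diff form_diff)
    also have "\<dots> = \<omega> w t / \<kappa> e f * \<omega> s (lb u e)"
      by (subst lb_half_half[OF w t]) (simp add: lb_scale_right form_scale)
    also have "\<omega> s (lb u e) = \<kappa> u s"
      by (subst lb_anti[of u e]) (simp add: lb_minus form_minus \<omega>_lb_e[OF s])
    finally show ?thesis by simp
  qed
  have "\<kappa> u s * \<omega> w t / \<kappa> e f = \<omega> w t * \<kappa> u s / \<kappa> e f" "\<kappa> u t * \<omega> w s / \<kappa> e f = \<omega> w s * \<kappa> u t / \<kappa> e f"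
    by simp_all
  then show ?thesis
    using R1[OF s w t] R1[OF t w s] R2[OF w s t] R2[OF w t s] by algebra
qed

text \<open>Under \<open>Dop w\<close>, the quadratic term yields \<open>-[w,u]\<close>, which
  cancels the image of \<open>u\<close>, and a remainder \<open>-?S2\<close>, which cancels the
  contribution of the cubic term; the \<lambda>-terms cancel by \<open>\<omega>_lb_e\<close>. Under
  \<open>Dop e\<close>, the image \<open>[e,u]\<close> of \<open>u\<close> cancels against the
  quadratic term.\<close>

lemma kill_psi:
  assumes u: "u \<in> gr (-(1/2))"
  shows "kill (\<psi> u)"
  unfolding kill_def
proof (intro conjI ballI)
  have eu: "lb e u \<in> gr (1/2)" by (rule lb_gr(5)[OF u])
  \<comment> \<open>Both sides equal \<open>\<kappa> u (v k)\<close>: \<open>u\<close> has degree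
    -1/2, which absorbs the factor -2.\<close>
  have "- 2 * \<kappa> x (lb u (v k)) = - \<omega> (v k) (lb e u)" if "k \<in> J" for k
  proof -
    have "- 2 * \<kappa> x (lb u (v k)) = - 2 * \<kappa> (lb x u) (v k)" by (simp add: form_inv)
    also have "\<dots> = \<kappa> u (v k)" using u by (simp add: in_gr of_rat_minus of_rat_divide form_scale form_minus)
    finally show ?thesis by (simp add: \<omega>_lb_e[OF v_gr(1)[OF that]])
  qed
  then have "(\<Sum>k\<in>J. dconst (- 2 * \<kappa> x (lb u (v k))) * \<iota> (v' k)) = - (\<Sum>k\<in>J. dconst (\<omega> (v k) (lb e u)) * \<iota> (v' k))"
    by (simp add: dconst_minus sum_negf)
  also have "\<dots> = - \<iota> (lb e u)" by (simp add: v'_sum[OF eu])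
  finally have 1: "(\<Sum>k\<in>J. dconst (- 2 * \<kappa> x (lb u (v k))) * \<iota> (v' k)) = - \<iota> (lb e u)" .
  have "Dop e (\<iota> (lb u (v k)) * \<iota> (v' k)) = [:dconst (- 2 * \<kappa> x (lb u (v k))) * \<iota> (v' k):]" if "k \<in> J" for k
    by (simp add: Dop_mult Dop_e gr_V' lb_gr v_gr u that mult.commute)
  then have 2: "Dop e (\<Sum>k\<in>J. \<iota> (lb u (v k)) * \<iota> (v' k)) =
      [:\<Sum>k\<in>J. dconst (- 2 * \<kappa> x (lb u (v k))) * \<iota> (v' k):]"
    by (simp add: Dop_sum sum_const_poly cong: sum.cong)
  have 3: "Dop e (\<Sum>h\<in>J. \<Sum>k\<in>J. \<iota> (lb (lb u (v h)) (v k)) * \<iota> (v' h) * \<iota> (v' k)) = 0"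
    by (simp add: Dop_sum Dop_mult Dop_e gr_V' V_closed lb_gr v_gr u)
  have "Dop e (\<psi> u) = [:\<iota> (lb e u) + (\<Sum>k\<in>J. dconst (- 2 * \<kappa> x (lb u (v k))) * \<iota> (v' k)):]"
    unfolding W_psi_def Dop_add Dop_dscale Dop_dD 2 3 by (simp add: Dop_e u eu)
  then show "Dop e (\<psi> u) = 0" by (simp only: 1) simp
  fix w assume w: "w \<in> gr (1/2)"
  let ?y = "\<lambda>k. \<iota> (v' k)"
  let ?Q = "\<Sum>h\<in>J. \<Sum>k\<in>J. dconst (\<omega> w (lb (lb u (v h)) (v k))) * ?y h * ?y k"
  let ?S1 = "\<Sum>k\<in>J. \<iota> (lb (lb u w) (v k)) * ?y k"
  let ?S2 = "\<Sum>h\<in>J. \<iota> (lb (lb u (v h)) w) * ?y h"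
  have S1: "(\<Sum>h\<in>J. \<Sum>k\<in>J. dconst (\<omega> w (v' h)) * \<iota> (lb (lb u (v h)) (v k)) * ?y k) = ?S1"
  proof -
    have "(\<Sum>h\<in>J. dconst (\<omega> w (v' h)) * \<iota> (lb (lb u (v h)) (v k)) * ?y k) = \<iota> (lb (lb u w) (v k)) * ?y k" for k
      by (subst v_sum[OF w, symmetric, where T = "\<lambda>s. lb (lb u s) (v k)"])
        (simp_all add: lb_add_right lb_add_left lb_scale_right lb_scale_left sum_distrib_right)
    then show ?thesis by (subst sum.swap) simp
  qed
  have S2: "(\<Sum>h\<in>J. \<Sum>k\<in>J. dconst (\<omega> w (v' k)) * \<iota> (lb (lb u (v h)) (v k)) * ?y h) = ?S2"
    by (subst v_sum[OF w, symmetric, where T = "\<lambda>s. lb (lb u _) s"])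
      (simp_all add: lb_add_right lb_scale_right sum_distrib_right)
  have S3: "(\<Sum>k\<in>J. \<iota> (lb w (lb u (v k))) * ?y k) = - ?S2"
    by (simp add: lb_anti[of w "lb u _"] \<iota>_minus sum_negf)
  have S4: "(\<Sum>k\<in>J. dconst (\<omega> w (v' k)) * \<iota> (lb u (v k))) = - \<iota> (lb w u)"
    by (subst v_sum[OF w]) (simp_all add: lb_add_right lb_scale_right lb_anti[of u w] \<iota>_minus)
  \<comment> \<open>\<open>?Q + ?S1 - ?S2 - ?S2\<close> is a quadratic form in the commuting
    \<open>v'\<close> whose symmetrised coefficients vanish by \<open>psi_identity\<close>. The
    cubic term therefore contributes three times \<open>?S2\<close>, which explains the coefficient
    1/3.\<close>
  have QS: "?Q + ?S1 + ?S2 = ?S2 + ?S2 + ?S2"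
  proof -
    have "?Q + ?S1 - ?S2 - ?S2 = (\<Sum>h\<in>J. \<Sum>k\<in>J. dconst (\<omega> w (lb (lb u (v h)) (v k))
        - 2 * \<omega> (v k) (lb (lb u (v h)) w) + \<omega> (v h) (lb (lb u w) (v k))) * ?y h * ?y k)"
    proof -
      have d: "dconst (p - 2 * q + r) = dconst p + dconst r - dconst q - dconst q" for p q r :: 'k
      proof -
        have "p - 2 * q + r = p + r + - q + - q" by simp
        then show ?thesis by (simp only: dconst_add dconst_minus) simp
      qed
      have T1: "lb (lb u w) (v k) \<in> gr (1/2)" if "k \<in> J" for k
        by (rule lb_gr(1)[OF lb_gr(3)[OF u w] v_gr(1)[OF that]])
      have T2: "lb (lb u (v k)) w \<in> gr (1/2)" if "k \<in> J" for k
        by (rule lb_gr(1)[OF lb_gr(3)[OF u v_gr(1)[OF that]] w])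
      have E1: "?S1 = (\<Sum>h\<in>J. \<Sum>k\<in>J. dconst (\<omega> (v h) (lb (lb u w) (v k))) * ?y h * ?y k)"
        by (rule v'_double_sum(1)) (rule T1)
      have E2: "?S2 = (\<Sum>h\<in>J. \<Sum>k\<in>J. dconst (\<omega> (v k) (lb (lb u (v h)) w)) * ?y h * ?y k)"
        by (rule v'_double_sum(2)) (rule T2)
      show ?thesis
        unfolding E1 E2 d
        by (simp add: sum.distrib sum_subtractf left_diff_distrib distrib_right sum_distrib_left mult.assoc sum_negf)
    qed
    also have "\<dots> = 0"
      by (rule antisymmetric_sum) (rule psi_identity[OF u w v_gr(1) v_gr(1)])
    finally show ?thesis by (simp add: algebra_simps)
  qed
  have "Dop w (\<psi> u) = [:\<iota> (lb w u), dconst (\<kappa> w u):]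
      + [:dconst (1/3) * (?Q + (\<Sum>h\<in>J. \<Sum>k\<in>J. dconst (\<omega> w (v' h)) * \<iota> (lb (lb u (v h)) (v k)) * ?y k)
         + (\<Sum>h\<in>J. \<Sum>k\<in>J. dconst (\<omega> w (v' k)) * \<iota> (lb (lb u (v h)) (v k)) * ?y h)):]
      + [:(\<Sum>k\<in>J. \<iota> (lb w (lb u (v k))) * ?y k) + (\<Sum>k\<in>J. dconst (\<omega> w (v' k)) * \<iota> (lb u (v k))):]
      + [:0, dconst (\<omega> w (lb e u)):]"
  proof -
    have "Dop w (\<iota> (lb (lb u (v h)) (v k)) * ?y h * ?y k) =
       [:dconst (\<omega> w (lb (lb u (v h)) (v k))) * ?y h * ?y k +
         dconst (\<omega> w (v' h)) * \<iota> (lb (lb u (v h)) (v k)) * ?y k +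
         dconst (\<omega> w (v' k)) * \<iota> (lb (lb u (v h)) (v k)) * ?y h:]" if "h \<in> J" "k \<in> J" for h k
      by (simp add: Dop_mult Dop_half[OF w] gr_V' V_closed lb_gr v_gr that u algebra_simps)
    then have 1: "Dop w (\<Sum>h\<in>J. \<Sum>k\<in>J. \<iota> (lb (lb u (v h)) (v k)) * ?y h * ?y k) =
      [:?Q + (\<Sum>h\<in>J. \<Sum>k\<in>J. dconst (\<omega> w (v' h)) * \<iota> (lb (lb u (v h)) (v k)) * ?y k)
         + (\<Sum>h\<in>J. \<Sum>k\<in>J. dconst (\<omega> w (v' k)) * \<iota> (lb (lb u (v h)) (v k)) * ?y h):]"
      by (simp add: Dop_sum sum_const_poly sum.distrib cong: sum.cong)
    have "Dop w (\<iota> (lb u (v k)) * ?y k) = [:\<iota> (lb w (lb u (v k))) * ?y k + dconst (\<omega> w (v' k)) * \<iota> (lb u (v k)):]"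
      if "k \<in> J" for k
      by (simp add: Dop_mult Dop_half[OF w] gr_V' V_closed lb_gr v_gr that u algebra_simps)
    then have 2: "Dop w (\<Sum>k\<in>J. \<iota> (lb u (v k)) * ?y k) =
       [:(\<Sum>k\<in>J. \<iota> (lb w (lb u (v k))) * ?y k) + (\<Sum>k\<in>J. dconst (\<omega> w (v' k)) * \<iota> (lb u (v k))):]"
      by (simp add: Dop_sum sum_const_poly sum.distrib cong: sum.cong)
    show ?thesis
      unfolding W_psi_def Dop_add Dop_dscale Dop_dD 1 2
      by (simp add: Dop_half[OF w] u eu lamD_const)
  qed
  also have "\<dots> = 0"
    unfolding S1 S2 S3 S4 QS dconst_third
    by (simp add: \<omega>_lb_e[OF w] dconst_minus form_sym[of u w])
  finally show "Dop w (\<psi> u) = 0" .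
qed

text \<open>Under \<open>Dop e\<close>, \<open>2x\<close> from \<open>f\<close> cancels the
  contraction of the dual bases of degree 0, and the \<lambda>-terms of \<open>f\<close> and
  \<open>x'\<close> cancel because \<open>2 \<kappa> x x = \<kappa> e f\<close>. Under
  \<open>Dop w\<close>, \<open>[w,f]\<close> and \<open>?S\<close> cancel in pairs, while the
  \<lambda>-terms have coefficients \<open>-1/2 + 1 - 1/2\<close> and the terms in the derivative of
  \<open>w\<close> have \<open>-1/2 + 1/2\<close>.\<close>

lemma kill_L: "kill L"
  unfolding kill_def
proof (intro conjI ballI)
  have ef: "lb e (lb f (v k)) = v k" if "k \<in> J" for k
  proof -
    have "lb e (lb f (v k)) = lb x (v k) + lb x (v k)"
      by (simp add: lb_jacobi[of e f] lb_e_f lb_add_left lb_e_half[OF v_gr(1)[OF that]])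
    also have "\<dots> = scale (1/2 + 1/2) (v k)"
      using v_gr(1)[OF that] by (simp only: in_gr scale_left_distrib) (simp add: of_rat_divide)
    finally show ?thesis by simp
  qed
  \<comment> \<open>Expanding \<open>v k\<close> along the \<open>v'\<close> gives the skew matrix
    \<open>\<omega> (v h) (v k)\<close>, contracted with commuting products.\<close>
  have vv: "(\<Sum>k\<in>J. \<iota> (v k) * \<iota> (v' k)) = 0"
  proof -
    have "(\<Sum>k\<in>J. \<iota> (v k) * \<iota> (v' k)) = (\<Sum>h\<in>J. \<Sum>k\<in>J. dconst (\<omega> (v h) (v k)) * \<iota> (v' h) * \<iota> (v' k))"
      by (rule v'_double_sum(1)) (rule v_gr(1))
    also have "\<dots> = 0"
    proof (rule antisymmetric_sum)
      show "\<omega> (v h) (v k) + \<omega> (v k) (v h) = 0" for h k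
        using \<omega>_anti[of "v h" "v k"] by simp
    qed
    finally show ?thesis .
  qed
  have cc: "(\<Sum>j\<in>J0. dconst (- 2 * \<kappa> x (c j)) * \<iota> (c' j)) = - \<iota> x - \<iota> x"
    "(\<Sum>j\<in>J0. dconst (- 2 * \<kappa> x (c' j)) * \<iota> (c j)) = - \<iota> x - \<iota> x"
  proof -
    have d: "dconst (- 2 * r) * p = dconst (- 2) * (dconst r * p)" for r :: 'k and p :: "('i, 'k) dpoly"
      by (simp only: dconst_mult mult.assoc)
    have d2: "dconst (- 2) * p = - p - p" for p :: "('i, 'k) dpoly"
    proof -
      have "dconst (- 2 :: 'k) = dconst (- 1) + dconst (- 1)" by (simp flip: dconst_add)
      also have "\<dots> = - 1 - (1 :: ('i, 'k) dpoly)" by (simp only: dconst_minus dconst_1) simp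
      finally show ?thesis by (simp add: left_diff_distrib)
    qed
    show "(\<Sum>j\<in>J0. dconst (- 2 * \<kappa> x (c j)) * \<iota> (c' j)) = - \<iota> x - \<iota> x"
      "(\<Sum>j\<in>J0. dconst (- 2 * \<kappa> x (c' j)) * \<iota> (c j)) = - \<iota> x - \<iota> x"
      unfolding d sum_distrib_left[symmetric] c_sum[OF x_gr] by (rule d2)+
  qed
  have "Dop e (\<iota> (c j) * \<iota> (c' j)) =
      [:dconst (- 2 * \<kappa> x (c j)) * \<iota> (c' j) + dconst (- 2 * \<kappa> x (c' j)) * \<iota> (c j):]" if "j \<in> J0" for j
    by (simp add: Dop_mult Dop_e gr_V' c_gr that mult.commute)
  then have 1: "Dop e (\<Sum>j\<in>J0. \<iota> (c j) * \<iota> (c' j)) = [:(\<Sum>j\<in>J0. dconst (- 2 * \<kappa> x (c j)) * \<iota> (c' j))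
      + (\<Sum>j\<in>J0. dconst (- 2 * \<kappa> x (c' j)) * \<iota> (c j)):]"
    by (simp add: Dop_sum sum_const_poly sum.distrib cong: sum.cong)
  have "Dop e (\<iota> (v' k) * \<iota> (lb f (v k))) = [:\<iota> (v k) * \<iota> (v' k):]" if "k \<in> J" for k
    by (simp add: Dop_mult Dop_e gr_V' lb_gr v_gr that ef mult.commute)
  then have 2: "Dop e (\<Sum>k\<in>J. \<iota> (v' k) * \<iota> (lb f (v k))) = [:\<Sum>k\<in>J. \<iota> (v k) * \<iota> (v' k):]"
    by (simp add: Dop_sum sum_const_poly cong: sum.cong)
  have 3: "Dop e (\<Sum>k\<in>J. \<iota> (v' k) * dD (\<iota> (v k))) = 0"
    by (simp add: Dop_sum Dop_mult Dop_dD Dop_e gr_V' V_closed v_gr)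
  have "Dop e L = [:\<iota> x + \<iota> x, dconst (\<kappa> e f):] + lamD [:dconst (- 2 * \<kappa> x x):]
    + [:dconst (1/2) * ((\<Sum>j\<in>J0. dconst (- 2 * \<kappa> x (c j)) * \<iota> (c' j)) + (\<Sum>j\<in>J0. dconst (- 2 * \<kappa> x (c' j)) * \<iota> (c j))):]
    + [:\<Sum>k\<in>J. \<iota> (v k) * \<iota> (v' k):]"
    unfolding W_L_def Dop_add Dop_dscale Dop_dD 1 2 3 by (simp add: Dop_e x_gr)
  also have "\<dots> = 0"
    unfolding vv cc dconst_half using form_x_x by (simp add: lamD_const flip: dconst_add)
  finally show "Dop e L = 0" .
  fix w assume w: "w \<in> gr (1/2)"
  let ?S = "\<Sum>k\<in>J. \<iota> (lb w (lb f (v k))) * \<iota> (v' k)"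
  \<comment> \<open>Stated for \<open>p\<close> and \<open>q\<close> because the dual bases are
    contracted in both orders. Moving \<open>ad w\<close> across the form leaves the expansion of
    \<open>[[f,v k],w]\<close>, which has degree 0.\<close>
  have S: "(\<Sum>j\<in>J0. \<iota> (lb w (p j)) * \<iota> (q j)) = - ?S"
    if pq: "\<And>y. y \<in> gr 0 \<Longrightarrow> (\<Sum>j\<in>J0. dconst (\<kappa> y (p j)) * \<iota> (q j)) = \<iota> y" and p: "\<And>j. j \<in> J0 \<Longrightarrow> p j \<in> gr 0"
    for p q
  proof -
    have "(\<Sum>j\<in>J0. \<iota> (lb w (p j)) * \<iota> (q j)) =
        (\<Sum>j\<in>J0. (\<Sum>k\<in>J. dconst (\<omega> (v k) (lb w (p j))) * \<iota> (v' k)) * \<iota> (q j))"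
      by (intro sum.cong refl arg_cong2[where f = "(*)"] v'_sum[symmetric] lb_gr(2) w p)
    also have "\<dots> = (\<Sum>j\<in>J0. \<Sum>k\<in>J. dconst (\<kappa> (lb (lb f (v k)) w) (p j)) * \<iota> (q j) * \<iota> (v' k))"
      by (simp add: form_inv sum_distrib_left mult_ac)
    also have "\<dots> = (\<Sum>k\<in>J. (\<Sum>j\<in>J0. dconst (\<kappa> (lb (lb f (v k)) w) (p j)) * \<iota> (q j)) * \<iota> (v' k))"
      by (subst sum.swap) (simp add: sum_distrib_right)
    also have "\<dots> = (\<Sum>k\<in>J. \<iota> (lb (lb f (v k)) w) * \<iota> (v' k))"
      by (intro sum.cong refl arg_cong2[where f = "(*)"] pq lb_gr w v_gr)
    also have "\<dots> = - ?S"
      by (simp add: lb_anti[of "lb f _" w] \<iota>_minus sum_negf)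
    finally show ?thesis .
  qed
  have wx: "lb w x = scale (- 1/2) w"
    using w lb_anti[of w x] by (simp add: in_gr of_rat_divide)
  have \<iota>wx: "\<iota> (lb w x) = - (dconst (1/2) * \<iota> w)"
    by (simp add: wx \<iota>_scale \<iota>_minus)
  have fv: "(\<Sum>k\<in>J. dconst (\<omega> w (v' k)) * \<iota> (lb f (v k))) = - \<iota> (lb w f)"
    by (subst v_sum[OF w]) (simp_all add: lb_add_right lb_scale_right lb_anti[of f w] \<iota>_minus)
  have v1: "(\<Sum>k\<in>J. dconst (\<kappa> w (lb f (v k))) * \<iota> (v' k)) = \<iota> w"
  proof -
    have "\<kappa> w (lb f (v k)) = \<omega> (v k) w" for k
      by (subst form_sym) (simp add: form_inv)
    then show ?thesis by (simp add: v'_sum[OF w])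
  qed
  have v2: "(\<Sum>k\<in>J. dconst (\<omega> w (v k)) * \<iota> (v' k)) = - \<iota> w"
    using v'_sum[OF w] by (simp add: \<omega>_anti[of w "v _"] dconst_minus sum_negf)
  have v3: "(\<Sum>k\<in>J. dconst (\<omega> w (v' k)) * dD (\<iota> (v k))) = dD (\<iota> w)"
  proof -
    have s: "dD (\<Sum>k\<in>A. F k) = (\<Sum>k\<in>A. dD (F k))" for A :: "'q set" and F :: "'q \<Rightarrow> ('i, 'k) dpoly"
      by (induction A rule: infinite_finite_induct) (auto simp: dD_add)
    have "(\<Sum>k\<in>J. dconst (\<omega> w (v' k)) * dD (\<iota> (v k))) = dD (\<Sum>k\<in>J. dconst (\<omega> w (v' k)) * \<iota> (v k))"
      by (simp add: s dD_scale)
    then show ?thesis by (simp add: v_sum[OF w, where T = "\<lambda>t. t"])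
  qed
  have sp: "(\<Sum>k\<in>A. [:F k, G k:]) = [:\<Sum>k\<in>A. F k, \<Sum>k\<in>A. G k:]" for A :: "'q set" and F G :: "'q \<Rightarrow> ('i, 'k) dpoly"
    by (induction A rule: infinite_finite_induct) auto
  have "Dop w L = [:\<iota> (lb w f):] + lamD [:\<iota> (lb w x):]
     + [:dconst (1/2) * ((\<Sum>j\<in>J0. \<iota> (lb w (c j)) * \<iota> (c' j)) + (\<Sum>j\<in>J0. \<iota> (lb w (c' j)) * \<iota> (c j))):]
     + [:(\<Sum>k\<in>J. dconst (\<omega> w (v' k)) * \<iota> (lb f (v k))) + ?S, \<Sum>k\<in>J. dconst (\<kappa> w (lb f (v k))) * \<iota> (v' k):]
     + [:dconst (1/2) * (\<Sum>k\<in>J. dconst (\<omega> w (v' k)) * dD (\<iota> (v k))),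
         dconst (1/2) * (\<Sum>k\<in>J. dconst (\<omega> w (v k)) * \<iota> (v' k)):]"
  proof -
    have "Dop w (\<iota> (c j) * \<iota> (c' j)) = [:\<iota> (lb w (c j)) * \<iota> (c' j) + \<iota> (lb w (c' j)) * \<iota> (c j):]" if "j \<in> J0" for j
      by (simp add: Dop_mult Dop_half[OF w] gr_V' c_gr that mult.commute)
    then have 1: "Dop w (\<Sum>j\<in>J0. \<iota> (c j) * \<iota> (c' j)) =
       [:(\<Sum>j\<in>J0. \<iota> (lb w (c j)) * \<iota> (c' j)) + (\<Sum>j\<in>J0. \<iota> (lb w (c' j)) * \<iota> (c j)):]"
      by (simp add: Dop_sum sum_const_poly sum.distrib cong: sum.cong)
    have "Dop w (\<iota> (v' k) * \<iota> (lb f (v k))) = [:dconst (\<omega> w (v' k)) * \<iota> (lb f (v k)) + \<iota> (lb w (lb f (v k))) * \<iota> (v' k),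
        dconst (\<kappa> w (lb f (v k))) * \<iota> (v' k):]" if "k \<in> J" for k
      by (simp add: Dop_mult Dop_half[OF w] gr_V' lb_gr v_gr that mult.commute)
    then have 2: "Dop w (\<Sum>k\<in>J. \<iota> (v' k) * \<iota> (lb f (v k))) =
       [:(\<Sum>k\<in>J. dconst (\<omega> w (v' k)) * \<iota> (lb f (v k))) + ?S, \<Sum>k\<in>J. dconst (\<kappa> w (lb f (v k))) * \<iota> (v' k):]"
      by (simp add: Dop_sum sp sum.distrib cong: sum.cong)
    have "Dop w (\<iota> (v' k) * dD (\<iota> (v k))) = [:dconst (\<omega> w (v' k)) * dD (\<iota> (v k)), dconst (\<omega> w (v k)) * \<iota> (v' k):]"
      if "k \<in> J" for k
      by (simp add: Dop_mult Dop_dD Dop_half[OF w] gr_V' V_closed v_gr that mult.commute lamD_const)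
    then have 3: "Dop w (\<Sum>k\<in>J. \<iota> (v' k) * dD (\<iota> (v k))) =
       [:\<Sum>k\<in>J. dconst (\<omega> w (v' k)) * dD (\<iota> (v k)), \<Sum>k\<in>J. dconst (\<omega> w (v k)) * \<iota> (v' k):]"
      by (simp add: Dop_sum sp cong: sum.cong)
    show ?thesis
      unfolding W_L_def Dop_add Dop_dscale Dop_dD 1 2 3
      by (simp add: Dop_half[OF w] x_gr)
  qed
  also have "\<dots> = 0"
  proof -
    have "\<iota> w - dconst (1/2) * \<iota> w - dconst (1/2) * \<iota> w = 0"
      using dconst_half[of "\<iota> w"] by (simp add: algebra_simps)
    moreover have S1: "(\<Sum>j\<in>J0. \<iota> (lb w (c j)) * \<iota> (c' j)) = - ?S"
      by (rule S[OF c_sum(2) c_gr(1)])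
    moreover have S2: "(\<Sum>j\<in>J0. \<iota> (lb w (c' j)) * \<iota> (c j)) = - ?S"
      by (rule S[OF c_sum(1) c_gr(2)])
    ultimately show ?thesis
      unfolding S1 S2 dconst_half fv v1 v2 v3 \<iota>wx lamD_const
      by (simp add: lamD_const dD_scale dD_mult algebra_simps dD_minus)
  qed
  finally show "Dop w L = 0" .
qed

end

section \<open>Generation and independence\<close>

lemma lamD_pow_const: "(lamD ^^ n) [:dconst r:] = monom (dconst r) n"
  by (induction n) (auto simp: monom_0 intro!: poly_eqI simp: coeff_lamD split: nat.split)

context minimal_W
begin

lemma to_perp_triple: "to_perp f = 0" "to_perp x = 0"
  using form_e_f_nz form_x_x_nz by (simp_all add: to_perp_def form_triple)

lemma pr_triple: "pr_0 f = 0" "pr_p f = 0" "pr_m f = 0" "pr_0 x = 0" "pr_p x = 0" "pr_m x = 0"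
  by (simp_all add: pr_0_def pr_p_def pr_m_def to_perp_triple)

lemma pr_0_gr: "a \<in> perp \<Longrightarrow> a \<in> gr 0 \<Longrightarrow> pr_0 a = a \<and> pr_p a = 0 \<and> pr_m a = 0"
  by (simp add: pr_0_def pr_p_def pr_m_def to_perp_id in_gr)

lemma pr_half_gr: "a \<in> gr (1/2) \<Longrightarrow> pr_0 a = 0 \<and> pr_p a = a \<and> pr_m a = 0"
proof -
  assume a: "a \<in> gr (1/2)"
  have "a \<in> perp" by (rule gr_perp[OF a]) simp_all
  moreover have "scale (1/2) a + scale (1/2) a = a"
    by (simp flip: scale_left_distrib)
  ultimately show ?thesis
    using a by (simp add: pr_0_def pr_p_def pr_m_def to_perp_id in_gr lb_scale_right of_rat_divide)
qed

lemma pr_neg_half_gr: "a \<in> gr (-(1/2)) \<Longrightarrow> pr_0 a = 0 \<and> pr_p a = 0 \<and> pr_m a = a"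
proof -
  assume a: "a \<in> gr (-(1/2))"
  have "a \<in> perp" by (rule gr_perp[OF a]) simp_all
  moreover have "scale (1/2) a + scale (1/2) a = a"
    by (simp flip: scale_left_distrib)
  ultimately show ?thesis
    using a by (simp add: pr_0_def pr_p_def pr_m_def to_perp_id in_gr lb_scale_right of_rat_divide of_rat_minus lb_minus)
qed

lemma v_nz: "k \<in> J \<Longrightarrow> v k \<noteq> 0"
  using dual_v[of k k] by auto

lemma span_\<iota>:
  assumes "\<And>b. b \<in> S \<Longrightarrow> \<iota> b \<in> diff_alg T" and "a \<in> span S"
  shows "\<iota> a \<in> diff_alg T"
  using assms(2)
proof (induction rule: span_induct_alt)
  case base
  show ?case using diff_alg.const[of 0 T] by simp
next
  case (step r b a)
  show ?case unfolding \<iota>_add \<iota>_scale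
    by (rule diff_alg.add[OF diff_alg.mult[OF diff_alg.const assms(1)[OF step(1)]] step(2)])
qed

section \<open>Variables adapted to the grading, for fixed bases of the centralizer and of degree
  -1/2\<close>

context
  fixes A U :: "'g set"
  assumes basis_A: "is_basis scale A id g0f" and basis_U: "is_basis scale U id (gr (-(1/2)))"
begin

definition "X_set = insert x (v ` J)"
definition "I_set = {Gen_L} \<union> Gen_phi ` A \<union> Gen_psi ` U"

text \<open>Besides the generators of the W-algebra, the index set contains the basis vectors of
  \<open>\<bbbF>x + \<gg>\<^sub>1\<^sub>/\<^sub>2\<close>, tagged with \<open>Gen_phi\<close> as well; they do not lie in \<open>A\<close>.\<close>

definition "K_set = I_set \<union> Gen_phi ` X_set"

definition "vec j = (case j of Gen_L \<Rightarrow> f | Gen_phi a \<Rightarrow> a | Gen_psi u \<Rightarrow> u)"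
text \<open>Levels increase as the degree decreases, except that \<open>x\<close> is placed at the
  bottom with degree 1/2. The corrections in each generator then involve lower levels only, which
  makes the change of variables triangular.\<close>

definition "lev j = (case j of Gen_L \<Rightarrow> 3 | Gen_phi a \<Rightarrow> if a \<in> A then 1 else 0 | Gen_psi u \<Rightarrow> (2::nat))"
text \<open>The value 0 off \<open>K_set\<close> keeps every \<open>gens j\<close> in V, so that the
  Leibniz rule of \<open>Dop\<close> applies to \<open>diff_hom gens P\<close> for arbitrary
  \<open>P\<close>.\<close>

definition "gens j = (if j \<in> I_set then W_gens L \<phi> \<psi> j else if j \<in> K_set then \<iota> (vec j) else 0)"

lemma A_facts: "independent A" "span A = g0f" and U_facts: "independent U" "span U = gr (-(1/2))"
  using basis_A basis_U unfolding is_basis_def by simp_all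

lemma A_in: "a \<in> A \<Longrightarrow> a \<in> g0f" and U_in: "u \<in> U \<Longrightarrow> u \<in> gr (-(1/2))"
  using span_base[of a A] span_base[of u U] by (simp_all add: A_facts U_facts)

lemma finite_A: "finite A" and finite_U: "finite U"
  by (rule finite_basis[OF basis_A] finite_basis[OF basis_U])+

lemma x_notin: "x \<notin> A"
  using A_in[of x] f_nz by (auto simp: g0_centralizer_def lb_f_x)

lemma v_notin: "k \<in> J \<Longrightarrow> v k \<notin> A"
proof
  assume k: "k \<in> J" and "v k \<in> A"
  then have "v k \<in> gr 0" using A_in by (auto simp: centralizer_eq)
  with gr_unique[OF v_gr(1)[OF k] this] v_nz[OF k] show False by simp
qed

lemma K_cases:
  assumes "j \<in> K_set"
  obtains "j = Gen_L" | a where "a \<in> A" "j = Gen_phi a" | u where "u \<in> U" "j = Gen_psi u"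
    | "j = Gen_phi x" | k where "k \<in> J" "j = Gen_phi (v k)"
  using assms unfolding K_set_def I_set_def X_set_def by blast

lemma in_K: "Gen_L \<in> K_set" "a \<in> A \<Longrightarrow> Gen_phi a \<in> K_set" "u \<in> U \<Longrightarrow> Gen_psi u \<in> K_set"
    "Gen_phi x \<in> K_set" "k \<in> J \<Longrightarrow> Gen_phi (v k) \<in> K_set"
  unfolding K_set_def I_set_def X_set_def by blast+

lemma notin_I: "Gen_phi x \<notin> I_set" "k \<in> J \<Longrightarrow> Gen_phi (v k) \<notin> I_set"
  using x_notin v_notin unfolding I_set_def by blast+

text \<open>Substituting the basis \<open>vec\<close> has this map as a left inverse, whence independence.\<close>

definition coords :: "'g \<Rightarrow> ('g gen_index, 'k) dpoly" where
  "coords a = dconst (\<kappa> e a / \<kappa> e f) * dvar (Gen_L, 0)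
     + (\<Sum>u\<in>U. dconst (representation U (pr_m a) u) * dvar (Gen_psi u, 0))
     + (\<Sum>b\<in>A. dconst (representation A (pr_0 a) b) * dvar (Gen_phi b, 0))
     + dconst (\<kappa> x a / \<kappa> x x) * dvar (Gen_phi x, 0)
     + (\<Sum>k\<in>J. dconst (\<omega> (pr_p a) (v' k)) * dvar (Gen_phi (v k), 0))"

lemma pr_span: "pr_m a \<in> span U" "pr_0 a \<in> span A"
  unfolding A_facts U_facts centralizer_eq using pr_gr[of a] pr_perp[of a] by simp_all

lemma coords_add: "coords (a + b) = coords a + coords b"
  by (simp add: coords_def form_add pr_add representation_add A_facts(1) U_facts(1) pr_span lb_add_left
      add_divide_distrib dconst_add distrib_right sum.distrib)

lemma coords_scale: "coords (scale r a) = dconst r * coords a"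
  by (simp add: coords_def form_scale pr_scale representation_scale A_facts(1) U_facts(1) pr_span lb_scale_left
      dconst_mult distrib_left sum_distrib_left mult.assoc flip: times_divide_eq_right)

lemma coords_vec: "j \<in> K_set \<Longrightarrow> coords (vec j) = dvar (j, 0)"
proof (erule K_cases)
  note z = representation_zero
  show "coords (vec j) = dvar (j, 0)" if "j = Gen_L"
    using form_e_f_nz by (simp add: that vec_def coords_def form_triple pr_triple z)
  show "coords (vec j) = dvar (j, 0)" if "j = Gen_phi x"
    using form_x_x_nz by (simp add: that vec_def coords_def form_triple pr_triple z)
  show "coords (vec j) = dvar (j, 0)" if a: "a \<in> A" "j = Gen_phi a" for a
  proof -
    have p: "a \<in> gr 0" "a \<in> perp" using A_in[OF a(1)] by (simp_all add: centralizer_eq)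
    then have "\<kappa> e a = 0" "\<kappa> x a = 0" by (simp_all add: perp_def)
    moreover have "(\<Sum>b\<in>A. dconst (representation A a b) * dvar (Gen_phi b, 0)) = (dvar (Gen_phi a, 0) :: ('g gen_index, 'k) dpoly)"
      by (simp add: representation_basis[OF A_facts(1) a(1)] if_distrib if_distribR finite_A a(1) cong: if_cong)
    ultimately show ?thesis using pr_0_gr[OF p(2,1)] by (simp add: a(2) vec_def coords_def z)
  qed
  show "coords (vec j) = dvar (j, 0)" if u: "u \<in> U" "j = Gen_psi u" for u
  proof -
    have p: "u \<in> gr (-(1/2))" by (rule U_in[OF u(1)])
    then have "\<kappa> e u = 0" "\<kappa> x u = 0" using gr_orth[OF e_gr p] gr_orth[OF x_gr p] by simp_all
    moreover have "(\<Sum>b\<in>U. dconst (representation U u b) * dvar (Gen_psi b, 0)) = (dvar (Gen_psi u, 0) :: ('g gen_index, 'k) dpoly)"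
      by (simp add: representation_basis[OF U_facts(1) u(1)] if_distrib if_distribR finite_U u(1) cong: if_cong)
    ultimately show ?thesis using pr_neg_half_gr[OF p] by (simp add: u(2) vec_def coords_def z)
  qed
  show "coords (vec j) = dvar (j, 0)" if k: "k \<in> J" "j = Gen_phi (v k)" for k
  proof -
    have p: "v k \<in> gr (1/2)" by (rule v_gr(1)[OF k(1)])
    then have "\<kappa> e (v k) = 0" "\<kappa> x (v k) = 0" using gr_orth[OF e_gr p] gr_orth[OF x_gr p] by simp_all
    moreover have "(\<Sum>h\<in>J. dconst (\<omega> (v k) (v' h)) * dvar (Gen_phi (v h), 0)) = (dvar (Gen_phi (v k), 0) :: ('g gen_index, 'k) dpoly)"
      by (simp add: dual_v k(1) if_distrib if_distribR finite_J cong: if_cong)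
    ultimately show ?thesis using pr_half_gr[OF p] by (simp add: k(2) vec_def coords_def z)
  qed
qed

lemma vec_le_half: "j \<in> K_set \<Longrightarrow> \<kappa> f (vec j) = 0"
proof (erule K_cases)
  show "\<kappa> f (vec j) = 0" if "a \<in> A" "j = Gen_phi a" for a
    using A_in[OF that(1)] that(2) by (simp add: centralizer_eq perp_def vec_def)
  show "\<kappa> f (vec j) = 0" if "u \<in> U" "j = Gen_psi u" for u
    using gr_orth[OF f_gr U_in[OF that(1)]] that(2) by (simp add: vec_def)
  show "\<kappa> f (vec j) = 0" if "k \<in> J" "j = Gen_phi (v k)" for k
    using gr_orth[OF f_gr v_gr(1)[OF that(1)]] that(2) by (simp add: vec_def)
qed (simp_all add: vec_def form_triple)

text \<open>Generation is the graded decomposition with no \<open>e\<close>-component. For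
  independence, \<open>coords\<close> on \<open>bas\<close> extends to a differential homomorphism
  that undoes the substitution.\<close>

lemma base_diff_polys: "diff_polys_in V K_set (\<lambda>j. \<iota> (vec j))"
  unfolding diff_polys_in_def
proof (intro conjI allI impI)
  have sub: "\<iota> a \<in> diff_alg ((\<lambda>j. \<iota> (vec j)) ` K_set)" if "\<kappa> f a = 0" for a
  proof -
    let ?D = "diff_alg ((\<lambda>j. \<iota> (vec j)) ` K_set)"
    have vecD: "\<iota> (vec j) \<in> ?D" if "j \<in> K_set" for j
      using that by (intro diff_alg.gen) simp
    have "\<iota> f \<in> ?D" "\<iota> x \<in> ?D"
      using vecD[OF in_K(1)] vecD[OF in_K(4)] by (simp_all add: vec_def)
    moreover have "\<iota> (pr_m a) \<in> ?D"
      by (rule span_\<iota>[OF _ pr_span(1)]) (use vecD[OF in_K(3)] in \<open>simp add: vec_def\<close>)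
    moreover have "\<iota> (pr_0 a) \<in> ?D"
      by (rule span_\<iota>[OF _ pr_span(2)]) (use vecD[OF in_K(2)] in \<open>simp add: vec_def\<close>)
    moreover have "\<iota> (pr_p a) \<in> ?D"
    proof (rule span_\<iota>)
      show "pr_p a \<in> span (v ` J)" using pr_gr(2)[of a] basis_v unfolding is_basis_def by simp
      show "\<iota> b \<in> ?D" if "b \<in> v ` J" for b
        using that vecD[OF in_K(5)] by (auto simp: vec_def)
    qed
    moreover have "\<iota> a = dconst (\<kappa> e a / \<kappa> e f) * \<iota> f + dconst (\<kappa> x a / \<kappa> x x) * \<iota> x + \<iota> (pr_0 a) + \<iota> (pr_p a) + \<iota> (pr_m a)"
      using arg_cong[OF decomposition[of a], of \<iota>] that by (simp add: \<iota>_add \<iota>_scale)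
    ultimately show ?thesis by (simp only:) (intro diff_alg.add diff_alg.mult diff_alg.const)
  qed
  show "V = diff_alg ((\<lambda>j. \<iota> (vec j)) ` K_set)"
  proof
    show "V \<subseteq> diff_alg ((\<lambda>j. \<iota> (vec j)) ` K_set)"
      unfolding V_eq by (rule diff_alg_subset) (use sub in blast)
    show "diff_alg ((\<lambda>j. \<iota> (vec j)) ` K_set) \<subseteq> V"
      unfolding V_eq by (rule diff_alg_subset) (auto intro!: diff_alg.gen vec_le_half)
  qed
  fix P :: "('g gen_index, 'k) dpoly"
  assume P: "dvars P \<subseteq> K_set \<times> UNIV \<and> diff_hom (\<lambda>j. \<iota> (vec j)) P = 0"
  have "diff_hom (\<lambda>i. coords (bas i)) (diff_hom (\<lambda>j. \<iota> (vec j)) P) = diff_hom (\<lambda>j. coords (vec j)) P"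
    by (simp only: diff_hom_comp diff_hom_\<iota>[of coords, OF coords_add coords_scale])
  also have "\<dots> = diff_hom (\<lambda>j. dvar (j, 0)) P"
    by (rule diff_hom_cong[OF conjunct1[OF P]]) (rule coords_vec)
  also have "\<dots> = P" by (rule diff_hom_id)
  finally show "P = 0" using P by simp
qed

definition "low n = diff_alg ((\<lambda>j. \<iota> (vec j)) ` {j \<in> K_set. lev j < n})"

lemma low_vec: "j \<in> K_set \<Longrightarrow> lev j < n \<Longrightarrow> \<iota> (vec j) \<in> low n"
  unfolding low_def by (rule diff_alg.gen) simp

lemma low_x: "0 < n \<Longrightarrow> \<iota> x \<in> low n"
  using low_vec[OF in_K(4), of n] by (simp add: lev_def vec_def x_notin)

lemma low_half: "a \<in> gr (1/2) \<Longrightarrow> 0 < n \<Longrightarrow> \<iota> a \<in> low n"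
proof -
  assume a: "a \<in> gr (1/2)" "0 < n"
  have "a \<in> span (v ` J)" using a(1) basis_v unfolding is_basis_def by simp
  moreover have "\<iota> b \<in> low n" if b: "b \<in> v ` J" for b
  proof -
    obtain k where "k \<in> J" "b = v k" using b by blast
    then show ?thesis using low_vec[OF in_K(5), of k n] a(2) by (simp add: lev_def vec_def v_notin)
  qed
  ultimately show ?thesis unfolding low_def by (rule span_\<iota>[rotated])
qed

lemma low_0: "a \<in> gr 0 \<Longrightarrow> 1 < n \<Longrightarrow> \<iota> a \<in> low n"
proof -
  assume a: "a \<in> gr 0" "1 < n"
  let ?a = "a - scale (\<kappa> x a / \<kappa> x x) x"
  have "?a \<in> gr 0" by (intro gr_diff gr_scale a x_gr)
  moreover have "?a \<in> perp"
    using form_x_x_nz gr_orth[OF e_gr a(1)] gr_orth[OF f_gr a(1)]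
    by (simp add: perp_def form_diff form_scale form_triple)
  ultimately have "?a \<in> span A" by (simp add: A_facts centralizer_eq)
  moreover have "\<iota> b \<in> low n" if "b \<in> A" for b
    using low_vec[OF in_K(2)[OF that], of n] a(2) that by (simp add: lev_def vec_def)
  ultimately have "\<iota> ?a \<in> low n" unfolding low_def by (rule span_\<iota>[rotated])
  moreover have "dconst (\<kappa> x a / \<kappa> x x) * \<iota> x \<in> low n"
    using low_x[of n] a(2) unfolding low_def by (intro diff_alg.mult diff_alg.const) simp
  ultimately have "\<iota> ?a + dconst (\<kappa> x a / \<kappa> x x) * \<iota> x \<in> low n"
    unfolding low_def by (rule diff_alg.add)
  then show ?thesis by (simp add: \<iota>_diff \<iota>_scale)
qed

lemma low_neg_half: "a \<in> gr (-(1/2)) \<Longrightarrow> 2 < n \<Longrightarrow> \<iota> a \<in> low n"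
proof -
  assume a: "a \<in> gr (-(1/2))" "2 < n"
  have "a \<in> span U" using a(1) by (simp add: U_facts)
  moreover have "\<iota> b \<in> low n" if "b \<in> U" for b
    using low_vec[OF in_K(3)[OF that], of n] a(2) by (simp add: lev_def vec_def)
  ultimately show ?thesis unfolding low_def by (rule span_\<iota>[rotated])
qed

lemma low_closed: "p \<in> low n \<Longrightarrow> q \<in> low n \<Longrightarrow> p + q \<in> low n" "p \<in> low n \<Longrightarrow> q \<in> low n \<Longrightarrow> p * q \<in> low n"
    "p \<in> low n \<Longrightarrow> dD p \<in> low n" "p \<in> low n \<Longrightarrow> dscale r p \<in> low n"
    "(\<And>i. i \<in> S \<Longrightarrow> F i \<in> low n) \<Longrightarrow> (\<Sum>i\<in>S. F i) \<in> low n"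
  unfolding low_def by (auto intro: diff_alg.intros diff_alg_dscale diff_alg_sum)

lemma gens_low: "j \<in> K_set \<Longrightarrow> gens j - \<iota> (vec j) \<in> low (lev j)"
proof (erule K_cases)
  have 0: "0 \<in> low n" for n using diff_alg.const[of 0] by (simp add: low_def)
  show "gens j - \<iota> (vec j) \<in> low (lev j)" if j: "j = Gen_L"
  proof -
    have "gens j - \<iota> (vec j) = dD (\<iota> x) + dscale (1/2) (\<Sum>j\<in>J0. \<iota> (c j) * \<iota> (c' j))
       + (\<Sum>k\<in>J. \<iota> (v' k) * \<iota> (lb f (v k))) + dscale (1/2) (\<Sum>k\<in>J. \<iota> (v' k) * dD (\<iota> (v k)))"
      by (simp add: j gens_def I_set_def vec_def W_L_def)
    also have "\<dots> \<in> low 3"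
      by (intro low_closed low_x low_0 low_half low_neg_half c_gr v_gr lb_gr(6)) simp_all
    finally show ?thesis by (simp add: j lev_def)
  qed
  show "gens j - \<iota> (vec j) \<in> low (lev j)" if a: "a \<in> A" "j = Gen_phi a" for a
  proof -
    have "a \<in> gr 0" using A_in[OF a(1)] by (simp add: centralizer_eq)
    moreover have "gens j - \<iota> (vec j) = dscale (1/2) (\<Sum>k\<in>J. \<iota> (lb a (v k)) * \<iota> (v' k))"
      using a by (simp add: gens_def I_set_def vec_def W_phi_def)
    moreover have "lev j = 1" using a by (simp add: lev_def)
    ultimately show ?thesis by (simp only:) (intro low_closed low_half v_gr lb_gr(1), simp_all)
  qed
  show "gens j - \<iota> (vec j) \<in> low (lev j)" if u: "u \<in> U" "j = Gen_psi u" for u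
  proof -
    have "u \<in> gr (-(1/2))" by (rule U_in[OF u(1)])
    moreover have "gens j - \<iota> (vec j) = dscale (1/3) (\<Sum>h\<in>J. \<Sum>k\<in>J. \<iota> (lb (lb u (v h)) (v k)) * \<iota> (v' h) * \<iota> (v' k))
       + (\<Sum>k\<in>J. \<iota> (lb u (v k)) * \<iota> (v' k)) + dD (\<iota> (lb e u))"
      using u by (simp add: gens_def I_set_def vec_def W_psi_def)
    moreover have "lev j = 2" using u by (simp add: lev_def)
    ultimately show ?thesis
      by (simp only:) (simp add: low_closed low_half low_0 v_gr lb_gr)
  qed
  show "gens j - \<iota> (vec j) \<in> low (lev j)" if "j = Gen_phi x"
    using that notin_I(1) in_K(4) 0 by (simp add: gens_def)
  show "gens j - \<iota> (vec j) \<in> low (lev j)" if "k \<in> J" "j = Gen_phi (v k)" for k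
    using that notin_I(2)[OF that(1)] in_K(5)[OF that(1)] 0 by (simp add: gens_def)
qed

lemma gens_diff_polys: "diff_polys_in V K_set gens"
proof (rule diff_polys_in_triangular[OF base_diff_polys])
  show "gens j - \<iota> (vec j) \<in> diff_alg ((\<lambda>j. \<iota> (vec j)) ` {i \<in> K_set. lev i < lev j})" if "j \<in> K_set" for j
    using gens_low[OF that] by (simp add: low_def)
  show "lev j < 4" for j by (simp add: lev_def split: gen_index.split)
qed

section \<open>Elimination of x and of degree 1/2\<close>

lemma gens_independent: "dvars P \<subseteq> K_set \<times> UNIV \<Longrightarrow> diff_hom gens P = 0 \<Longrightarrow> P = 0"
  using gens_diff_polys unfolding diff_polys_in_def by blast

lemma gens_V: "gens j \<in> V"
proof (cases "j \<in> K_set")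
  case True
  then have "gens j \<in> diff_alg (gens ` K_set)" by (intro diff_alg.gen) simp
  then show ?thesis using gens_diff_polys by (simp add: diff_polys_in_def)
next
  case False
  then show ?thesis using V_closed(3)[of 0] by (simp add: gens_def K_set_def)
qed

lemma diff_hom_gens_V: "diff_hom gens P \<in> V"
proof -
  have "diff_hom gens P \<in> diff_alg (gens ` UNIV)" by (rule diff_hom_in_diff_alg) simp
  also have "\<dots> \<subseteq> V" unfolding V_eq by (rule diff_alg_subset) (use gens_V V_eq in blast)
  finally show ?thesis .
qed

lemma gens_kill: "j \<in> I_set \<Longrightarrow> kill (gens j)"
  by (auto simp: I_set_def gens_def kill_L intro: kill_phi[OF A_in] kill_psi[OF U_in])

text \<open>\<open>Dop a\<close> composed with \<open>diff_hom gens\<close> is a derivation into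
  V[\<lambda>], and a derivative of a variable becomes a power of
  \<open>\<lambda> + \<partial>\<close> applied to its value.\<close>

lemma chain_rule:
  "Dop a (diff_hom gens P) = (\<Sum>w\<in>dvars P. [:diff_hom gens (dpartial w P):] * (lamD ^^ snd w) (Dop a (gens (fst w))))"
proof -
  have "Dop a (diff_hom gens P) = (\<Sum>w\<in>dvars P. [:diff_hom gens (dpartial w P):] * Dop a (diff_hom gens (dvar w)))"
    by (rule derivation_expand[where \<theta> = "\<lambda>p. [:diff_hom gens p:]" and \<delta> = "\<lambda>p. Dop a (diff_hom gens p)"])
      (simp_all add: diff_hom_add diff_hom_mult Dop_add Dop_mult diff_hom_gens_V add.commute)
  moreover have "Dop a (diff_hom gens (dvar w)) = (lamD ^^ snd w) (Dop a (gens (fst w)))" for w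
    by (cases w) (simp add: Dop_dD_pow)
  ultimately show ?thesis by simp
qed

text \<open>A power of \<open>\<lambda> + \<partial>\<close> sends the constant \<open>r\<close> to
  \<open>r \<lambda>^n\<close>. In the chain rule the coefficient of \<open>\<lambda>^n\<close> is
  thus \<open>r\<close> times the image of the partial derivative by \<open>(j, n)\<close> alone,
  and independence of the \<open>gens\<close> makes that derivative zero.\<close>

lemma eliminate_variable:
  assumes P: "dvars P \<subseteq> K_set \<times> UNIV" and 0: "Dop a (diff_hom gens P) = 0"
    and j: "Dop a (gens j) = [:dconst r:]" "r \<noteq> 0"
    and others: "\<And>i n. (i, n) \<in> dvars P \<Longrightarrow> i \<noteq> j \<Longrightarrow> Dop a (gens i) = 0"
  shows "(j, n) \<notin> dvars P"
proof
  assume jn: "(j, n) \<in> dvars P"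
  have lam0: "(lamD ^^ m) 0 = 0" for m by (induction m) auto
  have trm: "coeff ([:diff_hom gens (dpartial w P):] * (lamD ^^ snd w) (Dop a (gens (fst w)))) n =
      (if w = (j, n) then diff_hom gens (dpartial (j, n) P) * dconst r else 0)" if w: "w \<in> dvars P" for w
  proof (cases "fst w = j")
    case True
    then show ?thesis by (cases w) (auto simp: j(1) lamD_pow_const)
  next
    case False
    then have "Dop a (gens (fst w)) = 0" using others[of "fst w" "snd w"] w by simp
    with False show ?thesis by (auto simp: lam0)
  qed
  have "0 = coeff (Dop a (diff_hom gens P)) n" by (simp add: 0)
  also have "\<dots> = (\<Sum>w\<in>dvars P. if w = (j, n) then diff_hom gens (dpartial (j, n) P) * dconst r else 0)"
    unfolding chain_rule coeff_sum by (intro sum.cong refl trm)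
  also have "\<dots> = diff_hom gens (dpartial (j, n) P) * dconst r"
    using jn by (simp add: finite_dvars)
  finally have "diff_hom gens (dpartial (j, n) P) * dconst r * dconst (1 / r) = 0" by simp
  then have "diff_hom gens (dpartial (j, n) P) = 0"
    using j(2) by (simp add: mult.assoc flip: dconst_mult)
  then have "dpartial (j, n) P = 0"
    using dvars_dpartial[of "(j, n)" P] P by (intro gens_independent) auto
  with jn show False by (simp add: dpartial_eq_0_iff)
qed

lemma kill_imp_generated:
  assumes g: "g \<in> V" "kill g"
  obtains P where "dvars P \<subseteq> I_set \<times> UNIV" "g = diff_hom gens P"
proof -
  have "g \<in> diff_alg (gens ` K_set)" using g(1) gens_diff_polys by (simp add: diff_polys_in_def)
  then obtain P where P: "dvars P \<subseteq> K_set \<times> UNIV" "g = diff_hom gens P" by (rule diff_algE)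
  have gx: "gens (Gen_phi x) = \<iota> x" using notin_I(1) in_K(4) by (simp add: gens_def vec_def)
  have gv: "gens (Gen_phi (v k)) = \<iota> (v k)" if "k \<in> J" for k
    using notin_I(2)[OF that] in_K(5)[OF that] by (simp add: gens_def vec_def)
  \<comment> \<open>\<open>x\<close> is the only variable moved by \<open>Dop e\<close>, since the
    generators and the basis of degree 1/2 are killed.\<close>
  have x: "(Gen_phi x, n) \<notin> dvars P" for n
  proof (rule eliminate_variable[OF P(1), of e])
    show "Dop e (diff_hom gens P) = 0" using g(2) P(2) by (simp add: kill_def)
    show "Dop e (gens (Gen_phi x)) = [:dconst (- 2 * \<kappa> x x):]" by (simp only: gx Dop_e(2)[OF x_gr])
    show "- 2 * \<kappa> x x \<noteq> 0" using form_x_x_nz by simp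
    fix i m assume i: "(i, m) \<in> dvars P" "i \<noteq> Gen_phi x"
    then have "i \<in> K_set" using P(1) by auto
    then consider "i \<in> I_set" | k where "k \<in> J" "i = Gen_phi (v k)"
      using i(2) unfolding K_set_def X_set_def by blast
    then show "Dop e (gens i) = 0"
    proof cases
      case 1
      then show ?thesis using gens_kill by (simp add: kill_def)
    next
      case 2
      then show ?thesis by (simp add: gv Dop_e(1) v_gr)
    qed
  qed
  \<comment> \<open>By duality \<open>v' k\<close> moves only \<open>v k\<close> among the basis of
    degree 1/2. It also moves \<open>x\<close>, with a nonconstant value, so the absence of
    \<open>x\<close> is used here.\<close>
  have v: "(Gen_phi (v k), n) \<notin> dvars P" if k: "k \<in> J" for k n
  proof (rule eliminate_variable[OF P(1), of "v' k"])
    note w = v_gr(2)[OF k]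
    have \<omega>v: "\<omega> (v' k) (v h) = (if h = k then - 1 else 0)" if "h \<in> J" for h
      using \<omega>_anti[of "v' k" "v h"] dual_v[OF that k] by simp
    show "Dop (v' k) (diff_hom gens P) = 0" using g(2) P(2) w by (simp add: kill_def)
    show "Dop (v' k) (gens (Gen_phi (v k))) = [:dconst (- 1):]"
      using Dop_half(1)[OF w v_gr(1)[OF k]] by (simp add: gv k \<omega>v)
    show "- 1 \<noteq> (0 :: 'k)" by simp
    fix i m assume i: "(i, m) \<in> dvars P" "i \<noteq> Gen_phi (v k)"
    then have "i \<in> K_set" "i \<noteq> Gen_phi x" using P(1) x by auto
    then consider "i \<in> I_set" | h where "h \<in> J" "i = Gen_phi (v h)"
      unfolding K_set_def X_set_def by blast
    then show "Dop (v' k) (gens i) = 0"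
    proof cases
      case 1
      then show ?thesis using gens_kill w by (simp add: kill_def)
    next
      case 2
      then show ?thesis using i(2) Dop_half(1)[OF w v_gr(1)[OF 2(1)]] by (auto simp: gv \<omega>v)
    qed
  qed
  have "dvars P \<subseteq> I_set \<times> UNIV"
  proof
    fix w assume w: "w \<in> dvars P"
    obtain i n where in': "w = (i, n)" by (cases w)
    then have "i \<in> K_set" using w P(1) by auto
    then have "i \<in> I_set" using w x v unfolding in' K_set_def X_set_def by blast
    then show "w \<in> I_set \<times> UNIV" by (simp add: in')
  qed
  then show thesis using P(2) by (rule that)
qed

lemma generated_imp_kill: "g \<in> diff_alg (gens ` I_set) \<Longrightarrow> g \<in> V \<and> kill g"
proof (induction rule: diff_alg.induct)
  case (gen g)
  then show ?case using gens_V gens_kill by auto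
next
  case (const r)
  show ?case by (simp add: V_closed kill_def)
next
  case (add p q)
  then show ?case by (simp add: V_closed kill_def Dop_add)
next
  case (mult p q)
  then show ?case by (simp add: V_closed kill_def Dop_mult)
next
  case (deriv p)
  then show ?case by (simp add: V_closed kill_def Dop_dD)
qed

lemma W_diff_polys: "diff_polys_in (W_alg scale lb \<kappa> bas x f br) I_set (W_gens L \<phi> \<psi>)"
  unfolding diff_polys_in_def
proof (intro conjI allI impI)
  have eq: "gens j = W_gens L \<phi> \<psi> j" if "j \<in> I_set" for j using that by (simp add: gens_def)
  then have im: "W_gens L \<phi> \<psi> ` I_set = gens ` I_set" by (simp cong: image_cong)
  show "W_alg scale lb \<kappa> bas x f br = diff_alg (W_gens L \<phi> \<psi> ` I_set)"
    unfolding W_alg_eq im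
  proof (intro equalityI subsetI)
    fix g assume "g \<in> {g \<in> V. kill g}"
    then have "g \<in> V" "kill g" by simp_all
    then obtain P where "dvars P \<subseteq> I_set \<times> UNIV" "g = diff_hom gens P" by (rule kill_imp_generated)
    then show "g \<in> diff_alg (gens ` I_set)" by (simp add: diff_hom_in_diff_alg)
  qed (use generated_imp_kill in blast)
  fix P :: "('g gen_index, 'k) dpoly"
  assume P: "dvars P \<subseteq> I_set \<times> UNIV \<and> diff_hom (W_gens L \<phi> \<psi>) P = 0"
  then have "diff_hom gens P = 0" using diff_hom_cong[of P I_set gens "W_gens L \<phi> \<psi>", OF _ eq] by simp
  then show "P = 0" using P by (intro gens_independent) (auto simp: K_set_def)
qed

end

end

section \<open>Conformal weights\<close>

lemma vector_space_dscale: "vector_space (dscale :: 'k::field \<Rightarrow> ('i, 'k) dpoly \<Rightarrow> ('i, 'k) dpoly)"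
  by unfold_locales (simp_all add: dscale_def dconst_add dconst_mult algebra_simps)

lemma lookup_dconst_mult: "Poly_Mapping.lookup (dconst r * p) m = r * Poly_Mapping.lookup p m"
  by (induction p rule: poly_mapping_add_induct)
    (auto simp: distrib_left lookup_add dconst_def mult_single lookup_single when_def)

lemma dconst_eq_0_iff: "dconst r = 0 \<longleftrightarrow> r = 0"
  unfolding dconst_def by (metis lookup_single_eq lookup_zero single_zero)

context minimal_W
begin

text \<open>The Euler derivation, whose eigenvalue on a monomial is its conformal weight.\<close>

definition euler :: "('i, 'k) dpoly \<Rightarrow> ('i, 'k) dpoly" where
  "euler = deriv_ext (\<lambda>(i, n). (dD ^^ n) (\<iota> (bas i - lb x (bas i))) + dconst (of_nat n) * dvar (i, n))"

lemma euler_add: "euler (p + q) = euler p + euler q"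
  and euler_mult: "euler (p * q) = euler p * q + p * euler q"
  and euler_const [simp]: "euler (dconst r) = 0"
  by (simp_all add: euler_def deriv_ext_add deriv_ext_mult)

lemma euler_0 [simp]: "euler 0 = 0"
  using euler_const[of 0] by simp

lemma euler_scale: "euler (dconst r * p) = dconst r * euler p"
  by (simp add: euler_mult)

lemma euler_dD: "euler (dD p) = dD (euler p) + dD p"
proof (induction p rule: dpoly_induct)
  case (var w)
  obtain i n where w: "w = (i, n)" by (cases w)
  show ?case
    by (simp add: w dD_var euler_def dD_add dD_scale dconst_add distrib_right)
qed (simp_all add: euler_add euler_mult dD_add dD_mult algebra_simps)

lemma euler_\<iota>: "euler (\<iota> a) = \<iota> (a - lb x a)"
proof -
  have s: "euler (\<Sum>i\<in>S. F i) = (\<Sum>i\<in>S. euler (F i))" for S :: "'i set" and F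
    by (induction S rule: infinite_finite_induct) (auto simp: euler_add)
  have "euler (\<iota> a) = (\<Sum>i\<in>UNIV. dconst (representation (range bas) a (bas i)) * \<iota> (bas i - lb x (bas i)))"
    unfolding emb_def[of scale bas a] s euler_scale by (simp add: euler_def)
  also have "\<dots> = \<iota> ((\<Sum>i\<in>UNIV. scale (representation (range bas) a (bas i)) (bas i))
      - lb x (\<Sum>i\<in>UNIV. scale (representation (range bas) a (bas i)) (bas i)))"
    by (simp add: \<iota>_diff \<iota>_sum \<iota>_scale lb_sum lb_scale_right sum_subtractf right_diff_distrib)
  finally show ?thesis by (simp only: crd_sum[OF vector_space_axioms bas])
qed

text \<open>An eigenvalue equation passes through polynomial expressions without exhibiting
  monomials. Every element of \<open>weight_space\<close> is shown to satisfy it, and that inclusion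
  suffices to bound W from above.\<close>

definition homog :: "rat \<Rightarrow> ('i, 'k) dpoly \<Rightarrow> bool" where
  "homog \<Delta> p \<longleftrightarrow> euler p = dconst (of_rat \<Delta>) * p"

lemma homog_add: "homog \<Delta> p \<Longrightarrow> homog \<Delta> q \<Longrightarrow> homog \<Delta> (p + q)"
  by (simp add: homog_def euler_add distrib_left)

lemma homog_0: "homog \<Delta> 0"
  using euler_const[of 0] by (simp add: homog_def)

lemma homog_dscale: "homog \<Delta> p \<Longrightarrow> homog \<Delta> (dscale r p)"
  by (simp add: homog_def dscale_def euler_scale mult.left_commute)

lemma homog_mult: "homog \<Delta> p \<Longrightarrow> homog \<Delta>' q \<Longrightarrow> \<Delta>'' = \<Delta> + \<Delta>' \<Longrightarrow> homog \<Delta>'' (p * q)"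
  by (simp add: homog_def euler_mult of_rat_add dconst_add algebra_simps)

lemma homog_sum: "(\<And>i. i \<in> S \<Longrightarrow> homog \<Delta> (F i)) \<Longrightarrow> homog \<Delta> (\<Sum>i\<in>S. F i)"
  by (induction S rule: infinite_finite_induct) (simp_all add: homog_0 homog_add)

lemma homog_dD: "homog \<Delta> p \<Longrightarrow> \<Delta>' = \<Delta> + 1 \<Longrightarrow> homog \<Delta>' (dD p)"
  by (simp add: homog_def euler_dD dD_scale of_rat_add dconst_add distrib_right)

lemma homog_dD_pow: "homog \<Delta> p \<Longrightarrow> homog (\<Delta> + of_nat n) ((dD ^^ n) p)"
  by (induction n) (auto intro!: homog_dD)

lemma homog_\<iota>: "a \<in> gr i \<Longrightarrow> \<Delta> = 1 - i \<Longrightarrow> homog \<Delta> (\<iota> a)"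
proof -
  assume a: "a \<in> gr i" "\<Delta> = 1 - i"
  have "a - lb x a = scale (of_rat \<Delta>) a"
    using a by (simp add: in_gr of_rat_diff scale_left_diff_distrib)
  then show ?thesis by (simp add: homog_def euler_\<iota> \<iota>_scale)
qed

section \<open>Weight spaces and the weights of the generators\<close>

definition weight_mons :: "rat \<Rightarrow> ('i, 'k) dpoly set" where
  "weight_mons \<Delta> = {\<Prod>j<r. (dD ^^ m j) (emb scale bas (b j)) | (r::nat) b (m::nat \<Rightarrow> nat) \<delta>.
        (\<forall>j<r. 1 - \<delta> j \<in> half_ints \<and> 1 - \<delta> j \<le> 1/2 \<and> b j \<in> grade scale lb x (1 - \<delta> j)) \<and>
        (\<Sum>j<r. \<delta> j + of_nat (m j)) = \<Delta>}"

lemma weight_space_eq: "weight_space scale lb bas x \<Delta> = module.span dscale (weight_mons \<Delta>)"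
  by (simp add: weight_space_def weight_mons_def)

lemma weight_mons_homog: "p \<in> weight_mons \<Delta> \<Longrightarrow> homog \<Delta> p"
proof -
  assume "p \<in> weight_mons \<Delta>"
  then obtain r b m \<delta> where p: "p = (\<Prod>j<r. (dD ^^ m j) (\<iota> (b j)))"
    and b: "\<forall>j<(r::nat). 1 - \<delta> j \<in> half_ints \<and> 1 - \<delta> j \<le> 1/2 \<and> b j \<in> gr (1 - \<delta> j)"
    and \<Delta>: "(\<Sum>j<r. \<delta> j + of_nat (m j)) = \<Delta>"
    unfolding weight_mons_def by blast
  have "homog (\<Sum>j<s. \<delta> j + of_nat (m j)) (\<Prod>j<s. (dD ^^ m j) (\<iota> (b j)))" if "s \<le> r" for s
    using that
  proof (induction s)
    case 0
    show ?case using euler_const[of 1] by (simp add: homog_def)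
  next
    case (Suc s)
    have "homog (\<delta> s) (\<iota> (b s))" using b Suc(2) by (intro homog_\<iota>[of _ "1 - \<delta> s"]) auto
    then have "homog (\<delta> s + of_nat (m s)) ((dD ^^ m s) (\<iota> (b s)))" by (rule homog_dD_pow)
    with Suc show ?case unfolding prod.lessThan_Suc by (intro homog_mult) auto
  qed
  from this[OF order_refl] show ?thesis by (simp only: p \<Delta>)
qed

interpretation dp: vector_space "dscale :: 'k \<Rightarrow> ('i, 'k) dpoly \<Rightarrow> ('i, 'k) dpoly"
  by (rule vector_space_dscale)

lemma weight_space_homog: "p \<in> weight_space scale lb bas x \<Delta> \<Longrightarrow> homog \<Delta> p"
proof -
  have "dp.subspace {p. homog \<Delta> p}"
    by (rule dp.subspaceI) (simp_all add: homog_0 homog_add homog_dscale)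
  then have "weight_space scale lb bas x \<Delta> \<subseteq> {p. homog \<Delta> p}"
    unfolding weight_space_eq using weight_mons_homog by (intro dp.span_minimal) auto
  then show "p \<in> weight_space scale lb bas x \<Delta> \<Longrightarrow> homog \<Delta> p" by blast
qed

lemma weight_mons_one: "1 \<in> weight_mons 0"
  unfolding weight_mons_def by (rule CollectI, rule exI[of _ 0]) simp

lemma weight_mons_mult:
  assumes p: "p \<in> weight_mons \<Delta>" and i: "i \<in> half_ints" "i \<le> 1/2" and a: "a \<in> gr i"
    and \<Delta>': "\<Delta>' = \<Delta> + (1 - i) + of_nat n"
  shows "p * (dD ^^ n) (\<iota> a) \<in> weight_mons \<Delta>'"
proof -
  obtain r b m \<delta> where p: "p = (\<Prod>j<r. (dD ^^ m j) (\<iota> (b j)))"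
    and b: "\<forall>j<(r::nat). 1 - \<delta> j \<in> half_ints \<and> 1 - \<delta> j \<le> 1/2 \<and> b j \<in> gr (1 - \<delta> j)"
    and \<Delta>: "(\<Sum>j<r. \<delta> j + of_nat (m j)) = \<Delta>"
    using p unfolding weight_mons_def by blast
  have "p * (dD ^^ n) (\<iota> a) = (\<Prod>j<Suc r. (dD ^^ (m(r := n)) j) (\<iota> ((b(r := a)) j)))"
    by (simp add: p)
  moreover have "\<forall>j<Suc r. 1 - (\<delta>(r := 1 - i)) j \<in> half_ints \<and> 1 - (\<delta>(r := 1 - i)) j \<le> 1/2
      \<and> (b(r := a)) j \<in> gr (1 - (\<delta>(r := 1 - i)) j)"
    using b i a by (simp add: less_Suc_eq)
  moreover have "(\<Sum>j<Suc r. (\<delta>(r := 1 - i)) j + of_nat ((m(r := n)) j)) = \<Delta>'"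
    by (simp add: \<Delta>' \<Delta>)
  ultimately show ?thesis unfolding weight_mons_def by blast
qed

lemma weight_mons_\<iota>:
  assumes "a \<in> gr i" "i \<in> half_ints" "i \<le> 1/2"
  shows "\<Delta> = 1 - i \<Longrightarrow> \<iota> a \<in> weight_mons \<Delta>"
    and "\<Delta> = 2 - i \<Longrightarrow> dD (\<iota> a) \<in> weight_mons \<Delta>"
    and "p \<in> weight_mons \<Delta>' \<Longrightarrow> \<Delta> = \<Delta>' + (1 - i) \<Longrightarrow> p * \<iota> a \<in> weight_mons \<Delta>"
  using weight_mons_mult[OF weight_mons_one assms(2,3,1), of \<Delta> 0]
    weight_mons_mult[OF weight_mons_one assms(2,3,1), of \<Delta> 1]
    weight_mons_mult[OF _ assms(2,3,1), of p \<Delta>' \<Delta> 0] by simp_all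

lemma weight_space_closed:
  "p \<in> weight_mons \<Delta> \<Longrightarrow> p \<in> weight_space scale lb bas x \<Delta>"
  "p \<in> weight_space scale lb bas x \<Delta> \<Longrightarrow> q \<in> weight_space scale lb bas x \<Delta> \<Longrightarrow> p + q \<in> weight_space scale lb bas x \<Delta>"
  "p \<in> weight_space scale lb bas x \<Delta> \<Longrightarrow> dscale r p \<in> weight_space scale lb bas x \<Delta>"
  "(\<And>i. i \<in> S \<Longrightarrow> F i \<in> weight_space scale lb bas x \<Delta>) \<Longrightarrow> (\<Sum>i\<in>S. F i) \<in> weight_space scale lb bas x \<Delta>"
  unfolding weight_space_eq by (auto intro: dp.span_base dp.span_add dp.span_scale dp.span_sum)

lemma phi_weight:
  assumes a: "a \<in> gr 0"
  shows "\<phi> a \<in> weight_space scale lb bas x 1"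
proof -
  note h = half_ints(4)
  have 1: "\<iota> a \<in> weight_space scale lb bas x 1"
    by (rule weight_space_closed(1)[OF weight_mons_\<iota>(1)[OF a half_ints(1)]]) simp_all
  have 2: "\<iota> (lb a (v k)) * \<iota> (v' k) \<in> weight_space scale lb bas x 1" if k: "k \<in> J" for k
  proof -
    have "\<iota> (lb a (v k)) \<in> weight_mons (1/2)"
      by (rule weight_mons_\<iota>(1)[OF lb_gr(1)[OF a v_gr(1)[OF k]] h]) simp_all
    then show ?thesis
      by (intro weight_space_closed(1), elim weight_mons_\<iota>(3)[OF v_gr(2)[OF k] h order_refl]) simp
  qed
  show ?thesis unfolding W_phi_def by (intro weight_space_closed(2-4) 1 2)
qed

lemma psi_weight:
  assumes u: "u \<in> gr (-(1/2))"
  shows "\<psi> u \<in> weight_space scale lb bas x (3/2)"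
proof -
  note h = half_ints(4)
  have 1: "\<iota> u \<in> weight_space scale lb bas x (3/2)"
    by (rule weight_space_closed(1)[OF weight_mons_\<iota>(1)[OF u half_ints(5)]]) simp_all
  have 2: "dD (\<iota> (lb e u)) \<in> weight_space scale lb bas x (3/2)"
    by (rule weight_space_closed(1)[OF weight_mons_\<iota>(2)[OF lb_gr(5)[OF u] h]]) simp_all
  have 3: "\<iota> (lb u (v k)) * \<iota> (v' k) \<in> weight_space scale lb bas x (3/2)" if k: "k \<in> J" for k
  proof -
    have "\<iota> (lb u (v k)) \<in> weight_mons 1"
      by (rule weight_mons_\<iota>(1)[OF lb_gr(3)[OF u v_gr(1)[OF k]] half_ints(1)]) simp_all
    then show ?thesis
      by (intro weight_space_closed(1), elim weight_mons_\<iota>(3)[OF v_gr(2)[OF k] h order_refl]) simp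
  qed
  have 4: "\<iota> (lb (lb u (v i)) (v k)) * \<iota> (v' i) * \<iota> (v' k) \<in> weight_space scale lb bas x (3/2)"
    if i: "i \<in> J" and k: "k \<in> J" for i k
  proof -
    have "\<iota> (lb (lb u (v i)) (v k)) \<in> weight_mons (1/2)"
      by (rule weight_mons_\<iota>(1)[OF lb_gr(1)[OF lb_gr(3)[OF u v_gr(1)[OF i]] v_gr(1)[OF k]] h]) simp_all
    then have "\<iota> (lb (lb u (v i)) (v k)) * \<iota> (v' i) \<in> weight_mons 1"
      by (rule weight_mons_\<iota>(3)[OF v_gr(2)[OF i] h order_refl]) simp
    then show ?thesis
      by (intro weight_space_closed(1), elim weight_mons_\<iota>(3)[OF v_gr(2)[OF k] h order_refl]) simp
  qed
  show ?thesis unfolding W_psi_def by (intro weight_space_closed(2-4) 1 2 3 4)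
qed

text \<open>\<open>L\<close> enters the weight count only through the eigenvalue 2, which keeps it
  out of weights 1 and 3/2.\<close>

lemma L_homog: "homog 2 L"
proof -
  have d: "homog 2 (dD (\<iota> x))" by (rule homog_dD[OF homog_\<iota>[OF x_gr refl]]) simp
  have f: "homog 2 (\<iota> f)" by (rule homog_\<iota>[OF f_gr]) simp
  have 1: "homog 2 (\<iota> (c j) * \<iota> (c' j))" if "j \<in> J0" for j
    by (rule homog_mult[OF homog_\<iota>[OF c_gr(1)[OF that] refl] homog_\<iota>[OF c_gr(2)[OF that] refl]]) simp
  have 2: "homog 2 (\<iota> (v' k) * \<iota> (lb f (v k)))" if "k \<in> J" for k
    by (rule homog_mult[OF homog_\<iota>[OF v_gr(2)[OF that] refl] homog_\<iota>[OF lb_gr(6)[OF v_gr(1)[OF that]] refl]]) simp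
  have 3: "homog 2 (\<iota> (v' k) * dD (\<iota> (v k)))" if "k \<in> J" for k
    by (rule homog_mult[OF homog_\<iota>[OF v_gr(2)[OF that] refl] homog_dD[OF homog_\<iota>[OF v_gr(1)[OF that] refl] refl]]) simp
  show ?thesis
    unfolding W_L_def by (intro homog_add homog_dscale homog_sum d f 1 2 3)
qed

lemma linear_phi: "Vector_Spaces.linear scale dscale \<phi>"
  unfolding Vector_Spaces.linear_iff
  by (intro conjI vector_space_axioms vector_space_dscale)
    (simp_all add: W_phi_def dscale_def lb_add_left lb_scale_left \<iota>_add \<iota>_scale
        distrib_right distrib_left sum.distrib sum_distrib_left mult_ac add_ac)

lemma linear_psi: "Vector_Spaces.linear scale dscale \<psi>"
  unfolding Vector_Spaces.linear_iff
  by (intro conjI vector_space_axioms vector_space_dscale)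
    (simp_all add: W_psi_def dscale_def lb_add_left lb_scale_left lb_add_right lb_scale_right
        \<iota>_add \<iota>_scale dD_add dD_scale distrib_right distrib_left sum.distrib sum_distrib_left mult_ac add_ac)

lemma linear_combination:
  assumes lin: "Vector_Spaces.linear scale dscale F" and b: "\<And>i. i \<in> S \<Longrightarrow> b i \<in> W" and W: "subspace W"
  shows "(\<Sum>i\<in>S. dconst (r i) * F (b i)) \<in> F ` W"
proof -
  interpret F: Vector_Spaces.linear scale dscale F by (rule lin)
  have "(\<Sum>i\<in>S. dconst (r i) * F (b i)) = F (\<Sum>i\<in>S. scale (r i) (b i))"
    by (simp add: F.sum F.scale dscale_def)
  moreover have "(\<Sum>i\<in>S. scale (r i) (b i)) \<in> W"
    using b W by (intro subspace_sum subspace_scale)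
  ultimately show ?thesis by blast
qed

lemma subspace_g0f: "subspace g0f"
  unfolding centralizer_eq
  by (rule subspaceI) (simp_all add: gr_add gr_scale perp_add perp_scale, simp add: perp_def)

section \<open>Elements of weight below 2\<close>

context
  fixes A U :: "'g set"
  assumes basis_A: "is_basis scale A id g0f" and basis_U: "is_basis scale U id (gr (-(1/2)))"
begin

abbreviation "I_AU \<equiv> {Gen_L} \<union> Gen_phi ` A \<union> Gen_psi ` U"

definition "gen_weight w = (case w of (j, n) \<Rightarrow>
  (case j of Gen_L \<Rightarrow> 2 | Gen_phi a \<Rightarrow> 1 | Gen_psi u \<Rightarrow> 3/2) + (of_nat n :: rat))"

lemma gen_weight_ge_1: "1 \<le> gen_weight w"
  by (auto simp: gen_weight_def split: prod.split gen_index.split)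

lemma A_gr: "a \<in> A \<Longrightarrow> a \<in> gr 0"
  using basis_in[OF basis_A] by (simp add: centralizer_eq)

lemma U_gr: "u \<in> U \<Longrightarrow> u \<in> gr (-(1/2))"
  using basis_in[OF basis_U] by simp

lemma W_structure: "diff_polys_in (W_alg scale lb \<kappa> bas x f br) I_AU (W_gens L \<phi> \<psi>)"
  using W_diff_polys[OF basis_A basis_U] by (simp add: I_set_def[OF basis_A basis_U])

lemma W_independent: "dvars P \<subseteq> I_AU \<times> UNIV \<Longrightarrow> diff_hom (W_gens L \<phi> \<psi>) P = 0 \<Longrightarrow> P = 0"
  using W_structure unfolding diff_polys_in_def by blast

text \<open>Applying \<open>euler\<close> to an element of weight \<open>\<Delta> < 2\<close> shows that it is a polynomial in the
  generators all of whose monomials have weight \<open>\<Delta>\<close>; these are single generators.\<close>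

lemma weight_less_2:
  assumes g: "g \<in> W_weight scale lb \<kappa> bas x f br \<Delta>" and \<Delta>: "0 < \<Delta>" "\<Delta> < 2"
  shows "\<exists>(M :: ('g gen_index \<times> nat \<Rightarrow>\<^sub>0 nat) set) r j. g = (\<Sum>m\<in>M. dconst (r m) * W_gens L \<phi> \<psi> (j m)) \<and>
    (\<forall>m\<in>M. j m \<in> I_AU \<and> gen_weight (j m, 0) = \<Delta>)"
proof -
  \<comment> \<open>The value 0 off the index set makes every \<open>G j\<close> homogeneous, as
    needed for \<open>E\<close>, which is proved by induction over all polynomials.\<close>
  define G where "G j = (if j \<in> I_AU then W_gens L \<phi> \<psi> j else 0)" for j
  have "g \<in> diff_alg (W_gens L \<phi> \<psi> ` I_AU)"
    using g W_structure by (simp add: W_weight_def diff_polys_in_def)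
  then obtain P where P: "dvars P \<subseteq> I_AU \<times> UNIV" "g = diff_hom (W_gens L \<phi> \<psi>) P" by (rule diff_algE)
  have GP: "diff_hom G Q = diff_hom (W_gens L \<phi> \<psi>) Q" if "dvars Q \<subseteq> I_AU \<times> UNIV" for Q
    by (rule diff_hom_cong[OF that]) (simp add: G_def)
  have Gh: "homog (gen_weight (j, 0)) (G j)" for j
  proof (cases "j \<in> I_AU")
    case True
    then show ?thesis
      using L_homog weight_space_homog[OF phi_weight[OF A_gr]] weight_space_homog[OF psi_weight[OF U_gr]]
      by (auto simp: G_def gen_weight_def)
  qed (simp add: G_def homog_0)
  \<comment> \<open>\<open>diff_hom G\<close> intertwines the two weight operators. The eigenvalue
    equation for \<open>g\<close> thereby becomes a relation among independent generators, hence an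
    equation on the coefficients of \<open>P\<close>.\<close>
  have E: "euler (diff_hom G Q) = diff_hom G (weight_op gen_weight Q)" for Q
  proof (induction Q rule: dpoly_induct)
    case (var w)
    obtain j n where w: "w = (j, n)" by (cases w)
    have "homog (gen_weight (j, 0) + of_nat n) ((dD ^^ n) (G j))" by (rule homog_dD_pow[OF Gh])
    moreover have "gen_weight (j, 0) + of_nat n = gen_weight (j, n)" by (simp add: gen_weight_def)
    ultimately show ?case by (simp add: w weight_op_var homog_def diff_hom_mult)
  qed (simp_all add: euler_add euler_mult weight_op_add weight_op_mult weight_op_const diff_hom_add
      diff_hom_mult algebra_simps)
  have dv: "dvars (weight_op gen_weight P - dconst (of_rat \<Delta>) * P) \<subseteq> I_AU \<times> UNIV"
  proof -
    have "dvars (weight_op gen_weight P - dconst (of_rat \<Delta>) * P) \<subseteq> dvars P"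
      by (auto simp: dvars_def in_keys_iff lookup_minus lookup_weight_op lookup_dconst_mult)
    with P(1) show ?thesis by blast
  qed
  have "homog \<Delta> g" using g by (intro weight_space_homog) (simp add: W_weight_def)
  then have "diff_hom G (weight_op gen_weight P - dconst (of_rat \<Delta>) * P) = 0"
    by (simp add: diff_hom_diff diff_hom_mult homog_def P(2) flip: E GP[OF P(1)])
  then have "weight_op gen_weight P - dconst (of_rat \<Delta>) * P = 0"
    unfolding GP[OF dv] by (rule W_independent[OF dv])
  then have "Poly_Mapping.lookup (weight_op gen_weight P) m = Poly_Mapping.lookup (dconst (of_rat \<Delta>) * P) m" for m
    by simp
  then have wt: "of_rat (mon_weight gen_weight m) * Poly_Mapping.lookup P m = of_rat \<Delta> * Poly_Mapping.lookup P m" for m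
    by (simp add: lookup_weight_op lookup_dconst_mult)
  have "\<exists>j. m = Poly_Mapping.single (j, 0) 1 \<and> j \<in> I_AU \<and> gen_weight (j, 0) = \<Delta>"
    if m: "m \<in> Poly_Mapping.keys P" for m
  proof -
    have "mon_weight gen_weight m = \<Delta>" using wt[of m] m by (simp add: in_keys_iff)
    then obtain w where w: "m = Poly_Mapping.single w 1" "gen_weight w = \<Delta>"
      using mon_weight_less_2[of gen_weight m, OF gen_weight_ge_1] \<Delta> by auto
    obtain j n where jn: "w = (j, n)" by (cases w)
    have "gen_weight (j, 0) + of_nat n = \<Delta>" using w(2) by (simp add: jn gen_weight_def)
    \<comment> \<open>Generators have weight at least 1, so a proper derivative has weight at least
      2; only underived generators remain.\<close>
    then have "(of_nat n :: rat) < 1" using gen_weight_ge_1[of "(j, 0)"] \<Delta>(2) by linarith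
    then have "n = 0" by simp
    moreover have "w \<in> dvars P" using m w(1) unfolding dvars_def by force
    ultimately show ?thesis using w P(1) unfolding jn by blast
  qed
  then obtain j where j: "\<And>m. m \<in> Poly_Mapping.keys P \<Longrightarrow>
      m = Poly_Mapping.single (j m, 0) 1 \<and> j m \<in> I_AU \<and> gen_weight (j m, 0) = \<Delta>" by metis
  have "g = (\<Sum>m\<in>Poly_Mapping.keys P. dconst (Poly_Mapping.lookup P m) *
      dmon (\<lambda>(j, n). (dD ^^ n) (W_gens L \<phi> \<psi> j)) m)"
    by (simp add: P(2) diff_hom_def dsubst_altdef)
  also have "\<dots> = (\<Sum>m\<in>Poly_Mapping.keys P. dconst (Poly_Mapping.lookup P m) * W_gens L \<phi> \<psi> (j m))"
  proof (rule sum.cong[OF refl])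
    fix m assume "m \<in> Poly_Mapping.keys P"
    then have "m = Poly_Mapping.single (j m, 0) 1" using j by blast
    then have "dmon (\<lambda>(j, n). (dD ^^ n) (W_gens L \<phi> \<psi> j)) m =
        dmon (\<lambda>(j, n). (dD ^^ n) (W_gens L \<phi> \<psi> j)) (Poly_Mapping.single (j m, 0) 1)" by simp
    also have "\<dots> = W_gens L \<phi> \<psi> (j m)" by (simp add: dmon_def)
    finally show "dconst (Poly_Mapping.lookup P m) * dmon (\<lambda>(j, n). (dD ^^ n) (W_gens L \<phi> \<psi> j)) m =
        dconst (Poly_Mapping.lookup P m) * W_gens L \<phi> \<psi> (j m)" by (simp only:)
  qed
  finally have "g = (\<Sum>m\<in>Poly_Mapping.keys P. dconst (Poly_Mapping.lookup P m) * W_gens L \<phi> \<psi> (j m))" .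
  moreover have "\<forall>m\<in>Poly_Mapping.keys P. j m \<in> I_AU \<and> gen_weight (j m, 0) = \<Delta>"
    using j by blast
  ultimately show ?thesis by (intro exI conjI)
qed

text \<open>An element of the kernel, expanded in the basis \<open>S\<close>, is a linear relation
  among generators and so the zero polynomial; its partial derivatives are the coefficients.\<close>

lemma generator_map_inj:
  assumes lin: "Vector_Spaces.linear scale dscale F" and S: "is_basis scale S id W" "subspace W"
    and C: "inj C" "\<And>s. s \<in> S \<Longrightarrow> C s \<in> I_AU" "\<And>s. W_gens L \<phi> \<psi> (C s) = F s"
  shows "inj_on F W"
proof (rule inj_onI)
  interpret F: Vector_Spaces.linear scale dscale F by (rule lin)
  fix a b assume ab: "a \<in> W" "b \<in> W" "F a = F b"
  then have "a - b \<in> W" using S(2) by (intro subspace_diff)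
  then obtain r where r: "a - b = (\<Sum>s\<in>S. scale (r s) (id s))" using basis_expansion[OF S(1)] by blast
  define P where "P = (\<Sum>s\<in>S. dconst (r s) * dvar (C s, 0 :: nat))"
  have "dvars (dconst (r s) * dvar (C s, 0 :: nat)) \<subseteq> I_AU \<times> UNIV" if "s \<in> S" for s
    using dvars_mult[of "dconst (r s)" "dvar (C s, 0)"] C(2)[OF that] by auto
  then have "dvars P \<subseteq> I_AU \<times> UNIV"
    unfolding P_def by (intro order_trans[OF dvars_sum] UN_least)
  moreover have "diff_hom (W_gens L \<phi> \<psi>) P = F (a - b)"
    by (simp add: P_def diff_hom_sum diff_hom_mult C(3) r F.sum F.scale dscale_def)
  ultimately have "P = 0" using W_structure ab(3) unfolding diff_polys_in_def by (simp add: F.diff)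
  have fin: "finite S" by (rule finite_basis[OF S(1)])
  have "r t = 0" if t: "t \<in> S" for t
  proof -
    have "dpartial (C t, 0) P = (\<Sum>s\<in>S. if s = t then dconst (r s) else 0)"
      unfolding P_def dpartial_sum
      by (intro sum.cong refl) (auto simp: dpartial_mult dpartial_var inj_eq[OF C(1)])
    also have "\<dots> = dconst (r t)" using fin t by simp
    finally show ?thesis using \<open>P = 0\<close> by (simp add: dconst_eq_0_iff)
  qed
  then have "a - b = 0" unfolding r by simp
  then show "a = b" by simp
qed

lemma bij_phi: "bij_betw \<phi> g0f (W_weight scale lb \<kappa> bas x f br 1)"
  unfolding bij_betw_def
proof (intro conjI equalityI subsetI)
  show "inj_on \<phi> g0f"
    by (rule generator_map_inj[OF linear_phi basis_A subspace_g0f, of Gen_phi]) (auto intro: injI)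
  fix g assume "g \<in> \<phi> ` g0f"
  then obtain a where a: "a \<in> g0f" "g = \<phi> a" by blast
  then have "a \<in> gr 0" by (simp add: centralizer_eq)
  then show "g \<in> W_weight scale lb \<kappa> bas x f br 1"
    by (simp add: a(2) W_weight_def W_alg_eq \<phi>_V kill_phi[OF a(1)] phi_weight)
next
  fix g assume g: "g \<in> W_weight scale lb \<kappa> bas x f br 1"
  have "0 < (1 :: rat)" "1 < (2 :: rat)" by simp_all
  from weight_less_2[OF g this]
  obtain M :: "('g gen_index \<times> nat \<Rightarrow>\<^sub>0 nat) set" and r j
    where gj: "g = (\<Sum>m\<in>M. dconst (r m) * W_gens L \<phi> \<psi> (j m)) \<and>
      (\<forall>m\<in>M. j m \<in> I_AU \<and> gen_weight (j m, 0) = 1)"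
    by (elim exE)
  note g = gj[THEN conjunct1] and j = gj[THEN conjunct2]
  have "\<exists>a\<in>g0f. j m = Gen_phi a" if "m \<in> M" for m
    using bspec[OF j that] basis_in[OF basis_A] by (auto simp: gen_weight_def)
  then obtain b where b: "\<And>m. m \<in> M \<Longrightarrow> b m \<in> g0f \<and> j m = Gen_phi (b m)" by metis
  then have "g = (\<Sum>m\<in>M. dconst (r m) * \<phi> (b m))" by (simp add: g)
  then show "g \<in> \<phi> ` g0f"
    using linear_combination[OF linear_phi _ subspace_g0f, of M b r] b by simp
qed

lemma bij_psi: "bij_betw \<psi> (gr (-(1/2))) (W_weight scale lb \<kappa> bas x f br (3/2))"
  unfolding bij_betw_def
proof (intro conjI equalityI subsetI)
  show "inj_on \<psi> (gr (-(1/2)))"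
    by (rule generator_map_inj[OF linear_psi basis_U subspace_gr, of Gen_psi]) (auto intro: injI)
  fix g assume "g \<in> \<psi> ` gr (-(1/2))"
  then obtain u where u: "u \<in> gr (-(1/2))" "g = \<psi> u" by blast
  then show "g \<in> W_weight scale lb \<kappa> bas x f br (3/2)"
    by (simp only: u(2) W_weight_def W_alg_eq Int_iff mem_Collect_eq \<psi>_V[OF u(1)] kill_psi[OF u(1)] psi_weight[OF u(1)])
next
  fix g assume g: "g \<in> W_weight scale lb \<kappa> bas x f br (3/2)"
  have "0 < (3/2 :: rat)" "3/2 < (2 :: rat)" by simp_all
  from weight_less_2[OF g this]
  obtain M :: "('g gen_index \<times> nat \<Rightarrow>\<^sub>0 nat) set" and r j
    where gj: "g = (\<Sum>m\<in>M. dconst (r m) * W_gens L \<phi> \<psi> (j m)) \<and>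
      (\<forall>m\<in>M. j m \<in> I_AU \<and> gen_weight (j m, 0) = 3/2)"
    by (elim exE)
  note g = gj[THEN conjunct1] and j = gj[THEN conjunct2]
  have "\<exists>u\<in>gr (-(1/2)). j m = Gen_psi u" if "m \<in> M" for m
    using bspec[OF j that] U_gr by (auto simp: gen_weight_def)
  then obtain b where b: "\<And>m. m \<in> M \<Longrightarrow> b m \<in> gr (-(1/2)) \<and> j m = Gen_psi (b m)" by metis
  then have "g = (\<Sum>m\<in>M. dconst (r m) * \<psi> (b m))" by (simp add: g)
  then show "g \<in> \<psi> ` gr (-(1/2))"
    using linear_combination[OF linear_psi _ subspace_gr, of M b _ r] b by simp
qed

end

lemma basis_of_subspace:
  assumes "subspace W"
  shows "\<exists>B. is_basis scale B id W"
proof -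
  obtain B where B: "B \<subseteq> W" "independent B" "W \<subseteq> span B"
    by (rule maximal_independent_subset[of W])
  then have "span B = W" using span_minimal[OF B(1) assms] by blast
  with B(2) have "is_basis scale B id W" by (simp add: is_basis_def)
  then show ?thesis ..
qed

theorem minimal_W_structure:
  "Vector_Spaces.linear scale dscale \<phi> \<and>
   bij_betw \<phi> g0f (W_weight scale lb \<kappa> bas x f br 1) \<and>
   Vector_Spaces.linear scale dscale \<psi> \<and>
   bij_betw \<psi> (gr (-(1/2))) (W_weight scale lb \<kappa> bas x f br (3/2)) \<and>
   (\<forall>A U. is_basis scale A id g0f \<and> is_basis scale U id (gr (-(1/2))) \<longrightarrow>
     diff_polys_in (W_alg scale lb \<kappa> bas x f br) ({Gen_L} \<union> Gen_phi ` A \<union> Gen_psi ` U) (W_gens L \<phi> \<psi>))"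
proof -
  \<comment> \<open>The bijectivity statements mention no bases, but their proofs use the structure
    of W relative to some, so a pair is chosen.\<close>
  obtain A U where "is_basis scale A id g0f" "is_basis scale U id (gr (-(1/2)))"
    using basis_of_subspace[OF subspace_g0f] basis_of_subspace[OF subspace_gr] by blast
  then show ?thesis
    using linear_phi linear_psi bij_phi bij_psi W_structure by blast
qed

end

theorem theorem4p2:
  fixes scale :: "'k::{alg_closed_field, field_char_0} \<Rightarrow> 'g::ab_group_add \<Rightarrow> 'g"
    and lb :: "'g \<Rightarrow> 'g \<Rightarrow> 'g"
    and \<kappa> :: "'g \<Rightarrow> 'g \<Rightarrow> 'k"
    and e x f :: 'g
    and bas :: "'i::finite \<Rightarrow> 'g"
    and a a' :: "'p \<Rightarrow> 'g" and J0 :: "'p set"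
    and v v' :: "'q \<Rightarrow> 'g" and J :: "'q set"
    and z :: 'k
    and br :: "('i, 'k) dpoly \<Rightarrow> ('i, 'k) dpoly \<Rightarrow> ('i, 'k) dpoly poly"
  assumes simple: "simple_lie scale lb"
    and bas: "is_basis scale UNIV bas UNIV"
    and form: "invariant_form scale lb \<kappa>"
    and triple: "sl2_triple lb e x f"
    and minimal: "minimal_nilpotent scale lb f"
    and basis_a: "is_basis scale J0 a (grade scale lb x 0)"
    and basis_a': "is_basis scale J0 a' (grade scale lb x 0)"
    and dual_a: "\<And>i j. i \<in> J0 \<Longrightarrow> j \<in> J0 \<Longrightarrow> \<kappa> (a i) (a' j) = (if i = j then 1 else 0)"
    and basis_v: "is_basis scale J v (grade scale lb x (1/2))"
    and basis_v': "is_basis scale J v' (grade scale lb x (1/2))"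
    and dual_v: "\<And>h k. h \<in> J \<Longrightarrow> k \<in> J \<Longrightarrow> \<kappa> f (lb (v h) (v' k)) = (if h = k then 1 else 0)"
    and bracket: "is_lambda_bracket scale lb \<kappa> bas e z br"
  shows "let \<iota> = emb scale bas;
             L = W_L \<iota> lb x f J0 a a' J v v';
             \<phi> = W_phi \<iota> lb J v v';
             \<psi> = W_psi \<iota> lb e J v v';
             g0f = g0_centralizer scale lb x f;
             gm = grade scale lb x (-1/2)
         in Vector_Spaces.linear scale dscale \<phi> \<and>
            bij_betw \<phi> g0f (W_weight scale lb \<kappa> bas x f br 1) \<and>
            Vector_Spaces.linear scale dscale \<psi> \<and>
            bij_betw \<psi> gm (W_weight scale lb \<kappa> bas x f br (3/2)) \<and>
            (\<forall>A U. is_basis scale A id g0f \<and> is_basis scale U id gm \<longrightarrow>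
               diff_polys_in (W_alg scale lb \<kappa> bas x f br)
                 ({Gen_L} \<union> Gen_phi ` A \<union> Gen_psi ` U) (W_gens L \<phi> \<psi>))"
proof -
  interpret lie_algebra scale lb using simple by (simp add: simple_lie_def)
  interpret invariant_lie scale lb \<kappa> by unfold_locales (rule form)
  have "finite (range bas)" "span (range bas) = UNIV" using bas by (simp_all add: is_basis_def)
  from minimal_nilpotent_square[OF this minimal]
  interpret minimal_W scale lb \<kappa> e x f bas a a' J0 v v' J z br
    using triple minimal bas basis_a basis_a' dual_a basis_v basis_v' dual_v bracket
    by unfold_locales (auto simp: minimal_nilpotent_def)
  show ?thesis using minimal_W_structure unfolding Let_def by simp
qed

end
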